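(* Let $f(u)=u^3+\beta u^5+f_5(u)$ with $\beta<0$, where $f_5:\mathbb{R}\to\mathbb{R}$ is of class $C^5$ and $\lim_{s\to0}f_5(s)/|s|^5=0$. Let $$u\in C(\mathbb{R}:H^{1,1/2}(\mathbb{R}))\cap L^\infty(\mathbb{R}:H^1(\mathbb{R}))$$ be a non-trivial (i.e. not identically zero) real-valued strong solution of $$\partial_t u+\partial_x(\partial_x^2u+f(u))=0,\qquad (t,x)\in\mathbb{R}\times\mathbb{R},$$ with initial data $u(0,\cdot)=u_0$ such that $I_3(u)=I_3(u_0)\ge0$. There exists a small $\epsilon=\epsilon(f_5;\beta;I_3(u_0))>0$ (depending only on $f_5$, $\beta$ and the value $I_3(u_0)$) such that if $$\sup_{t\in\mathbb{R}}\|u(t)\|_{H^1}<\epsilon,$$ then $u=u(t,x)$ is not a time periodic solution (i.e. there is no $\omega>0$ with $u(t+\omega,x)=u(t,x)$ for all $t,x$). The same conclusion applies if instead $\beta>0$ and the initial data satisfies $I_3(u_0)\le0$.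
   Context: For $s,r\ge 0$, $H^{s,r}(\mathbb{R}):=H^s(\mathbb{R})\cap L^2(|x|^{2r}dx)$. The energy (a conserved quantity of the equation) is $$I_3(u):=\int_{-\infty}^{\infty}\Big(\tfrac12(\partial_xu)^2-G(u)\Big)(t,x)\,dx=I_3(u_0),\qquad G(x)=\int_0^xf(s)\,ds.$$ "Strong solution" of the initial value problem has its standard meaning: $u$ is a continuous function of time with values in the stated space and satisfies the equation with this initial datum. *)

theory Defs
  imports "HOL-Analysis.Analysis"
begin

definition C_k :: "nat \<Rightarrow> (real \<Rightarrow> real) \<Rightarrow> bool" where
  "C_k n f \<longleftrightarrow>
     (\<forall>i<n. \<forall>x. (deriv ^^ i) f differentiable (at x)) \<and> continuous_on UNIV ((deriv ^^ n) f)"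

definition test_function :: "(real \<Rightarrow> real) \<Rightarrow> bool" where
  "test_function \<phi> \<longleftrightarrow> (\<forall>n. C_k n \<phi>) \<and> compact (closure {x. \<phi> x \<noteq> 0})"

text \<open>
  Elements of the function spaces below are represented by Borel functions on the line;
  functions that agree almost everywhere represent the same element. Statements about
  such elements are therefore always made almost everywhere.
\<close>

definition locally_integrable :: "(real \<Rightarrow> real) \<Rightarrow> bool" where
  "locally_integrable g \<longleftrightarrow>
     g \<in> borel_measurable lborel \<and> (\<forall>K. compact K \<longrightarrow> set_integrable lborel K g)"

definition has_weak_deriv :: "(real \<Rightarrow> real) \<Rightarrow> (real \<Rightarrow> real) \<Rightarrow> bool" where
  "has_weak_deriv v g \<longleftrightarrow>
     locally_integrable v \<and> locally_integrable g \<and>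
     (\<forall>\<phi>. test_function \<phi> \<longrightarrow>
        (\<integral>x. v x * deriv \<phi> x \<partial>lborel) = - (\<integral>x. g x * \<phi> x \<partial>lborel))"

text \<open>The weak derivative is unique up to null sets; the choice is immaterial under integrals.\<close>

definition weak_deriv :: "(real \<Rightarrow> real) \<Rightarrow> real \<Rightarrow> real" where
  "weak_deriv v = (SOME g. has_weak_deriv v g)"

definition L2 :: "(real \<Rightarrow> real) set" where
  "L2 = {v. v \<in> borel_measurable lborel \<and> integrable lborel (\<lambda>x. (v x)\<^sup>2)}"

definition H1 :: "(real \<Rightarrow> real) set" where
  "H1 = {v \<in> L2. \<exists>g \<in> L2. has_weak_deriv v g}"

definition H1_norm :: "(real \<Rightarrow> real) \<Rightarrow> real" where
  "H1_norm v = sqrt ((\<integral>x. (v x)\<^sup>2 \<partial>lborel) + (\<integral>x. (weak_deriv v x)\<^sup>2 \<partial>lborel))"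

text \<open>\<open>H1_weighted r\<close> is $H^{1,r} = H^1 \cap L^2(|x|^{2r}dx)$, with the norm of the intersection.\<close>

definition H1_weighted :: "real \<Rightarrow> (real \<Rightarrow> real) set" where
  "H1_weighted r = {v \<in> H1. integrable lborel (\<lambda>x. \<bar>x\<bar> powr (2 * r) * (v x)\<^sup>2)}"

definition H1_weighted_norm :: "real \<Rightarrow> (real \<Rightarrow> real) \<Rightarrow> real" where
  "H1_weighted_norm r v =
     sqrt ((H1_norm v)\<^sup>2 + (\<integral>x. \<bar>x\<bar> powr (2 * r) * (v x)\<^sup>2 \<partial>lborel))"

definition continuous_in_H1_weighted :: "real \<Rightarrow> (real \<Rightarrow> real \<Rightarrow> real) \<Rightarrow> bool" where
  "continuous_in_H1_weighted r u \<longleftrightarrow>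
     (\<forall>t. u t \<in> H1_weighted r) \<and>
     (\<forall>t. ((\<lambda>s. H1_weighted_norm r (\<lambda>x. u s x - u t x)) \<longlongrightarrow> 0) (at t))"

text \<open>Since \<open>u\<close> is continuous in time with values in $H^1$, the supremum over all times is the
  norm of $L^\infty(\mathbb{R}:H^1)$.\<close>

definition bounded_in_H1 :: "(real \<Rightarrow> real \<Rightarrow> real) \<Rightarrow> bool" where
  "bounded_in_H1 u \<longleftrightarrow> (\<forall>t. u t \<in> H1) \<and> bdd_above (range (\<lambda>t. H1_norm (u t)))"

text \<open>
  The equation $\partial_t u = - \partial_x (\partial_x^2 u + f(u))$ at every time, in the sense of
  distributions in $x$; all three space derivatives are moved to the test function.
\<close>

definition satisfies_gKdV :: "(real \<Rightarrow> real) \<Rightarrow> (real \<Rightarrow> real \<Rightarrow> real) \<Rightarrow> bool" where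
  "satisfies_gKdV f u \<longleftrightarrow>
     (\<forall>\<phi> t. test_function \<phi> \<longrightarrow>
        ((\<lambda>s. \<integral>x. u s x * \<phi> x \<partial>lborel) has_real_derivative
           (\<integral>x. u t x * (deriv ^^ 3) \<phi> x + f (u t x) * deriv \<phi> x \<partial>lborel)) (at t))"

definition strong_solution ::
  "real \<Rightarrow> (real \<Rightarrow> real) \<Rightarrow> (real \<Rightarrow> real) \<Rightarrow> (real \<Rightarrow> real \<Rightarrow> real) \<Rightarrow> bool" where
  "strong_solution r f u0 u \<longleftrightarrow>
     u0 \<in> H1_weighted r \<and> continuous_in_H1_weighted r u \<and> satisfies_gKdV f u \<and>
     (AE x in lborel. u 0 x = u0 x)"

text \<open>The interval integral is oriented, so this is also the intended primitive at negative \<open>y\<close>.\<close>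

definition primitive0 :: "(real \<Rightarrow> real) \<Rightarrow> real \<Rightarrow> real" where
  "primitive0 f y = (LBINT s=ereal 0..ereal y. f s)"

definition I3 :: "(real \<Rightarrow> real) \<Rightarrow> (real \<Rightarrow> real) \<Rightarrow> real" where
  "I3 f v = (\<integral>x. (weak_deriv v x)\<^sup>2 / 2 - primitive0 f (v x) \<partial>lborel)"

definition time_periodic :: "(real \<Rightarrow> real \<Rightarrow> real) \<Rightarrow> bool" where
  "time_periodic u \<longleftrightarrow> (\<exists>\<omega>>0. \<forall>t. AE x in lborel. u (t + \<omega>) x = u t x)"

end

theory Submission
  imports Defs
begin

text \<open>
  For a solution with $|x|^{1/2} u \in L^2$ the virial $\int x u^2$ formally satisfies
  $\frac{d}{dt} \int x u^2 = -3 \int u_x^2 + 2 \int (u f(u) - G(u)) = -6 I_3(u) + \int (2 u f(u) - 8 G(u))$.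
  The cubic part of $f$ cancels in $2 y f(y) - 8 G(y) = \frac{2}{3} \beta y^6 + o(y^6)$, so for small
  solutions the right-hand side has the sign of $\beta$, and $\int x u^2$ is strictly monotone.

  The regularity $H^1$ does not suffice to differentiate $\int x u^2$. It is replaced by the double
  integral of $u(x) u(y)$ against $K(x, y) = \frac{x + y}{2} \rho_N(x - y)$, where $\rho_N$ is an even
  mollifier: for each $y$ this is a test function of $x$ with no cut-off in space, and since
  $(\partial_x^3 + \partial_y^3) K = 3 \rho_N''(x - y)$ the weight disappears from the dispersive term. The
  derivative of the regularised virial integrates to zero over a period; it is bounded uniformly in $N$
  and converges for each time as $N \to \infty$, so the limit also integrates to zero although it has a sign.
\<close>

section \<open>Compactly supported smooth functions\<close>

text \<open>The equation is available only against test functions of x, and x itself is not one.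
  Fixing y and testing with K(x, y) respects this. The growth of K is shared equally between u(x)
  and u(y), which is exactly what the integrability of |x|^(1/2) u pays for. Symmetry of K lets the
  derivative of the quadratic form be read off from the linear one. The nonlinear term keeps a
  factor x. It is harmless because f is cubic near 0: sqrt (1 + |x|) u^2 is bounded by the weighted
  norm and the norm of the derivative, so x f(u) lies in L2. The energy eliminates the integral of
  u_x^2 and enters through its sign: sgn \<beta> times it is nonpositive in both cases. Smallness in
  H^1 puts the values of u into [-\<delta>, \<delta>], where the y^6 term dominates; \<delta> comes
  from f5 and \<beta> alone, and \<epsilon> = \<delta>/2. Pointwise bounds and integration by parts
  refer to a continuous representative with an integrable derivative; it is constructed by
  mollification from the bare definition of weak derivatives.\<close>

definition bump_fun :: "real poly \<Rightarrow> nat \<Rightarrow> real \<Rightarrow> real" where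
  "bump_fun P k x =
     (if \<bar>x\<bar> < 1 then poly P x / (1 - x\<^sup>2) ^ k * exp (- (1 / (1 - x\<^sup>2))) else 0)"

text \<open>The single term of index k + 2 in the series of exp (1/w), with w = 1 - x^2, already
  beats the pole w^(-k) and leaves a factor w^2. Vanishing to second order at the endpoints is what
  later makes the derivative there zero.\<close>

lemma bump_fun_boundary_bound:
  obtains C where "0 \<le> C" "\<And>x. \<bar>bump_fun P k x\<bar> \<le> C * (1 - x\<^sup>2)\<^sup>2"
proof -
  have "bounded (poly P ` {-1..1})"
    by (intro compact_imp_bounded compact_continuous_image continuous_intros) auto
  then obtain M where M: "\<And>x. x \<in> {-1..1} \<Longrightarrow> \<bar>poly P x\<bar> \<le> M"
    unfolding bounded_iff by (metis imageI real_norm_def)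
  have M0: "0 \<le> M" using M[of 0] by auto
  have "\<bar>bump_fun P k x\<bar> \<le> (M * fact (k + 2)) * (1 - x\<^sup>2)\<^sup>2" for x
  proof (cases "\<bar>x\<bar> < 1")
    case True
    define w where "w = 1 - x\<^sup>2"
    have w: "0 < w" using True by (simp add: w_def abs_square_less_1)
    define c :: real where "c = fact (k + 2)"
    have c: "0 < c" unfolding c_def by (rule fact_gt_zero)
    have "(\<Sum>n\<in>{k+2}. (1 / w) ^ n /\<^sub>R fact n) \<le> exp (1 / w)"
      unfolding exp_def by (rule sum_le_suminf) (use w summable_exp[of "1 / w"] in \<open>auto\<close>)
    then have "(1 / w) ^ (k + 2) / c \<le> exp (1 / w)"
      unfolding c_def by (simp only: sum.insert_if sum.empty finite.emptyI real_scaleR_def divide_inverse mult.commute) simp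
    then have "1 / w ^ k * exp (- (1 / w)) \<le> c * w\<^sup>2"
      using w c by (simp add: exp_minus field_simps power2_eq_square)
    then have "1 / w ^ k * exp (- (1 / w)) \<le> fact (k + 2) * w\<^sup>2"
      unfolding c_def .
    then have "\<bar>poly P x\<bar> * (1 / w ^ k * exp (- (1 / w))) \<le> M * (fact (k + 2) * w\<^sup>2)"
      using M[of x] True w M0 by (intro mult_mono[OF _ _ M0]) (auto simp: abs_less_iff)
    then show ?thesis
      using True w unfolding bump_fun_def w_def[symmetric] by (simp add: abs_mult mult.assoc)
  next
    case False
    then show ?thesis using M0 by (simp add: bump_fun_def)
  qed
  then show ?thesis using that[of "M * fact (k + 2)"] M0 by simp
qed

text \<open>Numerator over w^(k+2), with w = 1 - x^2, of the derivative of P w^(-k) exp (-1/w): the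
  summands come from P, from the power and from the exponential. The family \<open>bump_fun\<close>
  is thereby closed under differentiation.\<close>

definition bump_deriv_poly :: "real poly \<Rightarrow> nat \<Rightarrow> real poly" where
  "bump_deriv_poly P k = pderiv P * [:1, 0, -1:]\<^sup>2
     + smult (2 * real k) ([:0, 1:] * P * [:1, 0, -1:]) - smult 2 ([:0, 1:] * P)"

lemma has_real_derivative_bump_fun:
  "(bump_fun P k has_real_derivative bump_fun (bump_deriv_poly P k) (k + 2) x) (at x)"
proof (cases "\<bar>x\<bar> < 1")
  case True
  define w where "w = 1 - x\<^sup>2"
  have w: "0 < w" using True by (simp add: w_def abs_square_less_1)
  have "((\<lambda>x. poly P x / (1 - x\<^sup>2) ^ k * exp (- (1 / (1 - x\<^sup>2)))) has_real_derivative
      bump_fun (bump_deriv_poly P k) (k + 2) x) (at x)"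
  proof -
    have "((\<lambda>x. poly P x / (1 - x\<^sup>2) ^ k * exp (- (1 / (1 - x\<^sup>2)))) has_real_derivative
      ((poly (pderiv P) x * w ^ k - poly P x * (real k * w ^ (k - 1) * (- (2 * x)))) / (w ^ k * w ^ k)) * exp (- (1 / w))
       + poly P x / w ^ k * (exp (- (1 / w)) * (- (2 * x / (w * w))))) (at x)"
      unfolding w_def using w[unfolded w_def]
      by (auto intro!: derivative_eq_intros simp: power2_eq_square divide_simps) (simp add: algebra_simps)?
    moreover have "((poly (pderiv P) x * w ^ k - poly P x * (real k * w ^ (k - 1) * (- (2 * x)))) / (w ^ k * w ^ k)) * exp (- (1 / w))
       + poly P x / w ^ k * (exp (- (1 / w)) * (- (2 * x / (w * w))))
       = bump_fun (bump_deriv_poly P k) (k + 2) x"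
    proof -
      have k: "real k * w ^ (k - 1) = real k * w ^ k / w" using w by (cases k) auto
      have "poly (bump_deriv_poly P k) x = poly (pderiv P) x * w\<^sup>2 + 2 * real k * x * poly P x * w - 2 * x * poly P x"
        by (simp add: bump_deriv_poly_def w_def power2_eq_square algebra_simps)
      then show ?thesis using True w unfolding bump_fun_def w_def[symmetric] k
        by (simp add: divide_simps power_add power2_eq_square) (simp add: algebra_simps)
    qed
    ultimately show ?thesis by simp
  qed
  then show ?thesis
    by (rule has_field_derivative_transform_within_open[where S = "{-1<..<1}"])
       (use True in \<open>auto simp: bump_fun_def abs_less_iff\<close>)
next
  case False
  obtain C where C: "0 \<le> C" "\<And>x. \<bar>bump_fun P k x\<bar> \<le> C * (1 - x\<^sup>2)\<^sup>2"
    using bump_fun_boundary_bound by blast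
  \<comment> \<open>For |x| >= 1 the inside points satisfy 1 - |y| <= |y - x|, so (1 - y^2)^2 is
    O((y - x)^2). This settles the endpoints and the exterior at once.\<close>
  have b: "\<bar>bump_fun P k y\<bar> \<le> 4 * C * \<bar>y - x\<bar>\<^sup>2" for y
  proof (cases "\<bar>y\<bar> < 1")
    case True
    have "\<bar>1 - y\<^sup>2\<bar> = (1 - \<bar>y\<bar>) * (1 + \<bar>y\<bar>)" using True abs_square_less_1[of y]
      by (simp add: algebra_simps power2_eq_square abs_if)
    also have "\<dots> \<le> \<bar>y - x\<bar> * 2" using True False by (intro mult_mono) auto
    finally have "(1 - y\<^sup>2)\<^sup>2 \<le> (\<bar>y - x\<bar> * 2)\<^sup>2" by (metis abs_ge_zero power2_abs power_mono)
    then have "C * (1 - y\<^sup>2)\<^sup>2 \<le> C * (\<bar>y - x\<bar> * 2)\<^sup>2" using C(1) by (rule mult_left_mono)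
    then show ?thesis using C(2)[of y] by (simp add: power_mult_distrib)
  next
    case False then show ?thesis using C by (simp add: bump_fun_def)
  qed
  have 0: "bump_fun Q j x = 0" for Q j using False by (simp add: bump_fun_def)
  have "((\<lambda>y. (bump_fun P k y - bump_fun P k x) / (y - x)) \<longlongrightarrow> 0) (at x)"
  proof (rule Lim_null_comparison)
    show "\<forall>\<^sub>F y in at x. norm ((bump_fun P k y - bump_fun P k x) / (y - x)) \<le> 4 * C * \<bar>y - x\<bar>"
      using b by (auto simp: eventually_at_filter 0 divide_le_eq power2_eq_square mult.assoc)
    show "((\<lambda>y. 4 * C * \<bar>y - x\<bar>) \<longlongrightarrow> 0) (at x)"
      by (auto intro!: tendsto_eq_intros)
  qed
  then show ?thesis by (simp add: has_field_derivative_iff 0)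
qed

lemma bump_fun_zero: "1 \<le> \<bar>x\<bar> \<Longrightarrow> bump_fun P k x = 0"
  by (simp add: bump_fun_def)

lemma bump_fun_smult: "bump_fun (smult c P) k x = c * bump_fun P k x"
  by (simp add: bump_fun_def)

lemma continuous_on_bump_fun: "continuous_on S (bump_fun P k)"
  by (meson DERIV_isCont continuous_at_imp_continuous_on has_real_derivative_bump_fun)

text \<open>Smoothness of every order follows without computing higher derivatives: each one is
  again in the family, the chain-rule factor c being absorbed into the polynomial.\<close>

lemma deriv_funpow_bump_fun_affine:
  "\<exists>Q j. (deriv ^^ i) (\<lambda>x. bump_fun P k (c * x + d)) = (\<lambda>x. bump_fun Q j (c * x + d))"
proof (induction i)
  case 0
  show ?case by auto
next
  case (Suc i)
  then obtain Q j where Q: "(deriv ^^ i) (\<lambda>x. bump_fun P k (c * x + d)) = (\<lambda>x. bump_fun Q j (c * x + d))"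
    by blast
  have "deriv (\<lambda>x. bump_fun Q j (c * x + d)) =
      (\<lambda>x. bump_fun (smult c (bump_deriv_poly Q j)) (j + 2) (c * x + d))"
  proof
    fix x
    have "((\<lambda>x. bump_fun Q j (c * x + d)) has_real_derivative
       bump_fun (bump_deriv_poly Q j) (j + 2) (c * x + d) * c) (at x)"
      by (rule DERIV_chain2[OF has_real_derivative_bump_fun]) (auto intro!: derivative_eq_intros)
    then show "deriv (\<lambda>x. bump_fun Q j (c * x + d)) x = bump_fun (smult c (bump_deriv_poly Q j)) (j + 2) (c * x + d)"
      by (simp add: DERIV_imp_deriv bump_fun_smult mult.commute)
  qed
  then show ?case using Q by auto
qed

lemma test_function_bump_fun_affine:
  assumes "c \<noteq> 0"
  shows "test_function (\<lambda>x. bump_fun P k (c * x + d))"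
proof -
  have "C_k n (\<lambda>x. bump_fun P k (c * x + d))" for n
    unfolding C_k_def
  proof (intro conjI allI impI)
    fix i x
    obtain Q j where Q: "(deriv ^^ i) (\<lambda>x. bump_fun P k (c * x + d)) = (\<lambda>x. bump_fun Q j (c * x + d))"
      using deriv_funpow_bump_fun_affine by blast
    have "((\<lambda>x. bump_fun Q j (c * x + d)) has_real_derivative
       bump_fun (bump_deriv_poly Q j) (j + 2) (c * x + d) * c) (at x)"
      by (rule DERIV_chain2[OF has_real_derivative_bump_fun]) (auto intro!: derivative_eq_intros)
    then show "(deriv ^^ i) (\<lambda>x. bump_fun P k (c * x + d)) differentiable at x"
      unfolding Q using real_differentiable_def by blast
  next
    obtain Q j where Q: "(deriv ^^ n) (\<lambda>x. bump_fun P k (c * x + d)) = (\<lambda>x. bump_fun Q j (c * x + d))"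
      using deriv_funpow_bump_fun_affine by blast
    show "continuous_on UNIV ((deriv ^^ n) (\<lambda>x. bump_fun P k (c * x + d)))"
      unfolding Q by (intro continuous_on_compose2[OF continuous_on_bump_fun[of UNIV]] continuous_intros) auto
  qed
  moreover have "compact (closure {x. bump_fun P k (c * x + d) \<noteq> 0})"
  proof -
    have "{x. bump_fun P k (c * x + d) \<noteq> 0} \<subseteq> cball (- d / c) (1 / \<bar>c\<bar>)"
    proof
      fix x assume "x \<in> {x. bump_fun P k (c * x + d) \<noteq> 0}"
      then have "\<bar>c * x + d\<bar> < 1" by (auto simp: bump_fun_def split: if_splits)
      moreover have "\<bar>c * x + d\<bar> = \<bar>c\<bar> * \<bar>- d / c - x\<bar>" using assms
        by (simp add: abs_mult[symmetric] algebra_simps abs_minus_commute)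
      ultimately show "x \<in> cball (- d / c) (1 / \<bar>c\<bar>)"
        using assms by (simp add: dist_real_def field_simps)
    qed
    then show ?thesis
      by (meson bounded_cball bounded_subset compact_closure)
  qed
  ultimately show ?thesis by (simp add: test_function_def)
qed

section \<open>Continuity of translations\<close>

lemma borel_translate: "A \<in> sets borel \<Longrightarrow> {x. x + h \<in> A} \<in> sets borel" for h :: real
proof -
  assume "A \<in> sets borel"
  then have "(\<lambda>x. x + h) -` A \<inter> space borel \<in> sets borel"
    by (intro measurable_sets) auto
  then show ?thesis by (simp add: vimage_def)
qed

lemma lborel_integral_translate:
  fixes f :: "real \<Rightarrow> real"
  shows "(LBINT x. f (x + h)) = (LBINT x. f x)"
  using lborel_integral_real_affine[of 1 f h] by (simp add: add.commute)

lemma lborel_integrable_translate: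
  fixes f :: "real \<Rightarrow> real"
  shows "integrable lborel f \<Longrightarrow> integrable lborel (\<lambda>x. f (x + h))"
  using lborel_integrable_real_affine[of f 1 h] by (simp add: add.commute)

text \<open>Limits along a real parameter such as a shift reduce to sequences, to which the usual
  dominated convergence theorem applies.\<close>

lemma integral_dominated_convergence_at:
  fixes s :: "real \<Rightarrow> 'a \<Rightarrow> real"
  assumes [measurable]: "f \<in> borel_measurable M" "\<And>h. s h \<in> borel_measurable M"
    and w: "integrable M w"
    and lim: "AE x in M. ((\<lambda>h. s h x) \<longlongrightarrow> f x) (at a)"
    and bound: "\<And>h. AE x in M. norm (s h x) \<le> w x"
  shows "((\<lambda>h. integral\<^sup>L M (s h)) \<longlongrightarrow> integral\<^sup>L M f) (at a)"
  unfolding tendsto_at_iff_sequentially comp_def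
proof (intro allI impI)
  fix X assume X: "\<forall>i. X i \<in> UNIV - {a}" "X \<longlonglongrightarrow> a"
  show "(\<lambda>i. integral\<^sup>L M (s (X i))) \<longlonglongrightarrow> integral\<^sup>L M f"
  proof (rule integral_dominated_convergence[OF _ _ w _ bound])
    show "AE x in M. (\<lambda>i. s (X i) x) \<longlonglongrightarrow> f x"
      using lim by eventually_elim (use X in \<open>auto simp: tendsto_at_iff_sequentially comp_def\<close>)
  qed auto
qed

text \<open>|1_A - 1_B| = 1_A + 1_B - 2 1_A 1_B reduces the claim to the product of indicators. The
  product vanishes off U for every shift, so convergence has to be checked only on U, where openness
  gives it; boundary points cause no trouble.\<close>

lemma translation_continuous_open:
  fixes U :: "real set"
  assumes U: "open U" and fin: "emeasure lborel U < \<infinity>"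
  shows "((\<lambda>h. LBINT x. \<bar>indicator U (x + h) - indicator U x\<bar>) \<longlongrightarrow> (0::real)) (at 0)"
proof -
  have U': "U \<in> sets borel" using U by auto
  have int: "integrable lborel (indicator U :: real \<Rightarrow> real)" using U' fin by simp
  have inth: "integrable lborel (\<lambda>x. indicator U (x + h) :: real)" for h
    by (rule lborel_integrable_translate[OF int])
  have intm: "integrable lborel (\<lambda>x. indicator U (x + h) * indicator U x :: real)" for h
    by (rule Bochner_Integration.integrable_bound[OF int])
       (use U' borel_translate[OF U', of h] in \<open>auto simp: indicator_def\<close>)
  have "((\<lambda>h. LBINT x. indicator U (x + h) * indicator U x) \<longlongrightarrow> (LBINT x. indicator U x :: real)) (at 0)"
  proof (rule integral_dominated_convergence_at)
    show "AE x in lborel. norm (indicator U (x + h) * indicator U x :: real) \<le> indicator U x" for h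
      by (auto simp: indicator_def)
    show "AE x in lborel. ((\<lambda>h. indicator U (x + h) * indicator U x :: real) \<longlongrightarrow> indicator U x) (at 0)"
    proof (rule AE_I2)
      fix x
      show "((\<lambda>h. indicator U (x + h) * indicator U x :: real) \<longlongrightarrow> indicator U x) (at 0)"
      proof (cases "x \<in> U")
        case True
        have "((\<lambda>h. x + h) \<longlongrightarrow> x) (at 0)" by (auto intro!: tendsto_eq_intros)
        then have "\<forall>\<^sub>F h in at 0. x + h \<in> U" using U True by (rule topological_tendstoD)
        then show ?thesis using True by (intro tendsto_eventually) (auto elim!: eventually_mono)
      qed simp
    qed
  qed (use int intm in auto)
  from tendsto_diff[OF tendsto_const[of "2 * (LBINT x. indicator U x :: real)"] tendsto_mult[OF tendsto_const[of 2] this]]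
  have "((\<lambda>h. 2 * (LBINT x. indicator U x) - 2 * (LBINT x. indicator U (x + h) * indicator U x :: real)) \<longlongrightarrow> 0) (at 0)"
    by simp
  moreover have "(LBINT x. \<bar>indicator U (x + h) - indicator U x\<bar> :: real) =
     2 * (LBINT x. indicator U x) - 2 * (LBINT x. indicator U (x + h) * indicator U x :: real)" for h
  proof -
    have "(LBINT x. \<bar>indicator U (x + h) - indicator U x\<bar> :: real) =
      (LBINT x. indicator U (x + h) + indicator U x - 2 * (indicator U (x + h) * indicator U x))"
      by (intro Bochner_Integration.integral_cong) (auto simp: indicator_def)
    also have "\<dots> = 2 * (LBINT x. indicator U x) - 2 * (LBINT x. indicator U (x + h) * indicator U x :: real)"
      using int inth intm lborel_integral_translate[of "indicator U" h] by simp
    finally show ?thesis .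
  qed
  ultimately show ?thesis by simp
qed

text \<open>Outer regularity replaces A by an open U. The excess U - A is counted twice, shifted and
  unshifted, hence the bound e/4 on its measure.\<close>

lemma translation_continuous_indicator:
  fixes A :: "real set"
  assumes A: "A \<in> sets borel" and fin: "emeasure lborel A < \<infinity>"
  shows "((\<lambda>h. LBINT x. \<bar>indicator A (x + h) - indicator A x\<bar>) \<longlongrightarrow> (0::real)) (at 0)"
proof (rule tendstoI)
  fix e :: real assume e: "0 < e"
  obtain U where U: "A \<subseteq> U" "open U" "emeasure lborel (U - A) < ennreal (e / 4)"
    using outer_regular_lborel[OF A, of "e / 4"] e by auto
  have U': "U \<in> sets borel" using U by auto
  have "emeasure lborel U \<le> emeasure lborel A + emeasure lborel (U - A)"
    using emeasure_subadditive[of A lborel "U - A"] A U' U(1) by (simp add: Un_absorb1)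
  also have "\<dots> < \<infinity>" using fin U(3) by (auto simp: less_top[symmetric])
  finally have finU: "emeasure lborel U < \<infinity>" .
  have D: "U - A \<in> sets borel" using U' A by auto
  have intU: "integrable lborel (indicator U :: real \<Rightarrow> real)" using U' finU by simp
  have intA: "integrable lborel (indicator A :: real \<Rightarrow> real)" using A fin by simp
  have intD: "integrable lborel (indicator (U - A) :: real \<Rightarrow> real)"
    using D U(3) by (simp add: order_less_trans[OF _ ennreal_less_top])
  have mD: "(LBINT x. indicator (U - A) x :: real) < e / 4"
  proof -
    have "emeasure lborel (U - A) = ennreal (measure lborel (U - A))"
      by (rule emeasure_eq_ennreal_measure) (use U(3) in auto)
    then show ?thesis using U(3) D e by (simp add: ennreal_less_iff)
  qed
  have "\<forall>\<^sub>F h in at 0. dist (LBINT x. \<bar>indicator U (x + h) - indicator U x\<bar>) (0::real) < e / 2"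
    using translation_continuous_open[OF U(2) finU] e by (intro tendstoD) auto
  then show "\<forall>\<^sub>F h in at 0. dist (LBINT x. \<bar>indicator A (x + h) - indicator A x\<bar>) (0::real) < e"
  proof (rule eventually_mono)
    fix h :: real
    assume h: "dist (LBINT x. \<bar>indicator U (x + h) - indicator U x\<bar>) (0::real) < e / 2"
    have "(LBINT x. \<bar>indicator A (x + h) - indicator A x\<bar> :: real) \<le>
      (LBINT x. indicator (U - A) (x + h) + indicator (U - A) x + \<bar>indicator U (x + h) - indicator U x\<bar>)"
    proof (rule integral_mono)
      show "integrable lborel (\<lambda>x. \<bar>indicator A (x + h) - indicator A x\<bar> :: real)"
        by (intro integrable_abs Bochner_Integration.integrable_diff lborel_integrable_translate[OF intA] intA)
      show "integrable lborel (\<lambda>x. indicator (U - A) (x + h) + indicator (U - A) x + \<bar>indicator U (x + h) - indicator U x\<bar> :: real)"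
        by (intro Bochner_Integration.integrable_add integrable_abs Bochner_Integration.integrable_diff
            lborel_integrable_translate[OF intU] lborel_integrable_translate[OF intD] intD intU)
    qed (use U(1) in \<open>auto simp: indicator_def\<close>)
    also have "\<dots> = 2 * (LBINT x. indicator (U - A) x) + (LBINT x. \<bar>indicator U (x + h) - indicator U x\<bar>)"
      using lborel_integrable_translate[OF intD, of h] intD intU lborel_integrable_translate[OF intU, of h]
        lborel_integral_translate[of "indicator (U - A)" h] by simp
    also have "\<dots> < e" using mD h by (simp add: dist_real_def)
    finally show "dist (LBINT x. \<bar>indicator A (x + h) - indicator A x\<bar>) (0::real) < e"
      by (simp add: dist_real_def)
  qed
qed

text \<open>Induction over integrable functions. In the limit case the approximants satisfy |s_n| <=
  2 |f|, so they converge in L1 with majorant 3 |f|; the translation error of f costs two such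
  approximations plus the translation error of one s_n.\<close>

proposition translation_continuous_L1:
  fixes f :: "real \<Rightarrow> real"
  assumes "integrable lborel f"
  shows "((\<lambda>h. LBINT x. \<bar>f (x + h) - f x\<bar>) \<longlongrightarrow> 0) (at 0)"
  using assms
proof (induction rule: integrable_induct)
  case (base A c)
  have "((\<lambda>h. \<bar>c\<bar> * (LBINT x. \<bar>indicator A (x + h) - indicator A x\<bar>)) \<longlongrightarrow> \<bar>c\<bar> * 0) (at 0)"
    by (intro tendsto_mult tendsto_const translation_continuous_indicator) (use base in auto)
  moreover have "(LBINT x. \<bar>indicator A (x + h) *\<^sub>R c - indicator A x *\<^sub>R c\<bar>) =
      \<bar>c\<bar> * (LBINT x. \<bar>indicator A (x + h) - indicator A x\<bar>)" for h
    by (subst Bochner_Integration.integral_mult_right_zero[symmetric], intro Bochner_Integration.integral_cong)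
       (auto simp: abs_mult[symmetric] algebra_simps)
  ultimately show ?case by simp
next
  case (add f g)
  note [simp] = lborel_integrable_translate add.hyps
  show ?case
  proof (rule Lim_null_comparison)
    show "\<forall>\<^sub>F h in at 0. norm (LBINT x. \<bar>f (x + h) + g (x + h) - (f x + g x)\<bar>) \<le>
       (LBINT x. \<bar>f (x + h) - f x\<bar>) + (LBINT x. \<bar>g (x + h) - g x\<bar>)"
    proof (intro always_eventually allI)
      fix h
      have "(LBINT x. \<bar>f (x + h) + g (x + h) - (f x + g x)\<bar>) \<le>
        (LBINT x. \<bar>f (x + h) - f x\<bar> + \<bar>g (x + h) - g x\<bar>)"
        by (intro integral_mono) auto
      then show "norm (LBINT x. \<bar>f (x + h) + g (x + h) - (f x + g x)\<bar>) \<le>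
       (LBINT x. \<bar>f (x + h) - f x\<bar>) + (LBINT x. \<bar>g (x + h) - g x\<bar>)"
        by simp
    qed
    show "((\<lambda>h. (LBINT x. \<bar>f (x + h) - f x\<bar>) + (LBINT x. \<bar>g (x + h) - g x\<bar>)) \<longlongrightarrow> 0) (at 0)"
      using tendsto_add[OF add.IH] by simp
  qed
next
  case (lim f s)
  note [simp] = lborel_integrable_translate lim.hyps
  have [measurable]: "f \<in> borel_measurable borel" "s n \<in> borel_measurable borel" for n
    using borel_measurable_integrable[OF lim.hyps(4)] borel_measurable_integrable[OF lim.hyps(1)] by auto
  have conv: "(\<lambda>n. LBINT x. \<bar>s n x - f x\<bar>) \<longlonglongrightarrow> (\<integral>x. 0 \<partial>(lborel :: real measure))"
  proof (rule integral_dominated_convergence[where w = "\<lambda>x. 3 * \<bar>f x\<bar>"])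
    show "AE x in lborel. (\<lambda>n. \<bar>s n x - f x\<bar>) \<longlonglongrightarrow> 0"
      using lim.hyps(2) by (auto intro!: tendsto_rabs_zero LIM_zero)
    show "AE x in lborel. norm \<bar>s n x - f x\<bar> \<le> 3 * \<bar>f x\<bar>" for n
    proof (rule AE_I2)
      fix x :: real
      have "\<bar>s n x\<bar> \<le> 2 * \<bar>f x\<bar>" using lim.hyps(3)[of x n] by simp
      then show "norm \<bar>s n x - f x\<bar> \<le> 3 * \<bar>f x\<bar>" by simp
    qed
  qed auto
  show ?case
  proof (rule tendstoI)
    fix e :: real assume e: "0 < e"
    then obtain n where n: "(LBINT x. \<bar>s n x - f x\<bar>) < e / 4"
      using tendstoD[OF conv, of "e / 4"] by (auto simp: dist_real_def eventually_sequentially)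
    have "\<forall>\<^sub>F h in at 0. dist (LBINT x. \<bar>s n (x + h) - s n x\<bar>) 0 < e / 2"
      using lim.IH[of n] e by (intro tendstoD) auto
    then show "\<forall>\<^sub>F h in at 0. dist (LBINT x. \<bar>f (x + h) - f x\<bar>) 0 < e"
    proof (rule eventually_mono)
      fix h :: real
      assume h: "dist (LBINT x. \<bar>s n (x + h) - s n x\<bar>) 0 < e / 2"
      have "(LBINT x. \<bar>f (x + h) - f x\<bar>) \<le>
        (LBINT x. \<bar>s n (x + h) - f (x + h)\<bar> + \<bar>s n x - f x\<bar> + \<bar>s n (x + h) - s n x\<bar>)"
        by (intro integral_mono) auto
      also have "\<dots> = 2 * (LBINT x. \<bar>s n x - f x\<bar>) + (LBINT x. \<bar>s n (x + h) - s n x\<bar>)"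
        using lborel_integral_translate[of "\<lambda>x. \<bar>s n x - f x\<bar>" h] by simp
      also have "\<dots> < e" using n h by (simp add: dist_real_def)
      finally show "dist (LBINT x. \<bar>f (x + h) - f x\<bar>) 0 < e"
        by (simp add: dist_real_def)
    qed
  qed
qed

text \<open>Carries continuity of translations from L1 to L2: for a in L2 the function a |a| is
  integrable, and the signed square, unlike a^2, does not lose the sign of a.\<close>

lemma diff_square_le_signed_square:
  fixes p q :: real
  shows "(p - q)\<^sup>2 \<le> 2 * \<bar>p * \<bar>p\<bar> - q * \<bar>q\<bar>\<bar>"
proof -
  have *: "(p - q)\<^sup>2 \<le> 2 * (p * \<bar>p\<bar> - q * \<bar>q\<bar>)" if "q \<le> p" for p q :: real
  proof -
    consider "0 \<le> q" | "q < 0" "0 \<le> p" | "p < 0" using that by linarith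
    then show ?thesis
    proof cases
      case 1
      then have "0 \<le> (p - q) * (p + 3 * q)" using that by simp
      then show ?thesis using 1 that by (simp add: power2_eq_square algebra_simps)
    next
      case 2
      then show ?thesis using sum_squares_bound[of p "-q"] by (simp add: power2_eq_square algebra_simps)
    next
      case 3
      then have "0 \<le> (p - q) * (- q - 3 * p)" using that by simp
      then show ?thesis using 3 that by (simp add: power2_eq_square algebra_simps)
    qed
  qed
  show ?thesis
  proof (cases "q \<le> p")
    case True then show ?thesis using *[OF True] by (auto simp: abs_if)
  next
    case False then show ?thesis using *[of p q] power2_commute[of p q] by (auto simp: abs_if)
  qed
qed

section \<open>Bilinear forms with convolution kernels\<close>

lemma L2_measurable [measurable_dest]: "v \<in> L2 \<Longrightarrow> v \<in> borel_measurable borel"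
  by (simp add: L2_def)

lemma L2_integrable_square: "v \<in> L2 \<Longrightarrow> integrable lborel (\<lambda>x. (v x)\<^sup>2)"
  by (simp add: L2_def)

lemma L2I: "v \<in> borel_measurable borel \<Longrightarrow> integrable lborel (\<lambda>x. (v x)\<^sup>2) \<Longrightarrow> v \<in> L2"
  by (simp add: L2_def)

lemma L2_bounded_by:
  assumes [measurable]: "v \<in> borel_measurable borel" and w: "integrable lborel w"
    and le: "\<And>x. (v x)\<^sup>2 \<le> w x"
  shows "v \<in> L2"
  by (rule L2I, simp, rule Bochner_Integration.integrable_bound[OF w])
     (use le in \<open>auto intro: order_trans[OF _ abs_ge_self]\<close>)

lemma sum_squares_le_double: "(p + q)\<^sup>2 \<le> 2 * p\<^sup>2 + 2 * q\<^sup>2" for p q :: real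
  using sum_squares_bound[of p q] by (simp add: power2_sum)

lemma L2_add: "a \<in> L2 \<Longrightarrow> b \<in> L2 \<Longrightarrow> (\<lambda>x. a x + b x) \<in> L2"
  by (rule L2_bounded_by[where w = "\<lambda>x. 2 * (a x)\<^sup>2 + 2 * (b x)\<^sup>2"])
     (auto intro!: L2_integrable_square simp: L2_measurable intro: sum_squares_le_double)

lemma L2_cmult: "a \<in> L2 \<Longrightarrow> (\<lambda>x. c * a x) \<in> L2"
  by (auto simp: L2_def power_mult_distrib)

lemma L2_diff: "a \<in> L2 \<Longrightarrow> b \<in> L2 \<Longrightarrow> (\<lambda>x. a x - b x) \<in> L2"
  using L2_add[of a "\<lambda>x. (-1) * b x"] L2_cmult[of b "-1"] by simp

lemma L2_abs: "a \<in> L2 \<Longrightarrow> (\<lambda>x. \<bar>a x\<bar>) \<in> L2"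
  by (auto simp: L2_def)

lemma L2_translate: "a \<in> L2 \<Longrightarrow> (\<lambda>x. a (x + h)) \<in> L2"
  using lborel_integrable_translate[of "\<lambda>x. (a x)\<^sup>2" h] by (auto simp: L2_def)

lemma abs_mult_le_sum_squares: "\<bar>a * b\<bar> \<le> (a\<^sup>2 + b\<^sup>2) / 2" for a b :: real
  using sum_squares_bound[of "\<bar>a\<bar>" "\<bar>b\<bar>"] by (simp add: abs_mult)

lemma L2_mult_integrable:
  assumes "a \<in> L2" "b \<in> L2"
  shows "integrable lborel (\<lambda>x. a x * b x)"
  by (rule Bochner_Integration.integrable_bound[where f = "\<lambda>x. ((a x)\<^sup>2 + (b x)\<^sup>2) / 2"])
     (use assms abs_mult_le_sum_squares in \<open>auto intro!: L2_integrable_square simp: L2_measurable\<close>)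

text \<open>Optimising l A + B/l would need l = sqrt (B/A), which may be 0 or undefined. The weights
  (q + e)/(p + e) with p = sqrt A and q = sqrt B are always positive, and e tends to 0. The same
  device serves single and double integrals.\<close>

lemma le_sqrt_mult_from_weighted:
  fixes X c A B :: real
  assumes le: "\<And>l. 0 < l \<Longrightarrow> X \<le> c / 2 * (l * A + B / l)" and nn: "0 \<le> A" "0 \<le> B" "0 \<le> c"
  shows "X \<le> c * (sqrt A * sqrt B)"
proof (rule tendsto_lowerbound)
  show "((\<lambda>e. c / 2 * ((sqrt B + e) * sqrt A + sqrt B * (sqrt A + e))) \<longlongrightarrow> c * (sqrt A * sqrt B)) (at_right 0)"
    by (auto intro!: tendsto_eq_intros)
  show "\<forall>\<^sub>F e in at_right 0. X \<le> c / 2 * ((sqrt B + e) * sqrt A + sqrt B * (sqrt A + e))"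
  proof (rule eventually_at_right_less[THEN eventually_mono])
    fix e :: real assume e: "0 < e"
    define p q where "p = sqrt A" and "q = sqrt B"
    have pq: "0 \<le> p" "0 \<le> q" "A = p * p" "B = q * q" using nn by (auto simp: p_def q_def)
    define l where "l = (q + e) / (p + e)"
    have l: "0 < l" using pq e by (auto simp: l_def intro!: divide_pos_pos add_nonneg_pos)
    have p': "p / (p + e) \<le> 1" "q / (q + e) \<le> 1" using pq e by (auto simp: divide_le_eq)
    have "l * A = ((q + e) * p) * (p / (p + e))" by (simp add: l_def pq)
    also have "\<dots> \<le> ((q + e) * p) * 1" using p' pq e by (intro mult_left_mono) auto
    finally have 1: "l * A \<le> (q + e) * p" by simp
    have "B / l = (q * (p + e)) * (q / (q + e))" by (simp add: l_def pq)
    also have "\<dots> \<le> (q * (p + e)) * 1" using p' pq e by (intro mult_left_mono) auto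
    finally have 2: "B / l \<le> q * (p + e)" by simp
    have "X \<le> c / 2 * (l * A + B / l)" by (rule le[OF l])
    also have "\<dots> \<le> c / 2 * ((q + e) * p + q * (p + e))"
      using 1 2 nn by (intro mult_left_mono) auto
    finally show "X \<le> c / 2 * ((sqrt B + e) * sqrt A + sqrt B * (sqrt A + e))"
      by (simp add: p_def q_def)
  qed
qed simp

lemma weighted_am_gm: "0 < l \<Longrightarrow> \<bar>a * b\<bar> \<le> (l * a\<^sup>2 + b\<^sup>2 / l) / 2" for a b l :: real
  using abs_mult_le_sum_squares[of "sqrt l * a" "b / sqrt l"]
  by (simp add: power_mult_distrib power_divide)

definition L2norm :: "(real \<Rightarrow> real) \<Rightarrow> real" where
  "L2norm a = sqrt (LBINT x. (a x)\<^sup>2)"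

lemma L2norm_nonneg [simp]: "0 \<le> L2norm a"
  by (simp add: L2norm_def)

lemma L2_Cauchy_Schwarz:
  assumes "a \<in> L2" "b \<in> L2"
  shows "(LBINT x. \<bar>a x * b x\<bar>) \<le> L2norm a * L2norm b"
proof -
  note [simp] = assms[THEN L2_integrable_square] L2_mult_integrable[OF assms]
  have "(LBINT x. \<bar>a x * b x\<bar>) \<le> 1 * (sqrt (LBINT x. (a x)\<^sup>2) * sqrt (LBINT x. (b x)\<^sup>2))"
  proof (rule le_sqrt_mult_from_weighted)
    fix l :: real assume "0 < l"
    then have "(LBINT x. \<bar>a x * b x\<bar>) \<le> (LBINT x. (l * (a x)\<^sup>2 + (b x)\<^sup>2 / l) / 2)"
      using weighted_am_gm by (intro integral_mono) auto
    then show "(LBINT x. \<bar>a x * b x\<bar>) \<le> 1 / 2 * (l * (LBINT x. (a x)\<^sup>2) + (LBINT x. (b x)\<^sup>2) / l)"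
      by simp
  qed auto
  then show ?thesis by (simp add: L2norm_def)
qed

lemma L2_Cauchy_Schwarz':
  assumes "a \<in> L2" "b \<in> L2"
  shows "\<bar>LBINT x. a x * b x\<bar> \<le> L2norm a * L2norm b"
  using L2_Cauchy_Schwarz[OF assms] integral_abs_bound[of lborel "\<lambda>x. a x * b x"] by linarith

lemma translation_continuous_L2:
  assumes "a \<in> L2"
  shows "((\<lambda>h. L2norm (\<lambda>x. a (x + h) - a x)) \<longlongrightarrow> 0) (at 0)"
proof -
  define f where "f x = a x * \<bar>a x\<bar>" for x
  have f: "integrable lborel f"
    unfolding f_def by (intro L2_mult_integrable assms L2_abs)
  have "((\<lambda>h. LBINT x. (a (x + h) - a x)\<^sup>2) \<longlongrightarrow> 0) (at 0)"
  proof (rule Lim_null_comparison)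
    have "(LBINT x. (a (x + h) - a x)\<^sup>2) \<le> (LBINT x. 2 * \<bar>f (x + h) - f x\<bar>)" for h
    proof (rule integral_mono)
      show "integrable lborel (\<lambda>x. 2 * \<bar>f (x + h) - f x\<bar>)"
        using f lborel_integrable_translate[OF f, of h] by simp
    qed (auto simp: f_def intro!: L2_integrable_square L2_diff L2_translate assms diff_square_le_signed_square)
    then show "\<forall>\<^sub>F h in at 0. norm (LBINT x. (a (x + h) - a x)\<^sup>2) \<le> 2 * (LBINT x. \<bar>f (x + h) - f x\<bar>)"
      by simp
    show "((\<lambda>h. 2 * (LBINT x. \<bar>f (x + h) - f x\<bar>)) \<longlongrightarrow> 0) (at 0)"
      using tendsto_mult[OF tendsto_const[of 2] translation_continuous_L1[OF f]] by simp
  qed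
  from tendsto_real_sqrt[OF this] show ?thesis by (simp add: L2norm_def)
qed

lemma translation_pairing_tendsto:
  assumes a: "a \<in> L2" and b: "b \<in> L2"
  shows "((\<lambda>h. LBINT x. a x * b (x + h)) \<longlongrightarrow> (LBINT x. a x * b x)) (at 0)"
proof (rule LIM_zero_cancel, rule Lim_null_comparison)
  have "(LBINT x. a x * b (x + h)) - (LBINT x. a x * b x) = (LBINT x. a x * (b (x + h) - b x))" for h
    by (subst Bochner_Integration.integral_diff[symmetric])
       (auto intro!: L2_mult_integrable L2_translate a b simp: algebra_simps)
  then show "\<forall>\<^sub>F h in at 0. norm ((LBINT x. a x * b (x + h)) - (LBINT x. a x * b x)) \<le>
    L2norm a * L2norm (\<lambda>x. b (x + h) - b x)"
    using L2_Cauchy_Schwarz'[OF a L2_diff[OF L2_translate[OF b] b]] by simp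
  show "((\<lambda>h. L2norm a * L2norm (\<lambda>x. b (x + h) - b x)) \<longlongrightarrow> 0) (at 0)"
    using tendsto_mult[OF tendsto_const[of "L2norm a"] translation_continuous_L2[OF b]] by simp
qed

section \<open>Double integrals against kernels depending on x - y\<close>

lemma lborel_integral_reflect:
  fixes f :: "real \<Rightarrow> real"
  shows "(LBINT y. f (x - y)) = (LBINT y. f y)"
  using lborel_integral_real_affine[of "-1" f x] by simp

lemma lborel_integrable_reflect:
  fixes f :: "real \<Rightarrow> real"
  shows "integrable lborel f \<Longrightarrow> integrable lborel (\<lambda>y. f (x - y))"
  using lborel_integrable_real_affine[of f "-1" x] by simp

text \<open>Integrating over y first, the reflection y to x - y makes the inner integral of the
  kernel independent of x. The version with \<open>p y\<close> is the version with
  \<open>p x\<close> for the reflected kernel after exchanging the coordinates.\<close>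

lemma integrable_convolution_kernel:
  fixes \<kappa> p :: "real \<Rightarrow> real"
  assumes \<kappa>: "integrable lborel \<kappa>" and p: "integrable lborel p"
  shows "integrable (lborel \<Otimes>\<^sub>M lborel) (\<lambda>(x, y). \<kappa> (x - y) * p x)" (is ?A)
    and "(\<integral>z. (case z of (x, y) \<Rightarrow> \<kappa> (x - y) * p x) \<partial>(lborel \<Otimes>\<^sub>M lborel)) = (LBINT x. \<kappa> x) * (LBINT x. p x)" (is ?B)
    and "integrable (lborel \<Otimes>\<^sub>M lborel) (\<lambda>(x, y). \<kappa> (x - y) * p y)" (is ?C)
    and "(\<integral>z. (case z of (x, y) \<Rightarrow> \<kappa> (x - y) * p y) \<partial>(lborel \<Otimes>\<^sub>M lborel)) = (LBINT x. \<kappa> x) * (LBINT x. p x)" (is ?D)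
proof -
  have main: "integrable (lborel \<Otimes>\<^sub>M lborel) (\<lambda>(x, y). \<kappa> (x - y) * p x) \<and>
    (\<integral>z. (case z of (x, y) \<Rightarrow> \<kappa> (x - y) * p x) \<partial>(lborel \<Otimes>\<^sub>M lborel)) = (LBINT x. \<kappa> x) * (LBINT x. p x)"
    if \<kappa>: "integrable lborel \<kappa>" for \<kappa> :: "real \<Rightarrow> real"
  proof -
    have [measurable]: "\<kappa> \<in> borel_measurable borel" "p \<in> borel_measurable borel"
      using \<kappa> p by (auto dest: borel_measurable_integrable)
    have i: "integrable (lborel \<Otimes>\<^sub>M lborel) (\<lambda>(x, y). \<kappa> (x - y) * p x)"
    proof (rule lborel_pair.Fubini_integrable)
      show "integrable lborel (\<lambda>x. LBINT y. norm (case (x, y) of (x, y) \<Rightarrow> \<kappa> (x - y) * p x))"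
        using lborel_integral_reflect[of "\<lambda>y. \<bar>\<kappa> y\<bar>"] p by (simp add: abs_mult)
      show "AE x in lborel. integrable lborel (\<lambda>y. case (x, y) of (x, y) \<Rightarrow> \<kappa> (x - y) * p x)"
        using lborel_integrable_reflect[OF \<kappa>] by simp
    qed simp
    have "(\<integral>z. (case z of (x, y) \<Rightarrow> \<kappa> (x - y) * p x) \<partial>(lborel \<Otimes>\<^sub>M lborel)) = (LBINT x. (LBINT y. \<kappa> (x - y) * p x))"
      using lborel_pair.integral_fst'[OF i] by simp
    then show ?thesis using i lborel_integral_reflect[of \<kappa>] by simp
  qed
  show ?A ?B using main[OF \<kappa>] by auto
  have \<kappa>': "integrable lborel (\<lambda>x. \<kappa> (- x))" using lborel_integrable_reflect[OF \<kappa>, of 0] by simp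
  have e: "(\<lambda>(x, y). (case (y, x) of (x, y) \<Rightarrow> \<kappa> (- (x - y)) * p x)) = (\<lambda>(x, y). \<kappa> (x - y) * p y)"
    by auto
  have e': "(LBINT x. \<kappa> (- x)) = (LBINT x. \<kappa> x)" using lborel_integral_reflect[of \<kappa> 0] by simp
  show ?C using lborel_pair.integrable_product_swap[OF conjunct1[OF main[OF \<kappa>']]]
    by (simp add: case_prod_beta' split_beta')
  show ?D using lborel_pair.integral_product_swap[of "\<lambda>(x, y). \<kappa> (- (x - y)) * p x"] main[OF \<kappa>'] e'
    by (auto simp: case_prod_beta' split_beta' dest: borel_measurable_integrable)
qed

text \<open>The Schur-Young bound: the majorant \<open>W l\<close> splits |a(x) b(y)| by the
  weighted arithmetic-geometric mean, each square integrates against \<kappa>(x - y) to the mass of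
  \<kappa> times a squared norm, and varying l turns the sum into a product of norms.\<close>

lemma
  fixes k :: "real \<Rightarrow> real \<Rightarrow> real"
  assumes \<kappa>: "integrable lborel \<kappa>" and [measurable]: "(\<lambda>(x, y). k x y) \<in> borel_measurable (borel \<Otimes>\<^sub>M borel)"
    and le: "\<And>x y. \<bar>k x y\<bar> \<le> \<kappa> (x - y)" and a: "a \<in> L2" and b: "b \<in> L2"
  shows dominated_kernel_integrable: "integrable (lborel \<Otimes>\<^sub>M lborel) (\<lambda>(x, y). k x y * a x * b y)" (is ?A)
    and dominated_kernel_bound:
      "\<bar>LBINT x. (LBINT y. k x y * a x * b y)\<bar> \<le> (LBINT x. \<kappa> x) * (L2norm a * L2norm b)" (is ?B)
proof -
  have [measurable]: "a \<in> borel_measurable borel" "b \<in> borel_measurable borel"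
    using a b by (auto simp: L2_measurable)
  have \<kappa>0: "0 \<le> \<kappa> x" for x using le[of x 0] by (simp add: order_trans[OF abs_ge_zero])
  define W where "W l = (\<lambda>(x, y). (l * (\<kappa> (x - y) * (a x)\<^sup>2) + (\<kappa> (x - y) * (b y)\<^sup>2) / l) / 2)" for l :: real
  note c1 = integrable_convolution_kernel[OF \<kappa> L2_integrable_square[OF a]]
  note c2 = integrable_convolution_kernel[OF \<kappa> L2_integrable_square[OF b]]
  have Wi: "integrable (lborel \<Otimes>\<^sub>M lborel) (W l)" for l
    using c1(1) c2(3) unfolding W_def case_prod_beta' by auto
  have Wv: "(\<integral>z. W l z \<partial>(lborel \<Otimes>\<^sub>M lborel)) =
      (LBINT x. \<kappa> x) / 2 * (l * (LBINT x. (a x)\<^sup>2) + (LBINT x. (b x)\<^sup>2) / l)" for l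
    using c1(1,2) c2(3,4) unfolding W_def case_prod_beta' by (simp add: algebra_simps)
  have bd: "\<bar>k x y * a x * b y\<bar> \<le> W l (x, y)" if "0 < l" for x y l
  proof -
    have "\<bar>k x y * a x * b y\<bar> = \<bar>k x y\<bar> * \<bar>a x * b y\<bar>" by (simp add: abs_mult)
    also have "\<dots> \<le> \<kappa> (x - y) * ((l * (a x)\<^sup>2 + (b y)\<^sup>2 / l) / 2)"
      using le \<kappa>0 weighted_am_gm[OF that] by (intro mult_mono) auto
    also have "\<dots> = W l (x, y)" by (simp add: W_def algebra_simps)
    finally show ?thesis .
  qed
  show I: ?A
  proof (rule Bochner_Integration.integrable_bound[OF Wi[of 1]])
    show "AE z in lborel \<Otimes>\<^sub>M lborel. norm (case z of (x, y) \<Rightarrow> k x y * a x * b y) \<le> norm (W 1 z)"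
    proof (rule AE_I2)
      fix z :: "real \<times> real"
      show "norm (case z of (x, y) \<Rightarrow> k x y * a x * b y) \<le> norm (W 1 z)"
        using bd[of 1 "fst z" "snd z"] by (auto simp: case_prod_beta')
    qed
  qed simp
  have eq: "(LBINT x. (LBINT y. k x y * a x * b y)) = (\<integral>z. (case z of (x, y) \<Rightarrow> k x y * a x * b y) \<partial>(lborel \<Otimes>\<^sub>M lborel))"
    using lborel_pair.integral_fst'[OF I] by simp
  show ?B unfolding eq L2norm_def
  proof (rule le_sqrt_mult_from_weighted)
    fix l :: real assume l: "0 < l"
    have "\<bar>\<integral>z. (case z of (x, y) \<Rightarrow> k x y * a x * b y) \<partial>(lborel \<Otimes>\<^sub>M lborel)\<bar> \<le>
        (\<integral>z. \<bar>case z of (x, y) \<Rightarrow> k x y * a x * b y\<bar> \<partial>(lborel \<Otimes>\<^sub>M lborel))"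
      by (rule integral_abs_bound)
    also have "\<dots> \<le> (\<integral>z. W l z \<partial>(lborel \<Otimes>\<^sub>M lborel))"
      using I Wi bd[OF l] by (intro integral_mono) auto
    finally show "\<bar>\<integral>z. (case z of (x, y) \<Rightarrow> k x y * a x * b y) \<partial>(lborel \<Otimes>\<^sub>M lborel)\<bar> \<le>
       (LBINT x. \<kappa> x) / 2 * (l * (LBINT x. (a x)\<^sup>2) + (LBINT x. (b x)\<^sup>2) / l)"
      unfolding Wv .
  qed (use \<kappa>0 in auto)
qed

lemma dominated_kernel_swap:
  fixes k :: "real \<Rightarrow> real \<Rightarrow> real"
  assumes "integrable lborel \<kappa>" "(\<lambda>(x, y). k x y) \<in> borel_measurable (borel \<Otimes>\<^sub>M borel)"
    and "\<And>x y. \<bar>k x y\<bar> \<le> \<kappa> (x - y)" "a \<in> L2" "b \<in> L2"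
  shows "(LBINT x. (LBINT y. k x y * a x * b y)) = (LBINT y. (LBINT x. k x y * a x * b y))"
  using lborel_pair.Fubini_integral[OF dominated_kernel_integrable[OF assms]] by simp

text \<open>With z = N (x - y) the form becomes the integral of \<kappa>(z) T(-z/N), where T(h)
  pairs a with b shifted by h; T is bounded and continuous at 0. The mass of \<kappa> is kept
  general since a kernel of mass -1 occurs below.\<close>

lemma approximate_identity_tendsto:
  assumes \<kappa>: "integrable lborel \<kappa>" and a: "a \<in> L2" and b: "b \<in> L2"
  shows "(\<lambda>n. LBINT x. (LBINT y. real (Suc n) * \<kappa> (real (Suc n) * (x - y)) * a x * b y))
     \<longlonglongrightarrow> (LBINT x. \<kappa> x) * (LBINT x. a x * b x)"
proof -
  have [measurable]: "a \<in> borel_measurable borel" "b \<in> borel_measurable borel" "\<kappa> \<in> borel_measurable borel"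
    using a b \<kappa> by (auto simp: L2_measurable dest: borel_measurable_integrable)
  define T where "T h = (LBINT x. a x * b (x + h))" for h
  have [measurable]: "T \<in> borel_measurable borel" unfolding T_def by measurable
  have nb: "L2norm (\<lambda>x. b (x + h)) = L2norm b" for h
    unfolding L2norm_def using lborel_integral_translate[of "\<lambda>x. (b x)\<^sup>2" h] by simp
  have bound: "(LBINT x. \<bar>a x * b (x + h)\<bar>) \<le> L2norm a * L2norm b" for h
    using L2_Cauchy_Schwarz[OF a L2_translate[OF b, of h]] by (simp add: nb)
  have T_bound: "\<bar>T h\<bar> \<le> L2norm a * L2norm b" for h
    unfolding T_def using L2_Cauchy_Schwarz'[OF a L2_translate[OF b, of h]] by (simp add: nb)
  have eq: "(LBINT x. (LBINT y. N * \<kappa> (N * (x - y)) * a x * b y)) = (LBINT z. \<kappa> z * T (- z / N))"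
    if N: "0 < N" for N :: real
  proof -
    have "(LBINT y. N * \<kappa> (N * (x - y)) * a x * b y) = (LBINT z. \<kappa> z * a x * b (x + - z / N))" for x
      using lborel_integral_real_affine[of "- 1 / N" "\<lambda>y. N * \<kappa> (N * (x - y)) * a x * b y" x] N
      by (simp add: mult.assoc)
    moreover have "integrable (lborel \<Otimes>\<^sub>M lborel) (\<lambda>(z, x). \<kappa> z * a x * b (x + - z / N))"
    proof (rule lborel_pair.Fubini_integrable)
      have "integrable lborel (\<lambda>z. \<kappa> z * (LBINT x. \<bar>a x * b (x + - z / N)\<bar>))"
      proof (rule Bochner_Integration.integrable_bound)
        show "integrable lborel (\<lambda>z. \<bar>\<kappa> z\<bar> * (L2norm a * L2norm b))" using \<kappa> by simp
        show "AE z in lborel. norm (\<kappa> z * (LBINT x. \<bar>a x * b (x + - z / N)\<bar>)) \<le> norm (\<bar>\<kappa> z\<bar> * (L2norm a * L2norm b))"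
        proof (rule AE_I2)
          fix z
          have "\<bar>LBINT x. \<bar>a x * b (x + - z / N)\<bar>\<bar> \<le> \<bar>L2norm a * L2norm b\<bar>"
            using bound[of "- z / N"] by (simp add: abs_mult)
          then show "norm (\<kappa> z * (LBINT x. \<bar>a x * b (x + - z / N)\<bar>)) \<le> norm (\<bar>\<kappa> z\<bar> * (L2norm a * L2norm b))"
            unfolding real_norm_def abs_mult[of "\<kappa> z"] abs_mult[of "\<bar>\<kappa> z\<bar>"] abs_idempotent by (rule mult_left_mono) simp
        qed
      qed measurable
      then have "integrable lborel (\<lambda>z. \<bar>\<kappa> z * (LBINT x. \<bar>a x * b (x + - z / N)\<bar>)\<bar>)" by (rule integrable_abs)
      then show "integrable lborel (\<lambda>z. LBINT x. norm (case (z, x) of (z, x) \<Rightarrow> \<kappa> z * a x * b (x + - z / N)))"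
        by (simp add: abs_mult mult.assoc)
      show "AE z in lborel. integrable lborel (\<lambda>x. case (z, x) of (z, x) \<Rightarrow> \<kappa> z * a x * b (x + - z / N))"
        using L2_mult_integrable[OF a L2_translate[OF b, of "- z / N" for z]] by (simp add: mult.assoc)
    qed measurable
    from lborel_pair.Fubini_integral[OF this]
    have "(LBINT x. (LBINT z. \<kappa> z * a x * b (x + - z / N))) = (LBINT z. (LBINT x. \<kappa> z * a x * b (x + - z / N)))"
      by simp
    ultimately show ?thesis by (simp add: T_def mult.assoc)
  qed
  have "(\<lambda>n. LBINT z. \<kappa> z * T (- z / real (Suc n))) \<longlonglongrightarrow> (LBINT z. \<kappa> z * T 0)"
  proof (rule integral_dominated_convergence)
    show "integrable lborel (\<lambda>z. \<bar>\<kappa> z\<bar> * (L2norm a * L2norm b))" using \<kappa> by simp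
    show "AE z in lborel. norm (\<kappa> z * T (- z / real (Suc n))) \<le> \<bar>\<kappa> z\<bar> * (L2norm a * L2norm b)" for n
      using T_bound by (auto simp: abs_mult intro!: mult_left_mono)
    have "isCont T 0" unfolding isCont_def using translation_pairing_tendsto[OF a b] by (simp add: T_def[abs_def])
    have "(\<lambda>n. - z / real (Suc n)) \<longlonglongrightarrow> 0" for z :: real
      using tendsto_mult[OF tendsto_const[of "-z"] LIMSEQ_inverse_real_of_nat] by (simp add: divide_inverse)
    then have "(\<lambda>n. T (- z / real (Suc n))) \<longlonglongrightarrow> T 0" for z
      by (rule isCont_tendsto_compose[OF \<open>isCont T 0\<close>])
    then show "AE z in lborel. (\<lambda>n. \<kappa> z * T (- z / real (Suc n))) \<longlonglongrightarrow> \<kappa> z * T 0"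
      by (auto intro!: tendsto_mult)
  qed measurable
  then show ?thesis using eq by (simp add: T_def)
qed

section \<open>Mollification\<close>

definition mollifier :: "real \<Rightarrow> real" where
  "mollifier x = bump_fun [:1:] 0 x / (LBINT y. bump_fun [:1:] 0 y)"

lemma integrable_bump_fun: "integrable lborel (bump_fun P k)"
proof -
  have "integrable lborel (\<lambda>x. indicator {-1..1} x *\<^sub>R bump_fun P k x)"
    by (rule borel_integrable_compact) (auto intro: continuous_on_bump_fun)
  also have "(\<lambda>x. indicator {-1..1} x *\<^sub>R bump_fun P k x) = bump_fun P k"
    by (intro ext) (auto simp: indicator_def bump_fun_def)
  finally show ?thesis .
qed

lemma bump_fun_mass_pos: "0 < (LBINT y. bump_fun [:1:] 0 y)"
proof -
  have nn: "0 \<le> bump_fun [:1:] 0 y" for y by (simp add: bump_fun_def)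
  have "\<not> (AE y in lborel. bump_fun [:1:] 0 y = 0)"
  proof
    assume "AE y in lborel. bump_fun [:1:] 0 y = 0"
    then have "AE y in lborel. y \<notin> {-1<..<1::real}"
      by eventually_elim (auto simp: bump_fun_def split: if_splits)
    then have "emeasure lborel {-1<..<1::real} = 0"
      by (subst (asm) AE_iff_measurable[of "{-1<..<1}"]) auto
    then show False by simp
  qed
  then have "(LBINT y. bump_fun [:1:] 0 y) \<noteq> 0"
    using integral_nonneg_eq_0_iff_AE[OF integrable_bump_fun[of "[:1:]" 0]] nn by auto
  moreover have "0 \<le> (LBINT y. bump_fun [:1:] 0 y)" using nn by simp
  ultimately show ?thesis by simp
qed

definition mollifier_deriv :: "nat \<Rightarrow> real \<Rightarrow> real" where
  "mollifier_deriv j = (deriv ^^ j) mollifier"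

lemma mollifier_deriv_bump_fun: "\<exists>P k. mollifier_deriv j = bump_fun P k"
proof -
  define P where "P = smult (1 / (LBINT y. bump_fun [:1:] 0 y)) [:1:]"
  have "mollifier = bump_fun P 0"
    unfolding P_def by (intro ext, subst bump_fun_smult) (simp add: mollifier_def)
  then show ?thesis
    using deriv_funpow_bump_fun_affine[of j P 0 1 0] unfolding mollifier_deriv_def by simp
qed

lemma has_real_derivative_mollifier_deriv:
  "(mollifier_deriv j has_real_derivative mollifier_deriv (Suc j) x) (at x)"
proof -
  obtain P k where P: "mollifier_deriv j = bump_fun P k" using mollifier_deriv_bump_fun by blast
  have "mollifier_deriv (Suc j) = deriv (mollifier_deriv j)" by (simp add: mollifier_deriv_def)
  then show ?thesis unfolding P using has_real_derivative_bump_fun DERIV_imp_deriv by metis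
qed

lemma mollifier_deriv_parity: "mollifier_deriv j (- x) = (- 1) ^ j * mollifier_deriv j x"
proof (induction j arbitrary: x)
  case 0
  show ?case by (simp add: mollifier_deriv_def mollifier_def bump_fun_def)
next
  case (Suc j)
  have "((\<lambda>x. mollifier_deriv j (- x)) has_real_derivative mollifier_deriv (Suc j) (- x) * (- 1)) (at x)"
    by (rule DERIV_chain2[OF has_real_derivative_mollifier_deriv]) (auto intro!: derivative_eq_intros)
  moreover have "((\<lambda>x. (- 1) ^ j * mollifier_deriv j x) has_real_derivative (- 1) ^ j * mollifier_deriv (Suc j) x) (at x)"
    by (rule DERIV_cmult[OF has_real_derivative_mollifier_deriv])
  ultimately have "mollifier_deriv (Suc j) (- x) * (- 1) = (- 1) ^ j * mollifier_deriv (Suc j) x"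
    unfolding Suc.IH by (rule DERIV_unique)
  then show ?case by simp
qed

text \<open>\<open>moll N j\<close> is the \<open>j\<close>-th derivative of \<open>N \<rho>(N x)\<close>.\<close>

definition moll :: "real \<Rightarrow> nat \<Rightarrow> real \<Rightarrow> real" where
  "moll N j x = N ^ Suc j * mollifier_deriv j (N * x)"

lemma has_real_derivative_moll [derivative_intros]:
  assumes "(f has_real_derivative f') (at x)"
  shows "((\<lambda>x. moll N j (f x)) has_real_derivative moll N (Suc j) (f x) * f') (at x)"
proof -
  have "((\<lambda>x. mollifier_deriv j (N * f x)) has_real_derivative mollifier_deriv (Suc j) (N * f x) * (N * f')) (at x)"
    by (rule DERIV_chain2[OF has_real_derivative_mollifier_deriv DERIV_cmult[OF assms]])
  from DERIV_cmult[OF this, of "N ^ Suc j"] show ?thesis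
    unfolding moll_def by (simp add: algebra_simps)
qed

lemma continuous_moll: "continuous_on S (moll N j)"
  by (intro continuous_at_imp_continuous_on ballI DERIV_isCont[OF has_real_derivative_moll[OF DERIV_ident]])

lemma moll_measurable [measurable]: "moll N j \<in> borel_measurable borel"
  by (intro borel_measurable_continuous_onI continuous_moll)

text \<open>For N >= 1 all kernels live on |x| <= 1, a radius independent of N; the cut-offs at
  distance 1 below rely on it.\<close>

lemma moll_zero: "1 \<le> N \<Longrightarrow> 1 \<le> \<bar>x\<bar> \<Longrightarrow> moll N j x = 0"
proof -
  assume "1 \<le> N" "1 \<le> \<bar>x\<bar>"
  then have "1 * 1 \<le> \<bar>N\<bar> * \<bar>x\<bar>" by (intro mult_mono) auto
  moreover obtain P k where "mollifier_deriv j = bump_fun P k" using mollifier_deriv_bump_fun by blast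
  ultimately show ?thesis by (simp add: moll_def bump_fun_zero abs_mult)
qed

lemma moll_parity: "moll N j (- x) = (- 1) ^ j * moll N j x"
  by (simp add: moll_def mollifier_deriv_parity)

lemma moll_nonneg: "0 \<le> N \<Longrightarrow> 0 \<le> moll N 0 x"
  using bump_fun_mass_pos by (simp add: moll_def mollifier_deriv_def mollifier_def bump_fun_def)

lemma integrable_mollifier_deriv: "integrable lborel (mollifier_deriv j)"
  using mollifier_deriv_bump_fun[of j] integrable_bump_fun by auto

lemma integral_mollifier: "(LBINT x. mollifier_deriv 0 x) = 1"
  using bump_fun_mass_pos by (simp add: mollifier_deriv_def mollifier_def)

lemma integrable_moll: "0 < N \<Longrightarrow> integrable lborel (moll N j)"
  unfolding moll_def using lborel_integrable_real_affine[OF integrable_mollifier_deriv, of N j 0] by simp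

lemma integral_moll: "0 < N \<Longrightarrow> (LBINT x. moll N 0 x) = 1"
  unfolding moll_def using lborel_integral_real_affine[of N "mollifier_deriv 0" 0] by (simp add: integral_mollifier)

lemma moll_bounded: "\<exists>C\<ge>0. \<forall>x. \<bar>moll N j x\<bar> \<le> C"
proof -
  obtain P k where P: "mollifier_deriv j = bump_fun P k" using mollifier_deriv_bump_fun by blast
  have "bounded (bump_fun P k ` {-1..1})"
    by (intro compact_imp_bounded compact_continuous_image continuous_on_bump_fun) auto
  then obtain M where M: "\<And>x. x \<in> {-1..1} \<Longrightarrow> \<bar>bump_fun P k x\<bar> \<le> M"
    unfolding bounded_iff by (metis imageI real_norm_def)
  have "\<bar>bump_fun P k x\<bar> \<le> \<bar>M\<bar>" for x
    by (cases "x \<in> {-1..1}") (use M in \<open>force simp: bump_fun_def\<close>)+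
  then have "\<bar>moll N j x\<bar> \<le> \<bar>N ^ Suc j\<bar> * \<bar>M\<bar>" for x
    unfolding moll_def P abs_mult[of "N ^ Suc j"] by (rule mult_left_mono) auto
  then show ?thesis by (intro exI[of _ "\<bar>N ^ Suc j\<bar> * \<bar>M\<bar>"]) auto
qed

lemma test_function_moll:
  assumes "0 < N"
  shows "test_function (\<lambda>y. moll N j (x - y))" and "test_function (\<lambda>x. moll N j (x - y))"
proof -
  obtain P k where P: "mollifier_deriv j = bump_fun P k" using mollifier_deriv_bump_fun by blast
  have "(\<lambda>y. moll N j (x - y)) = (\<lambda>y. bump_fun (smult (N ^ Suc j) P) k (- N * y + N * x))"
    unfolding bump_fun_smult by (simp add: moll_def P algebra_simps)
  then show "test_function (\<lambda>y. moll N j (x - y))"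
    using test_function_bump_fun_affine[of "- N" "smult (N ^ Suc j) P" k "N * x"] assms by simp
  have "(\<lambda>x. moll N j (x - y)) = (\<lambda>x. bump_fun (smult (N ^ Suc j) P) k (N * x + - N * y))"
    unfolding bump_fun_smult by (simp add: moll_def P algebra_simps)
  then show "test_function (\<lambda>x. moll N j (x - y))"
    using test_function_bump_fun_affine[of N "smult (N ^ Suc j) P" k "- N * y"] assms by simp
qed

lemma deriv_moll_shift:
  "deriv (\<lambda>y. moll N j (x - y)) y = - moll N (Suc j) (x - y)"
  "deriv (\<lambda>x. moll N j (x - y)) x = moll N (Suc j) (x - y)"
  by (auto intro!: DERIV_imp_deriv derivative_eq_intros)

text \<open>Testing in y differentiates \<rho>(x - y) with a minus sign, which cancels the one in
  the definition of weak derivatives; testing in x does not. Hence the different signs.\<close>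

lemma weak_deriv_moll:
  assumes "has_weak_deriv v g" "0 < N"
  shows "(LBINT y. moll N (Suc j) (x - y) * v y) = (LBINT y. moll N j (x - y) * g y)"
    and "(LBINT x. moll N (Suc j) (x - y) * v x) = - (LBINT x. moll N j (x - y) * g x)"
proof -
  have 1: "(LBINT x. v x * deriv \<phi> x) = - (LBINT x. g x * \<phi> x)" if "test_function \<phi>" for \<phi>
    using assms(1) that by (simp add: has_weak_deriv_def)
  show "(LBINT y. moll N (Suc j) (x - y) * v y) = (LBINT y. moll N j (x - y) * g y)"
    using 1[OF test_function_moll(1)[OF assms(2), of j x]] by (simp add: deriv_moll_shift mult.commute)
  show "(LBINT x. moll N (Suc j) (x - y) * v x) = - (LBINT x. moll N j (x - y) * g x)"
    using 1[OF test_function_moll(2)[OF assms(2), of j y]] by (simp add: deriv_moll_shift mult.commute)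
qed

text \<open>By Fubini the L1 error is at most the \<rho>-average of the translation moduli
  \<tau>(-z/N), which are bounded and tend to 0.\<close>

lemma mollification_tendsto_L1:
  fixes d :: "real \<Rightarrow> real"
  assumes d: "integrable lborel d"
  shows "(\<lambda>n. LBINT x. \<bar>(LBINT y. moll (real (Suc n)) 0 (x - y) * d y) - d x\<bar>) \<longlonglongrightarrow> 0"
proof -
  have [measurable]: "d \<in> borel_measurable borel" using d by (auto dest: borel_measurable_integrable)
  let ?\<rho> = "mollifier_deriv 0"
  have \<rho>: "0 \<le> ?\<rho> z" for z using moll_nonneg[of 1 z] by (simp add: moll_def)
  have [measurable]: "?\<rho> \<in> borel_measurable borel"
    using integrable_mollifier_deriv by (auto dest: borel_measurable_integrable)
  define \<tau> where "\<tau> h = (LBINT x. \<bar>d (x + h) - d x\<bar>)" for h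
  have [measurable]: "\<tau> \<in> borel_measurable borel" unfolding \<tau>_def by measurable
  have dh: "integrable lborel (\<lambda>x. \<bar>d (x + h) - d x\<bar>)" for h
    using d lborel_integrable_translate[OF d] by simp
  have \<tau>0: "0 \<le> \<tau> h" for h by (simp add: \<tau>_def)
  have \<tau>_bound: "\<tau> h \<le> 2 * (LBINT x. \<bar>d x\<bar>)" for h
  proof -
    have "\<tau> h \<le> (LBINT x. \<bar>d (x + h)\<bar> + \<bar>d x\<bar>)" unfolding \<tau>_def
      using d dh lborel_integrable_translate[OF d] by (intro integral_mono) auto
    then show ?thesis
      using d lborel_integrable_translate[OF integrable_abs[OF d], of h] lborel_integral_translate[of "\<lambda>x. \<bar>d x\<bar>" h] by simp
  qed
  have pair: "integrable (lborel \<Otimes>\<^sub>M lborel) (\<lambda>(z, x). ?\<rho> z * \<bar>d (x + - z / N) - d x\<bar>)" for N :: real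
  proof (rule lborel_pair.Fubini_integrable)
    have "integrable lborel (\<lambda>z. ?\<rho> z * \<tau> (- z / N))"
      by (rule Bochner_Integration.integrable_bound[OF integrable_mult_left[OF integrable_mollifier_deriv[of 0], of "2 * (LBINT x. \<bar>d x\<bar>)"]])
         (use \<tau>0 \<tau>_bound \<rho> in \<open>auto simp: abs_mult intro!: mult_left_mono\<close>)
    then show "integrable lborel (\<lambda>z. LBINT x. norm (case (z, x) of (z, x) \<Rightarrow> ?\<rho> z * \<bar>d (x + - z / N) - d x\<bar>))"
      using \<rho> by (simp add: abs_mult \<tau>_def)
    show "AE z in lborel. integrable lborel (\<lambda>x. case (z, x) of (z, x) \<Rightarrow> ?\<rho> z * \<bar>d (x + - z / N) - d x\<bar>)"
      using dh[of "- z / N" for z] by simp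
  qed measurable
  have le: "(LBINT x. \<bar>(LBINT y. moll N 0 (x - y) * d y) - d x\<bar>) \<le> (LBINT z. ?\<rho> z * \<tau> (- z / N))"
    if N: "0 < N" for N :: real
  proof -
    \<comment> \<open>Fubini yields integrability in z only for almost every x, so the pointwise
      estimate below is an almost-everywhere one.\<close>
    have i: "AE x in lborel. integrable lborel (\<lambda>z. ?\<rho> z * \<bar>d (x + - z / N) - d x\<bar>)"
      using lborel_pair.AE_integrable_snd[OF pair] by simp
    have J: "integrable lborel (\<lambda>x. LBINT z. ?\<rho> z * \<bar>d (x + - z / N) - d x\<bar>)"
      using lborel_pair.integrable_snd[OF pair] by simp
    have "(LBINT x. \<bar>(LBINT y. moll N 0 (x - y) * d y) - d x\<bar>) \<le>
        (LBINT x. (LBINT z. ?\<rho> z * \<bar>d (x + - z / N) - d x\<bar>))"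
    proof (rule integral_mono_AE'[OF J])
      show "AE x in lborel. \<bar>(LBINT y. moll N 0 (x - y) * d y) - d x\<bar> \<le> (LBINT z. ?\<rho> z * \<bar>d (x + - z / N) - d x\<bar>)"
        using i
      proof eventually_elim
        fix x assume i: "integrable lborel (\<lambda>z. ?\<rho> z * \<bar>d (x + - z / N) - d x\<bar>)"
        have i': "integrable lborel (\<lambda>z. ?\<rho> z * (d (x + - z / N) - d x))"
          by (rule Bochner_Integration.integrable_bound[OF i]) (use \<rho> in \<open>auto simp: abs_mult\<close>)
        have "integrable lborel (\<lambda>z. ?\<rho> z * (d (x + - z / N) - d x) + ?\<rho> z * d x)"
          by (intro Bochner_Integration.integrable_add i' integrable_mult_left integrable_mollifier_deriv)
        then have i'': "integrable lborel (\<lambda>z. ?\<rho> z * d (x + - z / N))" by (simp add: algebra_simps)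
        have "(LBINT y. moll N 0 (x - y) * d y) = (LBINT z. ?\<rho> z * d (x + - z / N))"
          using lborel_integral_real_affine[of "- 1 / N" "\<lambda>y. moll N 0 (x - y) * d y" x] N
          by (simp add: moll_def mult.assoc)
        then have "(LBINT y. moll N 0 (x - y) * d y) - d x = (LBINT z. ?\<rho> z * (d (x + - z / N) - d x))"
          using i'' integrable_mollifier_deriv[of 0] integral_mollifier by (simp add: right_diff_distrib)
        also have "\<bar>\<dots>\<bar> \<le> (LBINT z. \<bar>?\<rho> z * (d (x + - z / N) - d x)\<bar>)" by (rule integral_abs_bound)
        finally show "\<bar>(LBINT y. moll N 0 (x - y) * d y) - d x\<bar> \<le> (LBINT z. ?\<rho> z * \<bar>d (x + - z / N) - d x\<bar>)"
          using \<rho> by (simp add: abs_mult)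
      qed
    qed (use \<rho> in simp)
    also have "\<dots> = (LBINT z. (LBINT x. ?\<rho> z * \<bar>d (x + - z / N) - d x\<bar>))"
      using lborel_pair.Fubini_integral[OF pair] by simp
    finally show ?thesis by (simp add: \<tau>_def)
  qed
  have "(\<lambda>n. LBINT z. ?\<rho> z * \<tau> (- z / real (Suc n))) \<longlonglongrightarrow> (LBINT z. ?\<rho> z * 0)"
  proof (rule integral_dominated_convergence)
    show "integrable lborel (\<lambda>z. ?\<rho> z * (2 * (LBINT x. \<bar>d x\<bar>)))"
      using integrable_mollifier_deriv by simp
    show "AE z in lborel. norm (?\<rho> z * \<tau> (- z / real (Suc n))) \<le> ?\<rho> z * (2 * (LBINT x. \<bar>d x\<bar>))" for n
      using \<tau>0 \<tau>_bound \<rho> by (auto simp: abs_mult intro!: mult_left_mono)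
    have "isCont \<tau> 0" unfolding isCont_def using translation_continuous_L1[OF d] by (simp add: \<tau>_def[abs_def])
    have "(\<lambda>n. - z / real (Suc n)) \<longlonglongrightarrow> 0" for z :: real
      using tendsto_mult[OF tendsto_const[of "-z"] LIMSEQ_inverse_real_of_nat] by (simp add: divide_inverse)
    then have "(\<lambda>n. \<tau> (- z / real (Suc n))) \<longlonglongrightarrow> \<tau> 0" for z
      by (rule isCont_tendsto_compose[OF \<open>isCont \<tau> 0\<close>])
    moreover have "\<tau> 0 = 0" by (simp add: \<tau>_def)
    ultimately show "AE z in lborel. (\<lambda>n. ?\<rho> z * \<tau> (- z / real (Suc n))) \<longlonglongrightarrow> ?\<rho> z * 0"
      by (intro AE_I2 tendsto_mult tendsto_const) (simp only:)
  qed measurable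
  then have lim: "(\<lambda>n. LBINT z. ?\<rho> z * \<tau> (- z / real (Suc n))) \<longlonglongrightarrow> 0" by simp
  show ?thesis
    by (rule tendsto_sandwich[OF _ _ tendsto_const lim]) (use le in \<open>auto intro!: always_eventually\<close>)
qed

section \<open>Weak derivatives on the line\<close>

lemma locally_integrable_measurable [measurable_dest]: "locally_integrable d \<Longrightarrow> d \<in> borel_measurable borel"
  by (simp add: locally_integrable_def)

lemma locally_integrable_indicator:
  "locally_integrable d \<Longrightarrow> integrable lborel (\<lambda>x. indicator {a..b} x * d x)"
  by (simp add: locally_integrable_def set_integrable_def)

lemma locally_integrable_indicator_Ioc:
  assumes "locally_integrable d"
  shows "integrable lborel (\<lambda>x. indicator {a<..b} x * d x)"
proof -
  have [measurable]: "d \<in> borel_measurable borel" using assms by measurable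
  show ?thesis
    by (rule Bochner_Integration.integrable_bound[OF locally_integrable_indicator[OF assms, of a b]])
       (auto simp: indicator_def)
qed

lemma locally_integrableI:
  assumes [measurable]: "d \<in> borel_measurable borel"
    and int: "\<And>a b. integrable lborel (\<lambda>x. indicator {a..b} x * d x)"
  shows "locally_integrable d"
  unfolding locally_integrable_def set_integrable_def
proof (intro conjI allI impI)
  fix K :: "real set" assume K: "compact K"
  then obtain R where R: "K \<subseteq> {-R..R}"
    using compact_imp_bounded[OF K] unfolding bounded_iff by (force simp: abs_le_iff)
  have [measurable]: "K \<in> sets borel" using K by (simp add: compact_imp_closed)
  show "integrable lborel (\<lambda>x. indicator K x *\<^sub>R d x)"
    by (rule Bochner_Integration.integrable_bound[OF int[of "-R" R]])
       (use R in \<open>auto simp: indicator_def intro!: AE_I2\<close>)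
qed simp

lemma integrable_indicator_interval [simp]:
  "integrable lborel (indicator {a<..b} :: real \<Rightarrow> real)"
  "integrable lborel (indicator {a..b} :: real \<Rightarrow> real)"
  by (cases "a \<le> b"; simp add: integrable_real_indicator)+

lemma indicator_L2: "(indicator {a<..b} :: real \<Rightarrow> real) \<in> L2"
proof -
  have "(\<lambda>x. (indicator {a<..b} x)\<^sup>2 :: real) = indicator {a<..b}" by (auto simp: indicator_def)
  then show ?thesis by (simp add: L2_def)
qed

lemma L2norm_indicator: "a \<le> b \<Longrightarrow> L2norm (indicator {a<..b}) = sqrt (b - a)"
proof -
  have "(\<lambda>x. (indicator {a<..b} x)\<^sup>2 :: real) = indicator {a<..b}" by (auto simp: indicator_def)
  then show "a \<le> b \<Longrightarrow> ?thesis" by (simp add: L2norm_def)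
qed

lemma indicator_Icc_L2: "(indicator {a..b} :: real \<Rightarrow> real) \<in> L2"
proof -
  have "(\<lambda>x. (indicator {a..b} x)\<^sup>2 :: real) = indicator {a..b}" by (auto simp: indicator_def)
  then show ?thesis by (simp add: L2_def)
qed

lemma L2_locally_integrable: "d \<in> L2 \<Longrightarrow> locally_integrable d"
  by (rule locally_integrableI) (auto simp: L2_measurable intro!: L2_mult_integrable indicator_Icc_L2)

lemma locally_integrable_moll_mult:
  assumes d: "locally_integrable d" and N: "1 \<le> N"
  shows "integrable lborel (\<lambda>y. moll N j (x - y) * d y)"
proof -
  have [measurable]: "d \<in> borel_measurable borel" using d by measurable
  obtain C where C: "0 \<le> C" "\<And>x. \<bar>moll N j x\<bar> \<le> C" using moll_bounded by blast
  show ?thesis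
  proof (rule Bochner_Integration.integrable_bound)
    show "integrable lborel (\<lambda>y. C * (indicator {x-1..x+1} y * d y))"
      by (intro integrable_mult_right locally_integrable_indicator d)
    show "AE y in lborel. norm (moll N j (x - y) * d y) \<le> norm (C * (indicator {x-1..x+1} y * d y))"
    proof (rule AE_I2)
      fix y
      show "norm (moll N j (x - y) * d y) \<le> norm (C * (indicator {x-1..x+1} y * d y))"
        using C(1) C(2)[of "x - y"] moll_zero[OF N, of "x - y" j]
        by (cases "\<bar>x - y\<bar> < 1") (auto simp: abs_mult indicator_def intro!: mult_right_mono)
    qed
  qed simp
qed

lemma integrable_indicator_bounded:
  fixes f :: "real \<Rightarrow> real"
  assumes [measurable]: "f \<in> borel_measurable borel" and le: "\<And>x. x \<in> {a..b} \<Longrightarrow> \<bar>f x\<bar> \<le> M"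
  shows "integrable lborel (\<lambda>x. indicator {a..b} x * f x)"
proof (rule Bochner_Integration.integrable_bound)
  show "integrable lborel (\<lambda>x::real. indicator {a..b} x * M)" by simp
  show "AE x in lborel. norm (indicator {a..b} x * f x) \<le> norm (indicator {a..b} x * M)"
  proof (rule AE_I2)
    fix x
    show "norm (indicator {a..b} x * f x) \<le> norm (indicator {a..b} x * M)"
      using le[of x] by (cases "x \<in> {a..b}") auto
  qed
qed simp

text \<open>On bounded intervals the mollifications converge to d in L1 and, being bounded and
  pointwise convergent, to e as well. Used with e = 0 for uniqueness of weak derivatives and with
  the continuous representative as e.\<close>

lemma mollified_limit_AE:
  fixes d e :: "real \<Rightarrow> real"
  assumes d: "locally_integrable d"
    and lim: "\<And>x. (\<lambda>n. LBINT y. moll (real (Suc n)) 0 (x - y) * d y) \<longlonglongrightarrow> e x"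
    and bnd: "\<And>R. \<exists>M. \<forall>n x. \<bar>x\<bar> \<le> R \<longrightarrow> \<bar>LBINT y. moll (real (Suc n)) 0 (x - y) * d y\<bar> \<le> M"
  shows "AE x in lborel. d x = e x"
proof -
  have [measurable]: "d \<in> borel_measurable borel" using d by measurable
  define E where "E n x = (LBINT y. moll (real (Suc n)) 0 (x - y) * d y)" for n x
  have [measurable]: "E n \<in> borel_measurable borel" for n unfolding E_def by measurable
  have [measurable]: "e \<in> borel_measurable borel"
    by (rule borel_measurable_LIMSEQ_real[where u = E]) (use lim in \<open>auto simp: E_def\<close>)
  have *: "AE x in lborel. \<bar>x\<bar> \<le> R \<longrightarrow> d x = e x" for R :: real
  proof -
    define S where "S = (indicator {-R..R} :: real \<Rightarrow> real)"
    \<comment> \<open>The kernels have radius at most 1, so on [-R, R] the mollifications see d only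
      on [-(R+1), R+1]; the truncation \<open>dR\<close> is integrable on the whole line.\<close>
    define dR where "dR x = indicator {-(R+1)..R+1} x * d x" for x
    have [measurable]: "dR \<in> borel_measurable borel" "S \<in> borel_measurable borel"
      unfolding dR_def S_def by measurable
    have dR: "integrable lborel dR" unfolding dR_def by (rule locally_integrable_indicator[OF d])
    obtain M where M: "\<And>n x. \<bar>x\<bar> \<le> R \<Longrightarrow> \<bar>E n x\<bar> \<le> M" using bnd[of R] unfolding E_def by blast
    have Me: "\<bar>e x\<bar> \<le> M" if "\<bar>x\<bar> \<le> R" for x
      by (rule LIMSEQ_le_const2[OF tendsto_rabs[OF lim]]) (use M[OF that] in \<open>auto simp: E_def\<close>)
    have Mde: "\<bar>\<bar>E n x - e x\<bar>\<bar> \<le> 2 * M" if "x \<in> {-R..R}" for n x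
      using M[of x n] Me[of x] that by (auto simp: abs_le_iff)
    have Ei: "integrable lborel (\<lambda>x. S x * \<bar>E n x - e x\<bar>)" for n
      unfolding S_def by (rule integrable_indicator_bounded[OF _ Mde]) measurable
    have Sd: "integrable lborel (\<lambda>x. S x * d x)" unfolding S_def by (rule locally_integrable_indicator[OF d])
    have Se: "integrable lborel (\<lambda>x. S x * e x)"
      unfolding S_def by (rule integrable_indicator_bounded[OF _ Me]) auto
    have pull: "S x * \<bar>p - q\<bar> = \<bar>S x * p - S x * q\<bar>" for x p q by (auto simp: S_def indicator_def)
    have l1: "(\<lambda>n. LBINT x. S x * \<bar>E n x - e x\<bar>) \<longlonglongrightarrow> (LBINT x. S x * 0)"
    proof (rule integral_dominated_convergence[where w = "\<lambda>x. 2 * M * S x"])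
      show "AE x in lborel. (\<lambda>n. S x * \<bar>E n x - e x\<bar>) \<longlonglongrightarrow> S x * 0"
        using lim by (intro AE_I2 tendsto_mult tendsto_const tendsto_rabs_zero LIM_zero) (simp add: E_def)
      show "AE x in lborel. norm (S x * \<bar>E n x - e x\<bar>) \<le> 2 * M * S x" for n
      proof (rule AE_I2)
        fix x
        show "norm (S x * \<bar>E n x - e x\<bar>) \<le> 2 * M * S x"
          using Mde[of x n] by (cases "x \<in> {-R..R}") (auto simp: S_def)
      qed
    qed (auto simp: S_def)
    define L where "L n = (LBINT x. \<bar>(LBINT y. moll (real (Suc n)) 0 (x - y) * dR y) - dR x\<bar>)" for n
    have l2: "L \<longlonglongrightarrow> 0" unfolding L_def by (rule mollification_tendsto_L1[OF dR])
    have conv_int: "integrable lborel (\<lambda>x. (LBINT y. moll (real (Suc n)) 0 (x - y) * dR y))" for n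
      using lborel_pair.integrable_fst'[OF integrable_convolution_kernel(3)[OF integrable_moll[of "real (Suc n)" 0] dR]] by simp
    have le: "(LBINT x. S x * \<bar>d x - e x\<bar>) \<le> (LBINT x. S x * \<bar>E n x - e x\<bar>) + L n" for n
    proof -
      have E_eq: "E n x = (LBINT y. moll (real (Suc n)) 0 (x - y) * dR y)" if "\<bar>x\<bar> \<le> R" for x
        unfolding E_def
      proof (intro Bochner_Integration.integral_cong refl)
        fix y
        show "moll (real (Suc n)) 0 (x - y) * d y = moll (real (Suc n)) 0 (x - y) * dR y"
          using that moll_zero[of "real (Suc n)" "x - y" 0] by (cases "\<bar>x - y\<bar> < 1") (auto simp: dR_def indicator_def)
      qed
      have "(LBINT x. S x * \<bar>d x - e x\<bar>) \<le>
         (LBINT x. S x * \<bar>E n x - e x\<bar> + \<bar>(LBINT y. moll (real (Suc n)) 0 (x - y) * dR y) - dR x\<bar>)"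
      proof (rule integral_mono)
        show "integrable lborel (\<lambda>x. S x * \<bar>d x - e x\<bar>)" unfolding pull using Sd Se by simp
        show "integrable lborel (\<lambda>x. S x * \<bar>E n x - e x\<bar> + \<bar>(LBINT y. moll (real (Suc n)) 0 (x - y) * dR y) - dR x\<bar>)"
          using Ei conv_int dR by (intro Bochner_Integration.integrable_add integrable_abs Bochner_Integration.integrable_diff)
        fix x
        show "S x * \<bar>d x - e x\<bar> \<le> S x * \<bar>E n x - e x\<bar> + \<bar>(LBINT y. moll (real (Suc n)) 0 (x - y) * dR y) - dR x\<bar>"
        proof (cases "\<bar>x\<bar> \<le> R")
          case True
          then have "S x = 1" "dR x = d x" by (auto simp: S_def dR_def indicator_def abs_le_iff)
          then show ?thesis unfolding E_eq[OF True, symmetric] by simp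
        next
          case False
          then have "S x = 0" by (auto simp: S_def indicator_def abs_le_iff)
          then show ?thesis by simp
        qed
      qed
      also have "\<dots> = (LBINT x. S x * \<bar>E n x - e x\<bar>) + L n"
        unfolding L_def using Ei conv_int dR
        by (intro Bochner_Integration.integral_add integrable_abs Bochner_Integration.integrable_diff)
      finally show ?thesis .
    qed
    have "(LBINT x. S x * \<bar>d x - e x\<bar>) \<le> 0"
      using LIMSEQ_le_const[OF tendsto_add[OF l1 l2]] le by auto
    moreover have i: "integrable lborel (\<lambda>x. S x * \<bar>d x - e x\<bar>)" unfolding pull using Sd Se by simp
    moreover have nn: "AE x in lborel. 0 \<le> S x * \<bar>d x - e x\<bar>" by (simp add: S_def)
    ultimately have "(LBINT x. S x * \<bar>d x - e x\<bar>) = 0" using integral_nonneg_AE[OF nn] by linarith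
    then have "AE x in lborel. S x * \<bar>d x - e x\<bar> = 0"
      using integral_nonneg_eq_0_iff_AE[OF i nn] by simp
    then show ?thesis by eventually_elim (auto simp: S_def indicator_def split: if_splits)
  qed
  have "AE x in lborel. \<forall>k. \<bar>x\<bar> \<le> real k \<longrightarrow> d x = e x"
    unfolding AE_all_countable using * by blast
  then show ?thesis
  proof eventually_elim
    fix x assume "\<forall>k. \<bar>x\<bar> \<le> real k \<longrightarrow> d x = e x"
    then show "d x = e x" using real_arch_simple[of "\<bar>x\<bar>"] by blast
  qed
qed

text \<open>Both derivatives have the same mollifications, namely the convolutions of v with
  \<open>moll N 1\<close>, so their difference mollifies to 0.\<close>

lemma weak_deriv_unique:
  assumes 1: "has_weak_deriv v g1" and 2: "has_weak_deriv v g2"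
  shows "AE x in lborel. g1 x = g2 x"
proof -
  have li: "locally_integrable g1" "locally_integrable g2" using 1 2 by (auto simp: has_weak_deriv_def)
  have [measurable]: "g1 \<in> borel_measurable borel" "g2 \<in> borel_measurable borel" using li by measurable
  have "locally_integrable (\<lambda>x. g1 x - g2 x)"
    by (rule locally_integrableI) (use locally_integrable_indicator[OF li(1)] locally_integrable_indicator[OF li(2)] in
        \<open>auto simp: right_diff_distrib\<close>)
  moreover have "(LBINT y. moll (real (Suc n)) 0 (x - y) * (g1 y - g2 y)) = 0" for n x
    using weak_deriv_moll(1)[OF 1, of "real (Suc n)" 0 x] weak_deriv_moll(1)[OF 2, of "real (Suc n)" 0 x]
      locally_integrable_moll_mult[OF li(1), of "real (Suc n)" 0 x] locally_integrable_moll_mult[OF li(2), of "real (Suc n)" 0 x]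
    by (simp add: right_diff_distrib)
  ultimately have "AE x in lborel. g1 x - g2 x = 0" by (intro mollified_limit_AE) auto
  then show ?thesis by simp
qed

text \<open>\<open>weak_deriv\<close> is an arbitrary choice among the weak derivatives. By
  uniqueness it agrees, up to a null set, with one that is known to be square integrable.\<close>

lemma H1_weak_deriv:
  assumes "v \<in> H1"
  obtains g where "g \<in> L2" "has_weak_deriv v g" "AE x in lborel. weak_deriv v x = g x"
proof -
  obtain g where g: "g \<in> L2" "has_weak_deriv v g" using assms by (auto simp: H1_def)
  have "has_weak_deriv v (weak_deriv v)" unfolding weak_deriv_def by (rule someI[of _ g]) (rule g)
  then show ?thesis using that[OF g] weak_deriv_unique g(2) by blast
qed

text \<open>\<open>w\<close> is absolutely continuous with derivative \<open>g\<close>; half-open intervals make the integral additive.\<close>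

definition primitive_of :: "(real \<Rightarrow> real) \<Rightarrow> (real \<Rightarrow> real) \<Rightarrow> bool" where
  "primitive_of w g \<longleftrightarrow> locally_integrable g \<and>
     (\<forall>a b. a \<le> b \<longrightarrow> w b - w a = (LBINT x. indicator {a<..b} x * g x))"

text \<open>The increment of the mollification \<open>V n\<close> over (a, b] is the integral of the
  mollified g, which converges. Convergence at the single point 0 therefore gives it everywhere, and
  it is obtained by averaging over (0, 1], where the integrals of \<open>V n\<close> are known to
  converge.\<close>

lemma H1_representative:
  assumes v: "v \<in> L2" and g: "g \<in> L2" and wd: "has_weak_deriv v g"
  obtains w where "AE x in lborel. v x = w x" "primitive_of w g"
proof -
  have [measurable]: "v \<in> borel_measurable borel" "g \<in> borel_measurable borel"
    using v g by (auto simp: L2_measurable)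
  define V where "V n x = (LBINT y. moll (real (Suc n)) 0 (x - y) * v y)" for n x
  define I where "I a b = (LBINT x. indicator {a<..b} x * g x)" for a b :: real
  define J where "J n a b = (LBINT x. (LBINT y. moll (real (Suc n)) 0 (x - y) * indicator {a<..b} x * g y))" for n and a b :: real
  have moll_real: "moll (real (Suc n)) 0 z = real (Suc n) * mollifier_deriv 0 (real (Suc n) * z)" for n z
    by (simp add: moll_def)
  have J_lim: "(\<lambda>n. J n a b) \<longlonglongrightarrow> I a b" for a b
    using approximate_identity_tendsto[OF integrable_mollifier_deriv[of 0] indicator_L2 g, of a b]
    by (simp only: moll_real[symmetric] integral_mollifier mult_1 J_def I_def)
  have m0: "\<bar>moll (real (Suc n)) 0 z\<bar> \<le> moll (real (Suc n)) 0 z" for n z using moll_nonneg by simp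
  have im: "integrable lborel (moll (real (Suc n)) j)" for n j by (rule integrable_moll) simp
  have J_bound: "\<bar>J n a b\<bar> \<le> sqrt (b - a) * L2norm g" if "a \<le> b" for n a b
    using dominated_kernel_bound[OF im[of n 0] _ m0 indicator_L2 g, of a b] that
    by (simp add: J_def integral_moll L2norm_indicator)
  \<comment> \<open>Exchanging the integrals and applying the fundamental theorem to the kernel in x
    avoids differentiating \<open>V n\<close> under the integral sign.\<close>
  have V_diff: "V n b - V n a = J n a b" if ab: "a \<le> b" for n a b
  proof -
    let ?N = "real (Suc n)"
    have "J n a b = (LBINT x. indicator {a<..b} x * (LBINT y. moll ?N 0 (x - y) * g y))"
      unfolding J_def by (subst integral_mult_right_zero[symmetric]) (simp add: ac_simps)
    also have "\<dots> = (LBINT x. indicator {a<..b} x * (LBINT y. moll ?N 1 (x - y) * v y))"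
      using weak_deriv_moll(1)[OF wd, of ?N 0] by simp
    also have "\<dots> = (LBINT x. (LBINT y. moll ?N 1 (x - y) * indicator {a<..b} x * v y))"
      by (subst integral_mult_right_zero[symmetric]) (simp add: ac_simps)
    also have "\<dots> = (LBINT y. (LBINT x. moll ?N 1 (x - y) * indicator {a<..b} x * v y))"
      by (rule dominated_kernel_swap[OF integrable_abs[OF im[of n 1]] _ _ indicator_L2 v]) auto
    also have "\<dots> = (LBINT y. (moll ?N 0 (b - y) - moll ?N 0 (a - y)) * v y)"
    proof (intro Bochner_Integration.integral_cong refl)
      fix y
      have "(LBINT x. moll ?N 1 (x - y) * indicator {a<..b} x) = (LBINT x. moll ?N 1 (x - y) * indicator {a..b} x)"
        by (rule integral_cong_AE) (use AE_lborel_singleton[of a] in \<open>auto elim!: eventually_mono simp: indicator_def\<close>)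
      also have "\<dots> = moll ?N 0 (b - y) - moll ?N 0 (a - y)"
        by (rule integral_FTC_Icc_real[OF ab, of "\<lambda>x. moll ?N 0 (x - y)"])
           (auto intro!: derivative_eq_intros continuous_intros DERIV_isCont[OF has_real_derivative_moll])
      finally show "(LBINT x. moll ?N 1 (x - y) * indicator {a<..b} x * v y) = (moll ?N 0 (b - y) - moll ?N 0 (a - y)) * v y"
        by simp
    qed
    also have "\<dots> = V n b - V n a"
      unfolding V_def left_diff_distrib
      by (rule Bochner_Integration.integral_diff; rule locally_integrable_moll_mult[OF L2_locally_integrable[OF v]]) simp_all
    finally show ?thesis by simp
  qed
  have [measurable]: "V n \<in> borel_measurable borel" for n unfolding V_def by measurable
  have g0: "0 \<le> L2norm g" by simp
  have V01: "\<bar>V n x - V n 0\<bar> \<le> L2norm g" if "x \<in> {0<..1}" for n x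
    using J_bound[of 0 x n] V_diff[of 0 x n] that mult_right_mono[of "sqrt x" 1 "L2norm g"] by auto
  have lim_I: "(\<lambda>n. LBINT x. indicator {0<..1} x * (V n x - V n 0)) \<longlonglongrightarrow> (LBINT x. indicator {0<..1} x * I 0 x)"
  proof (rule integral_dominated_convergence)
    show "(\<lambda>x. indicator {0<..1} x * I 0 x) \<in> borel_measurable lborel"
    proof (rule borel_measurable_LIMSEQ_real)
      show "(\<lambda>n. indicator {0<..1} x * (V n x - V n 0)) \<longlonglongrightarrow> indicator {0<..1} x * I 0 x" for x :: real
        by (cases "x \<in> {0<..1}") (use J_lim V_diff in auto)
    qed measurable
    show "integrable lborel (\<lambda>x::real. indicator {0<..1} x * L2norm g)" by simp
    show "AE x in lborel. (\<lambda>n. indicator {0<..1} x * (V n x - V n 0)) \<longlonglongrightarrow> indicator {0<..1} x * I 0 x"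
    proof (rule AE_I2)
      show "(\<lambda>n. indicator {0<..1} x * (V n x - V n 0)) \<longlonglongrightarrow> indicator {0<..1} x * I 0 x" for x :: real
        by (cases "x \<in> {0<..1}") (use J_lim V_diff in auto)
    qed
    show "AE x in lborel. norm (indicator {0<..1} x * (V n x - V n 0)) \<le> indicator {0<..1} x * L2norm g" for n
      using V01 by (intro AE_I2) (auto simp: indicator_def)
  qed measurable
  have lim_v: "(\<lambda>n. LBINT x. indicator {0<..1} x * V n x) \<longlonglongrightarrow> (LBINT x. indicator {0<..1} x * v x)"
  proof -
    have "(LBINT x. (LBINT y. moll (real (Suc n)) 0 (x - y) * indicator {0<..1} x * v y)) = (LBINT x. indicator {0<..1} x * V n x)" for n
      unfolding V_def by (subst integral_mult_right_zero[symmetric]) (simp add: ac_simps)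
    then show ?thesis
      using approximate_identity_tendsto[OF integrable_mollifier_deriv[of 0] indicator_L2 v, of 0 1]
      by (simp only: moll_real[symmetric] integral_mollifier mult_1)
  qed
  \<comment> \<open>The interval (0, 1] has length 1, so \<open>V n 0\<close> is its own average;
    both integrals on the right converge.\<close>
  have V0_eq: "V n 0 = (LBINT x. indicator {0<..1} x * V n x) - (LBINT x. indicator {0<..1} x * (V n x - V n 0))" for n
  proof -
    have "integrable lborel (\<lambda>x. indicator {0<..1} x * (V n x - V n 0))"
    proof (rule Bochner_Integration.integrable_bound)
      show "integrable lborel (\<lambda>x::real. indicator {0<..1} x * L2norm g)" by simp
      show "AE x in lborel. norm (indicator {0<..1} x * (V n x - V n 0)) \<le> norm (indicator {0<..1} x * L2norm g)"
        using V01 by (intro AE_I2) (auto simp: indicator_def)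
    qed measurable
    moreover have i1: "integrable lborel (\<lambda>x::real. indicator {0<..1} x * V n 0)" by simp
    ultimately have "integrable lborel (\<lambda>x. indicator {0<..1} x * (V n x - V n 0) + indicator {0<..1} x * V n 0)"
      by (rule Bochner_Integration.integrable_add)
    then have "integrable lborel (\<lambda>x. indicator {0<..1} x * V n x)" by (simp add: algebra_simps)
    then show ?thesis using i1 by (simp add: right_diff_distrib)
  qed
  have "(\<lambda>n. V n 0) = (\<lambda>n. (LBINT x. indicator {0<..1} x * V n x) - (LBINT x. indicator {0<..1} x * (V n x - V n 0)))"
    using V0_eq by (rule ext)
  then have "(\<lambda>n. V n 0) \<longlonglongrightarrow> (LBINT x. indicator {0<..1} x * v x) - (LBINT x. indicator {0<..1} x * I 0 x)"
    using tendsto_diff[OF lim_v lim_I] by (simp only:)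
  then have conv0: "convergent (\<lambda>n. V n 0)" unfolding convergent_def by blast
  have conv: "convergent (\<lambda>n. V n x)" for x
  proof (cases "0 \<le> x")
    case True
    then have "V n x = V n 0 + J n 0 x" for n using V_diff[of 0 x n] by simp
    then show ?thesis using conv0 J_lim by (simp add: convergent_add convergentI[OF J_lim])
  next
    case False
    then have "V n x = V n 0 - J n x 0" for n using V_diff[of x 0 n] by simp
    then show ?thesis using conv0 J_lim by (simp add: convergent_diff convergentI[OF J_lim])
  qed
  define w where "w x = lim (\<lambda>n. V n x)" for x
  have w: "(\<lambda>n. V n x) \<longlonglongrightarrow> w x" for x unfolding w_def using conv convergent_LIMSEQ_iff by blast
  have "primitive_of w g"
    unfolding primitive_of_def
  proof (intro conjI allI impI)
    fix a b :: real assume "a \<le> b"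
    then have "(\<lambda>n. V n b - V n a) \<longlonglongrightarrow> I a b" using V_diff J_lim by simp
    then show "w b - w a = (LBINT x. indicator {a<..b} x * g x)"
      using LIMSEQ_unique[OF tendsto_diff[OF w w]] by (simp add: I_def)
  qed (rule L2_locally_integrable[OF g])
  moreover have "AE x in lborel. v x = w x"
  proof (rule mollified_limit_AE[OF L2_locally_integrable[OF v]])
    show "(\<lambda>n. LBINT y. moll (real (Suc n)) 0 (x - y) * v y) \<longlonglongrightarrow> w x" for x
      using w by (simp add: V_def)
    fix R :: real
    obtain M where M: "\<And>n. \<bar>V n 0\<bar> \<le> M" using convergent_imp_Bseq[OF conv0]
      by (auto simp: Bseq_def)
    have "\<bar>V n x\<bar> \<le> M + sqrt R * L2norm g" if "\<bar>x\<bar> \<le> R" for n x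
    proof -
      have "\<bar>V n x - V n 0\<bar> \<le> sqrt \<bar>x\<bar> * L2norm g"
        using J_bound[of 0 x n] J_bound[of x 0 n] V_diff[of 0 x n] V_diff[of x 0 n] by (cases "0 \<le> x") auto
      also have "\<dots> \<le> sqrt R * L2norm g" using that by (intro mult_right_mono) auto
      finally show ?thesis using M[of n] by linarith
    qed
    then show "\<exists>M. \<forall>n x. \<bar>x\<bar> \<le> R \<longrightarrow> \<bar>LBINT y. moll (real (Suc n)) 0 (x - y) * v y\<bar> \<le> M"
      unfolding V_def by blast
  qed
  ultimately show ?thesis using that by blast
qed

section \<open>Absolutely continuous functions\<close>

text \<open>Walk from a to b in steps of length at most \<delta>; the increments of A telescope, so
  the local bounds add up.\<close>

lemma increment_bound_from_local:
  fixes \<Phi> A :: "real \<Rightarrow> real"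
  assumes \<delta>: "0 < \<delta>" and ab: "a \<le> b"
    and loc: "\<And>x y. a \<le> x \<Longrightarrow> x \<le> y \<Longrightarrow> y \<le> b \<Longrightarrow> y - x \<le> \<delta> \<Longrightarrow> \<bar>\<Phi> y - \<Phi> x\<bar> \<le> A y - A x"
  shows "\<bar>\<Phi> b - \<Phi> a\<bar> \<le> A b - A a"
proof -
  have "\<bar>\<Phi> y - \<Phi> a\<bar> \<le> A y - A a" if "a \<le> y" "y \<le> b" "y - a \<le> real n * \<delta>" for n y
    using that
  proof (induction n arbitrary: y)
    case 0
    then show ?case by simp
  next
    case (Suc n)
    show ?case
    proof (cases "y - a \<le> \<delta>")
      case True
      then show ?thesis using loc[of a y] Suc.prems by simp
    next
      case False
      then have "\<bar>\<Phi> (y - \<delta>) - \<Phi> a\<bar> \<le> A (y - \<delta>) - A a"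
        using Suc.prems \<delta> by (intro Suc.IH) (auto simp: algebra_simps)
      moreover have "\<bar>\<Phi> y - \<Phi> (y - \<delta>)\<bar> \<le> A y - A (y - \<delta>)"
        using False Suc.prems \<delta> by (intro loc) auto
      ultimately show ?thesis by linarith
    qed
  qed
  moreover obtain n where "(b - a) / \<delta> \<le> real n" using real_arch_simple by blast
  then have "b - a \<le> real n * \<delta>" using \<delta> by (simp add: field_simps)
  ultimately show ?thesis using ab by blast
qed

lemma locally_integrable_continuous_mult:
  assumes g: "locally_integrable g" and c: "continuous_on UNIV c"
  shows "locally_integrable (\<lambda>x. c x * g x)"
proof (rule locally_integrableI)
  have [measurable]: "g \<in> borel_measurable borel" "c \<in> borel_measurable borel"
    using g c by (measurable, intro borel_measurable_continuous_onI)
  show "(\<lambda>x. c x * g x) \<in> borel_measurable borel" by measurable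
  fix a b :: real
  have "bounded (c ` {a..b})"
    by (intro compact_imp_bounded compact_continuous_image continuous_on_subset[OF c]) auto
  then obtain M where M: "\<And>x. x \<in> {a..b} \<Longrightarrow> \<bar>c x\<bar> \<le> M"
    unfolding bounded_iff by (metis imageI real_norm_def)
  show "integrable lborel (\<lambda>x. indicator {a..b} x * (c x * g x))"
  proof (rule Bochner_Integration.integrable_bound)
    show "integrable lborel (\<lambda>x. M * (indicator {a..b} x * g x))"
      by (intro integrable_mult_right locally_integrable_indicator[OF g])
    show "AE x in lborel. norm (indicator {a..b} x * (c x * g x)) \<le> norm (M * (indicator {a..b} x * g x))"
    proof (rule AE_I2)
      fix x
      show "norm (indicator {a..b} x * (c x * g x)) \<le> norm (M * (indicator {a..b} x * g x))"
      proof (cases "x \<in> {a..b}")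
        case True
        then have "\<bar>c x\<bar> * \<bar>g x\<bar> \<le> \<bar>M\<bar> * \<bar>g x\<bar>" using M[OF True] by (intro mult_right_mono) auto
        then show ?thesis using True by (simp add: abs_mult)
      qed simp
    qed
  qed measurable
qed

lemma locally_integrable_add:
  "locally_integrable f \<Longrightarrow> locally_integrable g \<Longrightarrow> locally_integrable (\<lambda>x. f x + g x)"
  by (rule locally_integrableI)
     (auto simp: distrib_left locally_integrable_indicator intro!: borel_measurable_add locally_integrable_measurable)

lemma locally_integrable_abs: "locally_integrable f \<Longrightarrow> locally_integrable (\<lambda>x. \<bar>f x\<bar>)"
proof (rule locally_integrableI)
  assume f: "locally_integrable f"
  then show "(\<lambda>x. \<bar>f x\<bar>) \<in> borel_measurable borel" by measurable
  show "integrable lborel (\<lambda>x. indicator {a..b} x * \<bar>f x\<bar>)" for a b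
    using integrable_abs[OF locally_integrable_indicator[OF f, of a b]] by (simp add: abs_mult)
qed

lemma locally_integrable_const: "locally_integrable (\<lambda>x. c)"
  by (rule locally_integrableI) auto

lemma locally_integrable_continuous: "continuous_on UNIV c \<Longrightarrow> locally_integrable c"
  using locally_integrable_continuous_mult[OF locally_integrable_const[of 1]] by simp

definition ivl_integral :: "(real \<Rightarrow> real) \<Rightarrow> real \<Rightarrow> real \<Rightarrow> real" where
  "ivl_integral g a b = (LBINT x. indicator {a<..b} x * g x)"

lemma primitive_ofD: "primitive_of w g \<Longrightarrow> a \<le> b \<Longrightarrow> w b - w a = ivl_integral g a b"
  by (simp add: primitive_of_def ivl_integral_def)

lemma primitive_of_locally_integrable: "primitive_of w g \<Longrightarrow> locally_integrable g"
  by (simp add: primitive_of_def)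

lemma ivl_integral_add:
  "locally_integrable f \<Longrightarrow> locally_integrable g \<Longrightarrow>
    ivl_integral (\<lambda>x. f x + g x) a b = ivl_integral f a b + ivl_integral g a b"
  by (simp add: ivl_integral_def distrib_left locally_integrable_indicator_Ioc)

lemma ivl_integral_cmult: "ivl_integral (\<lambda>x. c * g x) a b = c * ivl_integral g a b"
  unfolding ivl_integral_def by (subst integral_mult_right_zero[symmetric]) (simp add: ac_simps)

lemma ivl_integral_const: "a \<le> b \<Longrightarrow> ivl_integral (\<lambda>x. c) a b = c * (b - a)"
  by (simp add: ivl_integral_def)

lemma ivl_integral_diff:
  "locally_integrable f \<Longrightarrow> locally_integrable g \<Longrightarrow>
    ivl_integral (\<lambda>x. f x - g x) a b = ivl_integral f a b - ivl_integral g a b"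
  by (simp add: ivl_integral_def right_diff_distrib locally_integrable_indicator_Ioc)

lemma ivl_integral_combine:
  assumes "locally_integrable g" "a \<le> b" "b \<le> c"
  shows "ivl_integral g a c = ivl_integral g a b + ivl_integral g b c"
proof -
  have "(\<lambda>x. indicator {a<..c} x * g x) = (\<lambda>x. indicator {a<..b} x * g x + indicator {b<..c} x * g x)"
    using assms by (auto simp: indicator_def fun_eq_iff)
  then show ?thesis
    by (simp add: ivl_integral_def locally_integrable_indicator_Ioc assms)
qed

lemma ivl_integral_abs_bound:
  assumes f: "locally_integrable f" and g: "locally_integrable g"
    and le: "\<And>x. x \<in> {a<..b} \<Longrightarrow> \<bar>f x\<bar> \<le> g x"
  shows "\<bar>ivl_integral f a b\<bar> \<le> ivl_integral g a b"
proof -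
  have "\<bar>ivl_integral f a b\<bar> \<le> (LBINT x. \<bar>indicator {a<..b} x * f x\<bar>)"
    unfolding ivl_integral_def by (rule integral_abs_bound)
  also have "\<dots> \<le> ivl_integral g a b"
    unfolding ivl_integral_def
    by (intro integral_mono integrable_abs locally_integrable_indicator_Ioc f g)
       (use le in \<open>auto simp: indicator_def\<close>)
  finally show ?thesis .
qed

text \<open>Errors that on short intervals are at most \<eta> times the mass of a fixed density add
  up to \<eta> times its mass on (a, b], and \<eta> tends to 0. Both the chain rule and the product
  rule for absolutely continuous functions follow from this.\<close>

lemma primitive_of_from_local:
  assumes k: "locally_integrable k" and g: "locally_integrable g"
    and loc: "\<And>a b \<eta>. a \<le> b \<Longrightarrow> 0 < \<eta> \<Longrightarrow> \<exists>\<delta>>0. \<forall>x y. a \<le> x \<longrightarrow> x \<le> y \<longrightarrow> y \<le> b \<longrightarrow> y - x \<le> \<delta> \<longrightarrow>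
       \<bar>W y - W x - ivl_integral k x y\<bar> \<le> \<eta> * ivl_integral g x y"
  shows "primitive_of W k"
  unfolding primitive_of_def
proof (intro conjI allI impI)
  fix a b :: real assume ab: "a \<le> b"
  define \<Phi> where "\<Phi> x = W x - ivl_integral k a x" for x
  have "\<bar>\<Phi> b - \<Phi> a\<bar> \<le> \<eta> * ivl_integral g a b" if \<eta>: "0 < \<eta>" for \<eta>
  proof -
    obtain \<delta> where \<delta>: "0 < \<delta>" "\<And>x y. a \<le> x \<Longrightarrow> x \<le> y \<Longrightarrow> y \<le> b \<Longrightarrow> y - x \<le> \<delta> \<Longrightarrow>
       \<bar>W y - W x - ivl_integral k x y\<bar> \<le> \<eta> * ivl_integral g x y"
      using loc[OF ab \<eta>] by blast
    have "\<bar>\<Phi> b - \<Phi> a\<bar> \<le> \<eta> * ivl_integral g a b - \<eta> * ivl_integral g a a"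
    proof (rule increment_bound_from_local[OF \<delta>(1) ab, where A = "\<lambda>x. \<eta> * ivl_integral g a x"])
      fix x y assume xy: "a \<le> x" "x \<le> y" "y \<le> b" "y - x \<le> \<delta>"
      then show "\<bar>\<Phi> y - \<Phi> x\<bar> \<le> \<eta> * ivl_integral g a y - \<eta> * ivl_integral g a x"
        using \<delta>(2)[OF xy] ivl_integral_combine[OF k xy(1,2)] ivl_integral_combine[OF g xy(1,2)]
        by (simp add: \<Phi>_def algebra_simps)
    qed
    then show ?thesis by (simp add: ivl_integral_def)
  qed
  note le = this
  have "\<bar>\<Phi> b - \<Phi> a\<bar> \<le> 0"
  proof (rule tendsto_lowerbound)
    show "((\<lambda>\<eta>. \<eta> * ivl_integral g a b) \<longlongrightarrow> 0) (at_right 0)" by (auto intro!: tendsto_eq_intros)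
    show "\<forall>\<^sub>F \<eta> in at_right 0. \<bar>\<Phi> b - \<Phi> a\<bar> \<le> \<eta> * ivl_integral g a b"
      using le by (auto simp: eventually_at_right_less eventually_at_filter)
  qed simp
  then show "W b - W a = (LBINT x. indicator {a<..b} x * k x)"
    by (simp add: \<Phi>_def ivl_integral_def)
qed (rule k)

lemma compact_uniform_modulus:
  fixes f :: "real \<Rightarrow> real"
  assumes "continuous_on UNIV f" "0 < \<eta>"
  obtains \<delta> where "0 < \<delta>" "\<And>x y. x \<in> {a..b} \<Longrightarrow> y \<in> {a..b} \<Longrightarrow> \<bar>x - y\<bar> \<le> \<delta> \<Longrightarrow> \<bar>f x - f y\<bar> \<le> \<eta>"
proof -
  have "uniformly_continuous_on {a..b} f"
    by (rule compact_uniformly_continuous) (use assms continuous_on_subset in auto)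
  then obtain d where d: "0 < d" "\<And>x y. x \<in> {a..b} \<Longrightarrow> y \<in> {a..b} \<Longrightarrow> dist y x < d \<Longrightarrow> dist (f y) (f x) < \<eta>"
    unfolding uniformly_continuous_on_def using assms(2) by metis
  show ?thesis
    by (rule that[of "d / 2"]) (use d in \<open>auto simp: dist_real_def intro!: less_imp_le\<close>)
qed

text \<open>The mean value theorem gives an intermediate value between w(x) and w(y), and continuity
  of w makes it a value w(\<xi>) with \<xi> in [x, y]. Replacing \<psi>'(w(\<xi>)) by \<psi>'(w(z))
  under the integral costs at most \<eta> |g(z)| on a short interval.\<close>

lemma primitive_of_compose:
  assumes w: "primitive_of w g" and cw: "continuous_on UNIV w"
    and \<psi>: "\<And>s. (\<psi> has_real_derivative \<psi>' s) (at s)" and c\<psi>': "continuous_on UNIV \<psi>'"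
  shows "primitive_of (\<lambda>x. \<psi> (w x)) (\<lambda>x. \<psi>' (w x) * g x)"
proof (rule primitive_of_from_local[where g = "\<lambda>x. \<bar>g x\<bar>"])
  have g: "locally_integrable g" by (rule primitive_of_locally_integrable[OF w])
  have c: "continuous_on UNIV (\<lambda>x. \<psi>' (w x))" using continuous_on_compose2[OF c\<psi>' cw] by simp
  show k: "locally_integrable (\<lambda>x. \<psi>' (w x) * g x)" by (rule locally_integrable_continuous_mult[OF g c])
  show "locally_integrable (\<lambda>x. \<bar>g x\<bar>)" by (rule locally_integrable_abs[OF g])
  fix a b \<eta> :: real assume "a \<le> b" "0 < \<eta>"
  obtain \<delta> where \<delta>: "0 < \<delta>" "\<And>x y. x \<in> {a..b} \<Longrightarrow> y \<in> {a..b} \<Longrightarrow> \<bar>x - y\<bar> \<le> \<delta> \<Longrightarrow> \<bar>\<psi>' (w x) - \<psi>' (w y)\<bar> \<le> \<eta>"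
    using compact_uniform_modulus[OF c \<open>0 < \<eta>\<close>] by blast
  show "\<exists>\<delta>>0. \<forall>x y. a \<le> x \<longrightarrow> x \<le> y \<longrightarrow> y \<le> b \<longrightarrow> y - x \<le> \<delta> \<longrightarrow>
     \<bar>\<psi> (w y) - \<psi> (w x) - ivl_integral (\<lambda>x. \<psi>' (w x) * g x) x y\<bar> \<le> \<eta> * ivl_integral (\<lambda>x. \<bar>g x\<bar>) x y"
  proof (intro exI[of _ \<delta>] conjI allI impI)
    fix x y assume xy: "a \<le> x" "x \<le> y" "y \<le> b" "y - x \<le> \<delta>"
    have "\<exists>\<xi>\<in>{x..y}. \<psi> (w y) - \<psi> (w x) = \<psi>' (w \<xi>) * (w y - w x)"
    proof -
      have mvt: "\<exists>\<theta>. p \<le> \<theta> \<and> \<theta> \<le> q \<and> \<psi> q - \<psi> p = \<psi>' \<theta> * (q - p)" if "p \<le> q" for p q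
      proof (cases "p = q")
        case False
        then have "p < q" using that by simp
        from MVT2[OF this \<psi>] obtain \<theta> where "p < \<theta>" "\<theta> < q" "\<psi> q - \<psi> p = (q - p) * \<psi>' \<theta>"
          by auto
        then show ?thesis by (auto intro!: exI[of _ \<theta>])
      qed auto
      obtain \<theta> where \<theta>: "min (w x) (w y) \<le> \<theta>" "\<theta> \<le> max (w x) (w y)" "\<psi> (w y) - \<psi> (w x) = \<psi>' \<theta> * (w y - w x)"
      proof (cases "w x \<le> w y")
        case True
        then show ?thesis using mvt[OF True] that by auto
      next
        case False
        then obtain \<theta> where "w y \<le> \<theta>" "\<theta> \<le> w x" "\<psi> (w x) - \<psi> (w y) = \<psi>' \<theta> * (w x - w y)"
          using mvt[of "w y" "w x"] by auto
        then show ?thesis using False that[of \<theta>] by (auto simp: algebra_simps)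
      qed
      have "continuous_on {x..y} w" using cw continuous_on_subset by blast
      then have "\<exists>\<xi>\<ge>x. \<xi> \<le> y \<and> w \<xi> = \<theta>"
        using IVT'[of w x \<theta> y] IVT2'[of w y \<theta> x] \<theta>(1,2) xy(2) by (cases "w x \<le> w y") auto
      then show ?thesis using \<theta>(3) by auto
    qed
    then obtain \<xi> where \<xi>: "\<xi> \<in> {x..y}" "\<psi> (w y) - \<psi> (w x) = \<psi>' (w \<xi>) * (w y - w x)" by blast
    have "\<psi> (w y) - \<psi> (w x) - ivl_integral (\<lambda>x. \<psi>' (w x) * g x) x y =
        ivl_integral (\<lambda>z. \<psi>' (w \<xi>) * g z - \<psi>' (w z) * g z) x y"
      by (subst ivl_integral_diff[OF _ k])
         (auto simp: ivl_integral_cmult \<xi>(2) primitive_ofD[OF w xy(2)]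
           intro!: locally_integrable_continuous_mult[OF g] continuous_intros)
    also have "\<bar>\<dots>\<bar> \<le> ivl_integral (\<lambda>z. \<eta> * \<bar>g z\<bar>) x y"
    proof (rule ivl_integral_abs_bound)
      show "locally_integrable (\<lambda>z. \<psi>' (w \<xi>) * g z - \<psi>' (w z) * g z)"
        unfolding left_diff_distrib[symmetric]
        by (intro locally_integrable_continuous_mult[OF g] continuous_intros c)
      show "locally_integrable (\<lambda>z. \<eta> * \<bar>g z\<bar>)"
        by (intro locally_integrable_continuous_mult locally_integrable_abs g continuous_intros)
      fix z assume "z \<in> {x<..y}"
      then have "\<bar>\<psi>' (w \<xi>) - \<psi>' (w z)\<bar> \<le> \<eta>" using \<xi>(1) xy by (intro \<delta>(2)) auto
      then show "\<bar>\<psi>' (w \<xi>) * g z - \<psi>' (w z) * g z\<bar> \<le> \<eta> * \<bar>g z\<bar>"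
        unfolding left_diff_distrib[symmetric] abs_mult by (rule mult_right_mono) simp
    qed
    finally show "\<bar>\<psi> (w y) - \<psi> (w x) - ivl_integral (\<lambda>x. \<psi>' (w x) * g x) x y\<bar> \<le> \<eta> * ivl_integral (\<lambda>x. \<bar>g x\<bar>) x y"
      by (simp add: ivl_integral_cmult)
  qed (rule \<delta>(1))
qed

text \<open>From y W(y) - x W(x) = (y - x) W(y) + x (W(y) - W(x)). Freezing W at y and the linear
  factor at x produces the errors |W(y) - W(z)| and |x - z| |k(z)|, which the density 1 + |k|
  absorbs.\<close>

lemma primitive_of_times_id:
  assumes W: "primitive_of W k" and cW: "continuous_on UNIV W"
  shows "primitive_of (\<lambda>x. x * W x) (\<lambda>x. W x + x * k x)"
proof (rule primitive_of_from_local[where g = "\<lambda>x. 1 + \<bar>k x\<bar>"])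
  have k: "locally_integrable k" by (rule primitive_of_locally_integrable[OF W])
  show q: "locally_integrable (\<lambda>x. W x + x * k x)"
    by (intro locally_integrable_add locally_integrable_continuous[OF cW] locally_integrable_continuous_mult k continuous_intros)
  show "locally_integrable (\<lambda>x. 1 + \<bar>k x\<bar>)"
    by (intro locally_integrable_add locally_integrable_const locally_integrable_abs k)
  fix a b \<eta> :: real assume "a \<le> b" "0 < \<eta>"
  obtain \<delta> where \<delta>: "0 < \<delta>" "\<And>x y. x \<in> {a..b} \<Longrightarrow> y \<in> {a..b} \<Longrightarrow> \<bar>x - y\<bar> \<le> \<delta> \<Longrightarrow> \<bar>W x - W y\<bar> \<le> \<eta>"
    using compact_uniform_modulus[OF cW \<open>0 < \<eta>\<close>] by blast
  show "\<exists>\<delta>>0. \<forall>x y. a \<le> x \<longrightarrow> x \<le> y \<longrightarrow> y \<le> b \<longrightarrow> y - x \<le> \<delta> \<longrightarrow>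
     \<bar>y * W y - x * W x - ivl_integral (\<lambda>x. W x + x * k x) x y\<bar> \<le> \<eta> * ivl_integral (\<lambda>x. 1 + \<bar>k x\<bar>) x y"
  \<comment> \<open>Here \<delta> controls the oscillation of W, and the bound y - x <= \<eta>
    controls the factor |x - z|.\<close>
  proof (intro exI[of _ "min \<delta> \<eta>"] conjI allI impI)
    fix x y assume xy: "a \<le> x" "x \<le> y" "y \<le> b" "y - x \<le> min \<delta> \<eta>"
    have li: "locally_integrable (\<lambda>z. W y + x * k z)"
      by (intro locally_integrable_add locally_integrable_const locally_integrable_continuous_mult k continuous_intros)
    have "y * W y - x * W x = ivl_integral (\<lambda>z. W y + x * k z) x y"
      by (subst ivl_integral_add)
         (auto simp: ivl_integral_cmult ivl_integral_const xy primitive_ofD[OF W xy(2), symmetric] algebra_simps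
           intro!: locally_integrable_const locally_integrable_continuous_mult k continuous_intros)
    then have "y * W y - x * W x - ivl_integral (\<lambda>x. W x + x * k x) x y =
        ivl_integral (\<lambda>z. (W y + x * k z) - (W z + z * k z)) x y"
      by (simp add: ivl_integral_diff[OF li q])
    also have "\<bar>\<dots>\<bar> \<le> ivl_integral (\<lambda>z. \<eta> * (1 + \<bar>k z\<bar>)) x y"
    proof (rule ivl_integral_abs_bound)
      have "locally_integrable (\<lambda>z. (W y + x * k z) + (-1) * (W z + z * k z))"
        by (intro locally_integrable_add[OF li] locally_integrable_continuous_mult q continuous_intros)
      then show "locally_integrable (\<lambda>z. (W y + x * k z) - (W z + z * k z))" by (simp add: algebra_simps)
      show "locally_integrable (\<lambda>z. \<eta> * (1 + \<bar>k z\<bar>))"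
        by (intro locally_integrable_continuous_mult locally_integrable_add locally_integrable_const locally_integrable_abs k continuous_intros)
      fix z assume z: "z \<in> {x<..y}"
      then have 1: "\<bar>W y - W z\<bar> \<le> \<eta>" using xy by (intro \<delta>(2)) auto
      have "\<bar>x - z\<bar> \<le> \<eta>" using z xy by auto
      then have 2: "\<bar>(x - z) * k z\<bar> \<le> \<eta> * \<bar>k z\<bar>" unfolding abs_mult by (rule mult_right_mono) simp
      have "(W y + x * k z) - (W z + z * k z) = (W y - W z) + (x - z) * k z" by (simp add: algebra_simps)
      then show "\<bar>(W y + x * k z) - (W z + z * k z)\<bar> \<le> \<eta> * (1 + \<bar>k z\<bar>)"
        using 1 2 abs_triangle_ineq[of "W y - W z" "(x - z) * k z"] by (simp add: distrib_left)
    qed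
    finally show "\<bar>y * W y - x * W x - ivl_integral (\<lambda>x. W x + x * k x) x y\<bar> \<le> \<eta> * ivl_integral (\<lambda>x. 1 + \<bar>k x\<bar>) x y"
      by (simp add: ivl_integral_cmult)
  qed (use \<delta>(1) \<open>0 < \<eta>\<close> in auto)
qed

text \<open>Cauchy-Schwarz on an interval gives Hoelder continuity of order 1/2.\<close>

lemma primitive_of_continuous:
  assumes w: "primitive_of w g" and g: "g \<in> L2"
  shows "continuous_on UNIV w"
proof -
  have le: "\<bar>w b - w a\<bar> \<le> sqrt (b - a) * L2norm g" if "a \<le> b" for a b
    using L2_Cauchy_Schwarz'[OF indicator_L2 g, of a b] L2norm_indicator[OF that] w that
    by (simp add: primitive_of_def)
  have le': "\<bar>w y - w x\<bar> \<le> sqrt \<bar>y - x\<bar> * L2norm g" for x y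
    using le[of x y] le[of y x] by (cases "x \<le> y") (auto simp: abs_minus_commute)
  have "isCont w x" for x
    unfolding isCont_def
  proof (rule LIM_zero_cancel, rule Lim_null_comparison)
    show "\<forall>\<^sub>F y in at x. norm (w y - w x) \<le> sqrt \<bar>y - x\<bar> * L2norm g" using le' by simp
    have "((\<lambda>y. sqrt \<bar>y - x\<bar> * L2norm g) \<longlongrightarrow> sqrt \<bar>x - x\<bar> * L2norm g) (at x)" by (intro tendsto_intros)
    then show "((\<lambda>y. sqrt \<bar>y - x\<bar> * L2norm g) \<longlongrightarrow> 0) (at x)" by simp
  qed
  then show ?thesis by (simp add: continuous_at_imp_continuous_on)
qed

text \<open>Compare w(x)^2 with w(y)^2, where y runs over the unit interval next to x on the side
  away from the origin, and average over y. On that side m >= m(x), so m(x) can be moved under the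
  integral. Applied with m = \<open>wt\<close> for decay and with m = 1 for the plain Sobolev
  bound.\<close>

lemma weighted_sup_bound:
  assumes w: "primitive_of w g" and w2: "w \<in> L2" and g2: "g \<in> L2"
    and m1: "\<And>x. 1 \<le> m x" and mono: "\<And>x z. \<bar>x\<bar> \<le> \<bar>z\<bar> \<Longrightarrow> m x \<le> m z"
    and mw: "(\<lambda>x. m x * w x) \<in> L2"
  shows "m x * (w x)\<^sup>2 \<le> (LBINT z. 2 * (m z * w z)\<^sup>2 + (g z)\<^sup>2)"
proof -
  have cw: "continuous_on UNIV w" by (rule primitive_of_continuous[OF w g2])
  have [measurable]: "w \<in> borel_measurable borel" "g \<in> borel_measurable borel"
    using w2 g2 by (auto simp: L2_measurable)
  have sq: "primitive_of (\<lambda>x. (w x)\<^sup>2) (\<lambda>x. 2 * w x * g x)"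
    by (rule primitive_of_compose[OF w cw]) (auto intro!: derivative_eq_intros continuous_intros)
  have wg: "integrable lborel (\<lambda>z. \<bar>w z * g z\<bar>)" using L2_mult_integrable[OF w2 g2] by simp
  have main: "m x * (w x)\<^sup>2 \<le> (LBINT z. 2 * (m z * w z)\<^sup>2 + (g z)\<^sup>2)"
    if TZ: "T \<subseteq> Z" and [measurable]: "Z \<in> sets borel" "T \<in> sets borel" and T: "(LBINT z. indicator T z) = (1::real)"
      and Ti: "integrable lborel (indicator T :: real \<Rightarrow> real)"
      and Zm: "\<And>z. z \<in> Z \<Longrightarrow> m x \<le> m z"
      and inc: "\<And>y. y \<in> T \<Longrightarrow> (w x)\<^sup>2 \<le> (w y)\<^sup>2 + (LBINT z. indicator Z z * (2 * \<bar>w z * g z\<bar>))" for T Z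
  proof -
    have iZ: "integrable lborel (\<lambda>z. indicator Z z * (2 * \<bar>w z * g z\<bar>))"
      by (rule Bochner_Integration.integrable_bound[OF integrable_mult_right[OF wg, of 2]])
         (auto simp: indicator_def intro!: AE_I2)
    have iT: "integrable lborel (\<lambda>y. indicator T y * (w y)\<^sup>2)"
      by (rule Bochner_Integration.integrable_bound[OF L2_integrable_square[OF w2]])
         (auto simp: indicator_def intro!: AE_I2)
    have "(w x)\<^sup>2 = (LBINT y. indicator T y * (w x)\<^sup>2)" using T by simp
    also have "\<dots> \<le> (LBINT y. indicator T y * (w y)\<^sup>2 + indicator T y * (LBINT z. indicator Z z * (2 * \<bar>w z * g z\<bar>)))"
    proof (rule integral_mono)
      show "integrable lborel (\<lambda>y. indicator T y * (w x)\<^sup>2)" using Ti by simp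
      show "integrable lborel (\<lambda>y. indicator T y * (w y)\<^sup>2 + indicator T y * (LBINT z. indicator Z z * (2 * \<bar>w z * g z\<bar>)))"
        using iT Ti by simp
      fix y
      show "indicator T y * (w x)\<^sup>2 \<le> indicator T y * (w y)\<^sup>2 + indicator T y * (LBINT z. indicator Z z * (2 * \<bar>w z * g z\<bar>))"
        using inc[of y] by (cases "y \<in> T") auto
    qed
    also have "\<dots> = (LBINT z. indicator T z * (w z)\<^sup>2 + indicator Z z * (2 * \<bar>w z * g z\<bar>))"
      using iT iZ Ti T by simp
    finally have 1: "(w x)\<^sup>2 \<le> (LBINT z. indicator T z * (w z)\<^sup>2 + indicator Z z * (2 * \<bar>w z * g z\<bar>))" .
    have mx: "0 \<le> m x" using m1[of x] by linarith
    have "m x * (w x)\<^sup>2 \<le> m x * (LBINT z. indicator T z * (w z)\<^sup>2 + indicator Z z * (2 * \<bar>w z * g z\<bar>))"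
      using 1 mx by (rule mult_left_mono)
    also have "\<dots> = (LBINT z. m x * (indicator T z * (w z)\<^sup>2 + indicator Z z * (2 * \<bar>w z * g z\<bar>)))" by simp
    also have "\<dots> \<le> (LBINT z. 2 * (m z * w z)\<^sup>2 + (g z)\<^sup>2)"
    proof (rule integral_mono)
      show "integrable lborel (\<lambda>z. m x * (indicator T z * (w z)\<^sup>2 + indicator Z z * (2 * \<bar>w z * g z\<bar>)))"
        using iT iZ by simp
      show "integrable lborel (\<lambda>z. 2 * (m z * w z)\<^sup>2 + (g z)\<^sup>2)"
        by (intro Bochner_Integration.integrable_add integrable_mult_right L2_integrable_square mw g2)
      fix z
      show "m x * (indicator T z * (w z)\<^sup>2 + indicator Z z * (2 * \<bar>w z * g z\<bar>)) \<le> 2 * (m z * w z)\<^sup>2 + (g z)\<^sup>2"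
      proof (cases "z \<in> Z")
        case True
        \<comment> \<open>Since m >= 1, m(x) <= m(z) <= m(z)^2. One square of m w comes from this
          averaged term, the other from the arithmetic-geometric mean for the product with g; hence
          the factor 2.\<close>
        have "m x * (w z)\<^sup>2 \<le> (m z)\<^sup>2 * (w z)\<^sup>2"
        proof (rule mult_right_mono)
          have "m z * 1 \<le> m z * m z" using m1[of z] by (intro mult_left_mono) auto
          then show "m x \<le> (m z)\<^sup>2" using Zm[OF True] by (simp add: power2_eq_square)
        qed simp
        then have a: "m x * (indicator T z * (w z)\<^sup>2) \<le> (m z * w z)\<^sup>2"
          using mx by (auto simp: indicator_def power_mult_distrib)
        have "m x * (2 * \<bar>w z * g z\<bar>) \<le> m z * (2 * \<bar>w z * g z\<bar>)"
          by (rule mult_right_mono[OF Zm[OF True]]) simp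
        also have "\<dots> = 2 * \<bar>(m z * w z) * g z\<bar>" using m1[of z] by (simp add: abs_mult)
        also have "\<dots> \<le> (m z * w z)\<^sup>2 + (g z)\<^sup>2"
          using abs_mult_le_sum_squares[of "m z * w z" "g z"] by simp
        finally show ?thesis using a True by (simp add: distrib_left)
      next
        case False
        then show ?thesis using TZ by (auto simp: indicator_def)
      qed
    qed
    finally show ?thesis .
  qed
  have up: "\<bar>ivl_integral (\<lambda>x. 2 * w x * g x) a b\<bar> \<le> (LBINT z. indicator Z z * (2 * \<bar>w z * g z\<bar>))"
    if "{a<..b} \<subseteq> Z" and [measurable]: "Z \<in> sets borel" for a b Z
  proof -
    have "\<bar>ivl_integral (\<lambda>x. 2 * w x * g x) a b\<bar> \<le> (LBINT z. \<bar>indicator {a<..b} z * (2 * w z * g z)\<bar>)"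
      unfolding ivl_integral_def by (rule integral_abs_bound)
    also have "\<dots> \<le> (LBINT z. indicator Z z * (2 * \<bar>w z * g z\<bar>))"
    proof (rule integral_mono)
      show "integrable lborel (\<lambda>z. \<bar>indicator {a<..b} z * (2 * w z * g z)\<bar>)"
        by (intro integrable_abs locally_integrable_indicator_Ioc primitive_of_locally_integrable[OF sq])
      show "integrable lborel (\<lambda>z. indicator Z z * (2 * \<bar>w z * g z\<bar>))"
        by (rule Bochner_Integration.integrable_bound[OF integrable_mult_right[OF wg, of 2]])
           (auto simp: indicator_def intro!: AE_I2)
    qed (use that in \<open>auto simp: indicator_def abs_mult\<close>)
    finally show ?thesis .
  qed
  have Ioc_up: "{x<..y} \<subseteq> {x..}" and Ioc_down: "{y<..x} \<subseteq> {..x}" for y by auto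
  show ?thesis
  proof (cases "0 \<le> x")
    case True
    show ?thesis
    proof (rule main[where T = "{x<..x+1}" and Z = "{x..}"])
      show "m x \<le> m z" if "z \<in> {x..}" for z using that True by (intro mono) auto
      fix y assume y: "y \<in> {x<..x+1}"
      then show "(w x)\<^sup>2 \<le> (w y)\<^sup>2 + (LBINT z. indicator {x..} z * (2 * \<bar>w z * g z\<bar>))"
        using primitive_ofD[OF sq, of x y] up[OF Ioc_up, of y] by auto
    qed auto
  next
    case False
    show ?thesis
    proof (rule main[where T = "{x-1<..x}" and Z = "{..x}"])
      show "m x \<le> m z" if "z \<in> {..x}" for z using that False by (intro mono) auto
      fix y assume y: "y \<in> {x-1<..x}"
      then show "(w x)\<^sup>2 \<le> (w y)\<^sup>2 + (LBINT z. indicator {..x} z * (2 * \<bar>w z * g z\<bar>))"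
        using primitive_ofD[OF sq, of y x] up[OF Ioc_down, of y] by auto
    qed auto
  qed
qed

text \<open>F is not known to vanish at infinity. Averaging F(x + n) - F(x - n) over x in (0, 1]
  replaces boundary values by integrals of F over unit intervals running off to infinity, and these
  tend to 0 since F is integrable.\<close>

lemma integral_of_derivative_zero:
  assumes F: "primitive_of F q" and Fi: "integrable lborel F" and q: "integrable lborel q"
  shows "(LBINT x. q x) = 0"
proof -
  have [measurable]: "F \<in> borel_measurable borel" "q \<in> borel_measurable borel"
    using Fi q by (auto dest: borel_measurable_integrable)
  let ?I = "LBINT x. q x"
  define D where "D n x = indicator {0<..1} x * (F (x + real n) - F (x + - real n))" for n x
  have eq: "F (x + real n) - F (x + - real n) = (LBINT z. indicator {x + - real n<..x + real n} z * q z)" for x n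
    using primitive_ofD[OF F, of "x + - real n" "x + real n"] by (simp add: ivl_integral_def)
  have [measurable]: "D n \<in> borel_measurable borel" for n unfolding D_def by measurable
  have "(\<lambda>n. LBINT x. D n x) \<longlonglongrightarrow> (LBINT x. indicator {0<..1::real} x * ?I)"
  proof (rule integral_dominated_convergence)
    show "integrable lborel (\<lambda>x::real. indicator {0<..1} x * (LBINT x. \<bar>q x\<bar>))" by simp
    show "AE x in lborel. (\<lambda>n. D n x) \<longlonglongrightarrow> indicator {0<..1} x * ?I"
    proof (rule AE_I2)
      fix x :: real
      have "(\<lambda>n. LBINT z. indicator {x + - real n<..x + real n} z * q z) \<longlonglongrightarrow> ?I"
      proof (rule integral_dominated_convergence[where w = "\<lambda>z. \<bar>q z\<bar>"])
        show "AE z in lborel. (\<lambda>n. indicator {x + - real n<..x + real n} z * q z) \<longlonglongrightarrow> q z"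
        proof (rule AE_I2)
          fix z
          obtain n0 :: nat where n0: "\<bar>z - x\<bar> < real n0" using reals_Archimedean2 by blast
          show "(\<lambda>n. indicator {x + - real n<..x + real n} z * q z) \<longlonglongrightarrow> q z"
          proof (rule tendsto_eventually, rule eventually_sequentiallyI[of n0])
            fix n assume "n0 \<le> n"
            then have "\<bar>z - x\<bar> < real n" using n0 by linarith
            then have "z \<in> {x + - real n<..x + real n}" by auto
            then show "indicator {x + - real n<..x + real n} z * q z = q z" by simp
          qed
        qed
      qed (use q in \<open>auto simp: indicator_def\<close>)
      then show "(\<lambda>n. D n x) \<longlonglongrightarrow> indicator {0<..1} x * ?I"
        unfolding D_def eq by (intro tendsto_mult tendsto_const)
    qed
    show "AE x in lborel. norm (D n x) \<le> indicator {0<..1} x * (LBINT x. \<bar>q x\<bar>)" for n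
    proof (rule AE_I2)
      fix x
      have "\<bar>LBINT z. indicator {x + - real n<..x + real n} z * q z\<bar> \<le> (LBINT z. \<bar>indicator {x + - real n<..x + real n} z * q z\<bar>)"
        by (rule integral_abs_bound)
      also have "\<dots> \<le> (LBINT z. \<bar>q z\<bar>)"
        by (intro integral_mono integrable_abs q locally_integrable_indicator_Ioc primitive_of_locally_integrable[OF F])
           (auto simp: indicator_def)
      finally show "norm (D n x) \<le> indicator {0<..1} x * (LBINT x. \<bar>q x\<bar>)"
        unfolding D_def eq by (auto simp: indicator_def)
    qed
  qed measurable
  moreover have "(\<lambda>n. LBINT x. D n x) \<longlonglongrightarrow> 0 - 0"
  proof -
    have shift: "(LBINT x. indicator {0<..1} x * F (x + h)) = (LBINT x. indicator {h<..h+1} x * F x)"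
      and shift_i: "integrable lborel (\<lambda>x. indicator {0<..1} x * F (x + h))" for h
    proof -
      have e: "(\<lambda>x. indicator {0<..1} x * F (x + h)) = (\<lambda>x. indicator {h<..h+1} (x + h) * F (x + h))"
        by (auto simp: indicator_def)
      show "(LBINT x. indicator {0<..1} x * F (x + h)) = (LBINT x. indicator {h<..h+1} x * F x)"
        unfolding e by (rule lborel_integral_translate)
      have "integrable lborel (\<lambda>x. indicator {h<..h+1} x * F x)"
        by (rule Bochner_Integration.integrable_bound[OF Fi]) (auto simp: indicator_def)
      then show "integrable lborel (\<lambda>x. indicator {0<..1} x * F (x + h))"
        unfolding e by (rule lborel_integrable_translate)
    qed
    have tail: "(\<lambda>n. LBINT x. indicator {c n<..c n + 1} x * F x) \<longlonglongrightarrow> 0"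
      if c: "\<And>n. \<bar>c n\<bar> = real n" for c :: "nat \<Rightarrow> real"
    proof -
      have "(\<lambda>n. LBINT x. indicator {c n<..c n + 1} x * F x) \<longlonglongrightarrow> (\<integral>x. 0 \<partial>(lborel :: real measure))"
      proof (rule integral_dominated_convergence[where w = "\<lambda>z. \<bar>F z\<bar>"])
        show "AE x in lborel. (\<lambda>n. indicator {c n<..c n + 1} x * F x) \<longlonglongrightarrow> 0"
        proof (rule AE_I2)
          fix x :: real
          obtain n0 :: nat where n0: "\<bar>x\<bar> + 2 < real n0" using reals_Archimedean2 by blast
          show "(\<lambda>n. indicator {c n<..c n + 1} x * F x) \<longlonglongrightarrow> 0"
          proof (rule tendsto_eventually, rule eventually_sequentiallyI[of n0])
            fix n assume "n0 \<le> n"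
            then have "\<bar>x\<bar> + 2 < real n" using n0 by linarith
            then have "x \<notin> {c n<..c n + 1}" using c[of n] by auto
            then show "indicator {c n<..c n + 1} x * F x = 0" by simp
          qed
        qed
      qed (use Fi in \<open>auto simp: indicator_def\<close>)
      then show ?thesis by simp
    qed
    have "(LBINT x. D n x) = (LBINT x. indicator {real n<..real n + 1} x * F x) - (LBINT x. indicator {- real n<..- real n + 1} x * F x)" for n
      unfolding D_def right_diff_distrib using shift[of "real n"] shift[of "- real n"]
      by (subst Bochner_Integration.integral_diff[OF shift_i shift_i]) simp
    then show ?thesis using tendsto_diff[OF tail[of real] tail[of "\<lambda>n. - real n"]] by simp
  qed
  ultimately have "(\<integral>x. indicator {0<..1} x * ?I \<partial>(lborel :: real measure)) = 0 - 0" by (rule LIMSEQ_unique)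
  then show ?thesis by simp
qed

section \<open>Differentiating the regularised virial\<close>

lemma L2norm_triangle:
  assumes a: "a \<in> L2" and b: "b \<in> L2"
  shows "L2norm (\<lambda>x. a x + b x) \<le> L2norm a + L2norm b"
proof -
  note i = L2_integrable_square[OF a] L2_integrable_square[OF b] L2_mult_integrable[OF a b]
  have sq: "(LBINT x. (c x)\<^sup>2) = (L2norm c)\<^sup>2" for c by (simp add: L2norm_def)
  have "(LBINT x. (a x + b x)\<^sup>2) = (LBINT x. (a x)\<^sup>2 + (b x)\<^sup>2 + 2 * (a x * b x))"
    by (simp add: power2_sum algebra_simps)
  also have "\<dots> = (L2norm a)\<^sup>2 + (L2norm b)\<^sup>2 + 2 * (LBINT x. a x * b x)"
    using i by (simp add: sq)
  also have "\<dots> \<le> (L2norm a + L2norm b)\<^sup>2"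
    using L2_Cauchy_Schwarz'[OF a b] by (simp add: power2_sum)
  finally show ?thesis unfolding L2norm_def[of "\<lambda>x. a x + b x"] by (rule real_le_lsqrt[rotated]) simp
qed

section \<open>The weighted space and its norm\<close>

definition wt :: "real \<Rightarrow> real" where
  "wt x = sqrt (1 + \<bar>x\<bar>)"

lemma wt_ge_1: "1 \<le> wt x" by (simp add: wt_def)
lemma wt_pos: "0 < wt x" using wt_ge_1[of x] by linarith
lemma wt_nonneg [simp]: "0 \<le> wt x" using wt_ge_1[of x] by linarith
lemma wt_square: "(wt x)\<^sup>2 = 1 + \<bar>x\<bar>" by (simp add: wt_def)
lemma wt_mono: "\<bar>x\<bar> \<le> \<bar>z\<bar> \<Longrightarrow> wt x \<le> wt z" by (simp add: wt_def)
lemma wt_measurable [measurable]: "wt \<in> borel_measurable borel" unfolding wt_def by measurable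

text \<open>On the strip |x - y| <= 1 the factor |x + y|/2 is at most 1 + |x| and at most 1 + |y|,
  hence at most their geometric mean. The virial weight is thus shared equally by two factors in
  \<open>L2w\<close>.\<close>

lemma wt_mult_lower:
  fixes x y :: real
  assumes "\<bar>x - y\<bar> \<le> 1"
  shows "\<bar>(x + y) / 2\<bar> \<le> wt x * wt y"
proof -
  have "(\<bar>(x + y) / 2\<bar>)\<^sup>2 \<le> (1 + \<bar>x\<bar>) * (1 + \<bar>y\<bar>)"
  proof -
    have "\<bar>x + y\<bar> \<le> 2 * (1 + \<bar>x\<bar>)" using assms abs_triangle_ineq[of "2 * x" "y - x"] by (simp add: abs_minus_commute)
    moreover have "\<bar>x + y\<bar> \<le> 2 * (1 + \<bar>y\<bar>)" using assms abs_triangle_ineq[of "2 * y" "x - y"] by simp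
    ultimately have "\<bar>(x + y) / 2\<bar> \<le> 1 + \<bar>x\<bar>" "\<bar>(x + y) / 2\<bar> \<le> 1 + \<bar>y\<bar>" by simp_all
    then show ?thesis unfolding power2_eq_square by (intro mult_mono) auto
  qed
  then have "\<bar>(x + y) / 2\<bar> \<le> sqrt ((1 + \<bar>x\<bar>) * (1 + \<bar>y\<bar>))" by (rule real_le_rsqrt)
  then show ?thesis by (simp add: wt_def real_sqrt_mult)
qed

text \<open>As the square of \<open>wt x\<close> is 1 + |x|, this is L2 intersected with L2(|x| dx),
  the weighted part of the solution space at r = 1/2.\<close>

definition L2w :: "(real \<Rightarrow> real) set" where
  "L2w = {v. v \<in> borel_measurable borel \<and> (\<lambda>x. wt x * v x) \<in> L2}"

definition L2wnorm :: "(real \<Rightarrow> real) \<Rightarrow> real" where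
  "L2wnorm v = L2norm (\<lambda>x. wt x * v x)"

lemma L2wnorm_nonneg [simp]: "0 \<le> L2wnorm v" by (simp add: L2wnorm_def)

lemma L2w_measurable [measurable_dest]: "v \<in> L2w \<Longrightarrow> v \<in> borel_measurable borel" by (simp add: L2w_def)

lemma L2w_weighted: "v \<in> L2w \<Longrightarrow> (\<lambda>x. wt x * v x) \<in> L2" by (simp add: L2w_def)

lemma L2w_add: "v \<in> L2w \<Longrightarrow> w \<in> L2w \<Longrightarrow> (\<lambda>x. v x + w x) \<in> L2w"
  unfolding L2w_def using L2_add[of "\<lambda>x. wt x * v x" "\<lambda>x. wt x * w x"] by (auto simp: distrib_left)

lemma L2w_diff: "v \<in> L2w \<Longrightarrow> w \<in> L2w \<Longrightarrow> (\<lambda>x. v x - w x) \<in> L2w"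
  unfolding L2w_def using L2_diff[of "\<lambda>x. wt x * v x" "\<lambda>x. wt x * w x"] by (auto simp: right_diff_distrib)

lemma L2wnorm_add: "v \<in> L2w \<Longrightarrow> w \<in> L2w \<Longrightarrow> L2wnorm (\<lambda>x. v x + w x) \<le> L2wnorm v + L2wnorm w"
  unfolding L2w_def L2wnorm_def using L2norm_triangle[of "\<lambda>x. wt x * v x" "\<lambda>x. wt x * w x"] by (simp add: distrib_left)

lemma L2_norm_mono:
  assumes b: "b \<in> L2" and [measurable]: "a \<in> borel_measurable borel" and le: "\<And>x. \<bar>a x\<bar> \<le> c * \<bar>b x\<bar>" and c: "0 \<le> c"
  shows "a \<in> L2" "L2norm a \<le> c * L2norm b"
proof -
  have le2: "(a x)\<^sup>2 \<le> c\<^sup>2 * (b x)\<^sup>2" for x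
    using power_mono[OF le[of x], of 2] by (simp add: power_mult_distrib)
  show a: "a \<in> L2"
    by (rule L2_bounded_by[where w = "\<lambda>x. c\<^sup>2 * (b x)\<^sup>2"]) (use le2 L2_integrable_square[OF b] in auto)
  have "(LBINT x. (a x)\<^sup>2) \<le> (LBINT x. c\<^sup>2 * (b x)\<^sup>2)"
    by (intro integral_mono L2_integrable_square a integrable_mult_right b le2)
  then have "L2norm a \<le> sqrt (c\<^sup>2 * (LBINT x. (b x)\<^sup>2))" by (simp add: L2norm_def)
  then show "L2norm a \<le> c * L2norm b" using c by (simp add: L2norm_def real_sqrt_mult)
qed

lemma L2w_norm_mono:
  assumes b: "b \<in> L2w" and a [measurable]: "a \<in> borel_measurable borel" and le: "\<And>x. \<bar>a x\<bar> \<le> c * \<bar>b x\<bar>" and c: "0 \<le> c"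
  shows "a \<in> L2w" "L2wnorm a \<le> c * L2wnorm b"
proof -
  have le': "\<bar>wt x * a x\<bar> \<le> c * \<bar>wt x * b x\<bar>" for x
    using mult_left_mono[OF le, of "wt x" x] by (simp add: abs_mult ac_simps)
  note * = L2_norm_mono[OF L2w_weighted[OF b] _ le' c]
  show "a \<in> L2w" "L2wnorm a \<le> c * L2wnorm b" using * a by (auto simp: L2w_def L2wnorm_def)
qed

lemma L2w_L2: "v \<in> L2w \<Longrightarrow> v \<in> L2"
proof -
  assume v: "v \<in> L2w"
  have "\<bar>v x\<bar> \<le> 1 * \<bar>wt x * v x\<bar>" for x
    using mult_right_mono[OF wt_ge_1[of x], of "\<bar>v x\<bar>"] by (simp add: abs_mult)
  then show "v \<in> L2" using L2_norm_mono(1)[OF L2w_weighted[OF v], of v 1] v L2w_measurable by auto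
qed

lemma L2norm_le_L2wnorm: "v \<in> L2w \<Longrightarrow> L2norm v \<le> L2wnorm v"
proof -
  assume v: "v \<in> L2w"
  have "\<bar>v x\<bar> \<le> 1 * \<bar>wt x * v x\<bar>" for x
    using mult_right_mono[OF wt_ge_1[of x], of "\<bar>v x\<bar>"] by (simp add: abs_mult)
  then show ?thesis using L2_norm_mono(2)[OF L2w_weighted[OF v], of v 1] v L2w_measurable by (auto simp: L2wnorm_def)
qed

section \<open>Kernels near the diagonal and their pairings\<close>

definition local_kernel :: "real \<Rightarrow> (real \<Rightarrow> real \<Rightarrow> real) \<Rightarrow> bool" where
  "local_kernel C k \<longleftrightarrow> 0 \<le> C \<and> (\<lambda>(x, y). k x y) \<in> borel_measurable (borel \<Otimes>\<^sub>M borel) \<and>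
     (\<forall>x y. \<bar>k x y\<bar> \<le> C * indicator {-1..1} (x - y) * (wt x * wt y))"

definition pairing :: "(real \<Rightarrow> real \<Rightarrow> real) \<Rightarrow> (real \<Rightarrow> real) \<Rightarrow> (real \<Rightarrow> real) \<Rightarrow> real" where
  "pairing k v \<theta> = (LBINT x. (LBINT y. k x y * v x * \<theta> y))"

text \<open>Cauchy-Schwarz on [y - 1, y + 1]. The bound grows like \<open>wt y\<close>, and this
  growth has to be absorbed by the function that is paired in y. The constant 2 rounds up the norm
  sqrt 2 of the indicator.\<close>

lemma local_kernel_section:
  assumes k: "local_kernel C k" and v: "v \<in> L2w"
  shows "integrable lborel (\<lambda>x. k x y * v x)" "\<bar>LBINT x. k x y * v x\<bar> \<le> 2 * C * wt y * L2wnorm v"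
proof -
  have [measurable]: "(\<lambda>(x, y). k x y) \<in> borel_measurable (borel \<Otimes>\<^sub>M borel)" "v \<in> borel_measurable borel"
    and C: "0 \<le> C" and kb: "\<And>x y. \<bar>k x y\<bar> \<le> C * indicator {-1..1} (x - y) * (wt x * wt y)"
    using k v by (auto simp: local_kernel_def L2w_measurable)
  have [measurable]: "(\<lambda>x. k x y) \<in> borel_measurable borel"
    using measurable_compose[of "\<lambda>x. (x, y)" borel "borel \<Otimes>\<^sub>M borel" "\<lambda>(x, y). k x y" borel] by simp
  define i where "i = (indicator {y-1..y+1} :: real \<Rightarrow> real)"
  have i: "i \<in> L2" unfolding i_def by (rule indicator_Icc_L2)
  have ni: "L2norm i \<le> 2"
  proof -
    have "(\<lambda>x. (i x)\<^sup>2) = i" by (auto simp: i_def indicator_def)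
    then have "L2norm i = sqrt 2" by (simp add: L2norm_def i_def)
    then show ?thesis using real_sqrt_le_mono[of 2 4] by simp
  qed
  note iv = L2_mult_integrable[OF i L2w_weighted[OF v]]
  have le: "\<bar>k x y * v x\<bar> \<le> C * wt y * \<bar>i x * (wt x * v x)\<bar>" for x
  proof -
    have "\<bar>k x y * v x\<bar> \<le> (C * indicator {-1..1} (x - y) * (wt x * wt y)) * \<bar>v x\<bar>"
      unfolding abs_mult by (rule mult_right_mono[OF kb]) simp
    also have "\<dots> = C * wt y * \<bar>i x * (wt x * v x)\<bar>"
      by (auto simp: i_def indicator_def abs_mult)
    finally show ?thesis .
  qed
  show I: "integrable lborel (\<lambda>x. k x y * v x)"
    by (rule Bochner_Integration.integrable_bound[OF integrable_mult_right[OF integrable_abs[OF iv], of "C * wt y"]])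
       (use le C in \<open>auto intro!: AE_I2 simp: abs_mult\<close>)
  have "\<bar>LBINT x. k x y * v x\<bar> \<le> (LBINT x. C * wt y * \<bar>i x * (wt x * v x)\<bar>)"
    by (rule order_trans[OF integral_abs_bound integral_mono[OF integrable_abs[OF I] integrable_mult_right[OF integrable_abs[OF iv]] le]])
  also have "\<dots> = C * wt y * (LBINT x. \<bar>i x * (wt x * v x)\<bar>)" by simp
  also have "\<dots> \<le> C * wt y * (L2norm i * L2wnorm v)"
    unfolding L2wnorm_def using C by (intro mult_left_mono L2_Cauchy_Schwarz i L2w_weighted v) auto
  also have "\<dots> \<le> C * wt y * (2 * L2wnorm v)"
    using ni C by (intro mult_left_mono mult_right_mono) auto
  finally show "\<bar>LBINT x. k x y * v x\<bar> \<le> 2 * C * wt y * L2wnorm v" by (simp add: ac_simps)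
qed

text \<open>Dividing the kernel by the two weights and multiplying the functions by them reduces
  everything to a kernel dominated by C on |x - y| <= 1, whose mass is 2 C.\<close>

lemma
  assumes k: "local_kernel C k" and v: "v \<in> L2w" and \<theta>: "\<theta> \<in> L2w"
  shows pairing_integrable: "integrable (lborel \<Otimes>\<^sub>M lborel) (\<lambda>(x, y). k x y * v x * \<theta> y)"
    and pairing_bound: "\<bar>pairing k v \<theta>\<bar> \<le> 2 * C * (L2wnorm v * L2wnorm \<theta>)"
    and pairing_swap: "pairing k v \<theta> = (LBINT y. \<theta> y * (LBINT x. k x y * v x))"
proof -
  have [measurable]: "(\<lambda>(x, y). k x y) \<in> borel_measurable (borel \<Otimes>\<^sub>M borel)"
    and C: "0 \<le> C" and kb: "\<And>x y. \<bar>k x y\<bar> \<le> C * indicator {-1..1} (x - y) * (wt x * wt y)"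
    using k by (auto simp: local_kernel_def)
  define k' where "k' x y = k x y / (wt x * wt y)" for x y
  have m: "(\<lambda>(x, y). k' x y) \<in> borel_measurable (borel \<Otimes>\<^sub>M borel)"
    unfolding k'_def by measurable
  have i: "integrable lborel (\<lambda>x::real. C * indicator {-1..1} x)" by simp
  have b: "\<bar>k' x y\<bar> \<le> C * indicator {-1..1} (x - y)" for x y
    using kb[of x y] wt_pos[of x] wt_pos[of y] by (simp add: k'_def abs_mult divide_le_eq)
  have eq: "k' x y * (wt x * v x) * (wt y * \<theta> y) = k x y * v x * \<theta> y" for x y
    using wt_pos[of x] wt_pos[of y] by (simp add: k'_def)
  note d = dominated_kernel_integrable[OF i m b L2w_weighted[OF v] L2w_weighted[OF \<theta>], unfolded eq]
    dominated_kernel_bound[OF i m b L2w_weighted[OF v] L2w_weighted[OF \<theta>], unfolded eq]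
  show "integrable (lborel \<Otimes>\<^sub>M lborel) (\<lambda>(x, y). k x y * v x * \<theta> y)" by (rule d(1))
  show "\<bar>pairing k v \<theta>\<bar> \<le> 2 * C * (L2wnorm v * L2wnorm \<theta>)"
    using d(2) by (simp add: pairing_def L2wnorm_def ac_simps)
  have "pairing k v \<theta> = (LBINT y. (LBINT x. k x y * v x * \<theta> y))"
    unfolding pairing_def using lborel_pair.Fubini_integral[OF d(1)] by simp
  then show "pairing k v \<theta> = (LBINT y. \<theta> y * (LBINT x. k x y * v x))"
    by (simp add: mult.commute)
qed

lemma pairing_prod:
  assumes k: "local_kernel C k" and v: "v \<in> L2w" and \<theta>: "\<theta> \<in> L2w"
  shows "pairing k v \<theta> = (\<integral>z. (case z of (x, y) \<Rightarrow> k x y * v x * \<theta> y) \<partial>(lborel \<Otimes>\<^sub>M lborel))"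
  unfolding pairing_def using lborel_pair.integral_fst'[OF pairing_integrable[OF assms]] by simp

lemma pairing_diff_left:
  assumes k: "local_kernel C k" and "v \<in> L2w" "w \<in> L2w" "\<theta> \<in> L2w"
  shows "pairing k (\<lambda>x. v x - w x) \<theta> = pairing k v \<theta> - pairing k w \<theta>"
  using pairing_integrable[OF k] assms L2w_diff[of v w]
  by (simp add: pairing_prod[OF k] case_prod_beta' left_diff_distrib right_diff_distrib)

lemma pairing_add_right:
  assumes k: "local_kernel C k" and "v \<in> L2w" "w \<in> L2w" "\<theta> \<in> L2w"
  shows "pairing k \<theta> (\<lambda>x. v x + w x) = pairing k \<theta> v + pairing k \<theta> w"
  using pairing_integrable[OF k] assms L2w_add[of v w]
  by (simp add: pairing_prod[OF k] case_prod_beta' distrib_right distrib_left)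

lemma pairing_diff_right:
  assumes k: "local_kernel C k" and "v \<in> L2w" "w \<in> L2w" "\<theta> \<in> L2w"
  shows "pairing k \<theta> (\<lambda>x. v x - w x) = pairing k \<theta> v - pairing k \<theta> w"
  using pairing_integrable[OF k] assms L2w_diff[of v w]
  by (simp add: pairing_prod[OF k] case_prod_beta' left_diff_distrib right_diff_distrib)

lemma pairing_commute:
  assumes k: "local_kernel C k" and v: "v \<in> L2w" and \<theta>: "\<theta> \<in> L2w" and sym: "\<And>x y. k x y = k y x"
  shows "pairing k v \<theta> = pairing k \<theta> v"
proof -
  have "\<theta> y * (LBINT x. k x y * v x) = (LBINT x. k y x * \<theta> y * v x)" for y
    by (subst integral_mult_right_zero[symmetric]) (simp add: ac_simps sym[of _ y])
  then show ?thesis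
    unfolding pairing_swap[OF k v \<theta>] unfolding pairing_def by simp
qed

text \<open>Cuts off the second argument only; this is how estimates for compactly supported
  \<theta> reach all of \<open>L2w\<close>.\<close>

lemma pairing_truncate_tendsto:
  assumes k: "local_kernel C k" and v: "v \<in> L2w" and \<theta>: "\<theta> \<in> L2w"
  shows "(\<lambda>n. pairing k v (\<lambda>y. indicator {- real n..real n} y * \<theta> y)) \<longlonglongrightarrow> pairing k v \<theta>"
proof -
  have [measurable]: "(\<lambda>(x, y). k x y) \<in> borel_measurable (borel \<Otimes>\<^sub>M borel)" "v \<in> borel_measurable borel" "\<theta> \<in> borel_measurable borel"
    using k v \<theta> by (auto simp: local_kernel_def L2w_measurable)
  have tr: "(\<lambda>y. indicator {- real n..real n} y * \<theta> y) \<in> L2w" for n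
    by (rule L2w_norm_mono(1)[OF \<theta>, of _ 1]) (auto simp: indicator_def)
  show ?thesis
    unfolding pairing_prod[OF k v \<theta>] pairing_prod[OF k v tr]
  proof (rule integral_dominated_convergence)
    show "integrable (lborel \<Otimes>\<^sub>M lborel) (\<lambda>z. \<bar>case z of (x, y) \<Rightarrow> k x y * v x * \<theta> y\<bar>)"
      by (rule integrable_abs[OF pairing_integrable[OF k v \<theta>]])
    show "AE z in lborel \<Otimes>\<^sub>M lborel. norm (case z of (x, y) \<Rightarrow> k x y * v x * (indicator {- real n..real n} y * \<theta> y))
        \<le> \<bar>case z of (x, y) \<Rightarrow> k x y * v x * \<theta> y\<bar>" for n
      by (rule AE_I2) (auto simp: indicator_def)
    show "AE z in lborel \<Otimes>\<^sub>M lborel. (\<lambda>n. case z of (x, y) \<Rightarrow> k x y * v x * (indicator {- real n..real n} y * \<theta> y))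
       \<longlonglongrightarrow> (case z of (x, y) \<Rightarrow> k x y * v x * \<theta> y)"
    proof (rule AE_I2)
      fix z :: "real \<times> real"
      obtain x y where z: "z = (x, y)" by (cases z)
      obtain n0 :: nat where n0: "\<bar>y\<bar> < real n0" using reals_Archimedean2 by blast
      show "(\<lambda>n. case z of (x, y) \<Rightarrow> k x y * v x * (indicator {- real n..real n} y * \<theta> y))
       \<longlonglongrightarrow> (case z of (x, y) \<Rightarrow> k x y * v x * \<theta> y)"
      proof (rule tendsto_eventually, rule eventually_sequentiallyI[of n0])
        fix n assume "n0 \<le> n"
        then have "\<bar>y\<bar> < real n" using n0 by linarith
        then have "y \<in> {- real n..real n}" by auto
        then show "(case z of (x, y) \<Rightarrow> k x y * v x * (indicator {- real n..real n} y * \<theta> y)) = (case z of (x, y) \<Rightarrow> k x y * v x * \<theta> y)"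
          by (simp add: z)
      qed
    qed
  qed measurable
qed

text \<open>Two terms, so that the regularised weight (x + y)/2 \<rho>(x - y) and all its
  x-derivatives have this form. The weight itself has p = 0, q = 1, j = 0; when p = 0 the index i is
  a dummy.\<close>

definition virial_kernel :: "real \<Rightarrow> real \<Rightarrow> nat \<Rightarrow> real \<Rightarrow> nat \<Rightarrow> real \<Rightarrow> real \<Rightarrow> real" where
  "virial_kernel p N i q j x y = p * moll N i (x - y) + q * ((x + y) / 2) * moll N j (x - y)"

lemma local_kernel_virial:
  assumes N: "1 \<le> N"
  shows "\<exists>C. local_kernel C (virial_kernel p N i q j)"
proof -
  obtain A where A: "0 \<le> A" "\<And>x. \<bar>moll N i x\<bar> \<le> A" using moll_bounded by blast
  obtain B where B: "0 \<le> B" "\<And>x. \<bar>moll N j x\<bar> \<le> B" using moll_bounded by blast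
  have "\<bar>virial_kernel p N i q j x y\<bar> \<le> (\<bar>p\<bar> * A + \<bar>q\<bar> * B) * indicator {-1..1} (x - y) * (wt x * wt y)" for x y
  proof (cases "\<bar>x - y\<bar> \<le> 1")
    case True
    have w1: "1 \<le> wt x * wt y" using mult_mono[OF wt_ge_1[of x] wt_ge_1[of y]] by simp
    have "\<bar>p * moll N i (x - y)\<bar> \<le> (\<bar>p\<bar> * A) * 1" unfolding abs_mult using A by (simp add: mult_left_mono)
    also have "\<dots> \<le> (\<bar>p\<bar> * A) * (wt x * wt y)" using w1 A by (intro mult_left_mono) auto
    finally have 1: "\<bar>p * moll N i (x - y)\<bar> \<le> (\<bar>p\<bar> * A) * (wt x * wt y)" .
    have "\<bar>q * ((x + y) / 2) * moll N j (x - y)\<bar> = \<bar>q\<bar> * (\<bar>(x + y) / 2\<bar> * \<bar>moll N j (x - y)\<bar>)" by (simp add: abs_mult)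
    also have "\<dots> \<le> \<bar>q\<bar> * ((wt x * wt y) * B)"
      using wt_mult_lower[OF True] B by (intro mult_left_mono mult_mono) auto
    finally have 2: "\<bar>q * ((x + y) / 2) * moll N j (x - y)\<bar> \<le> \<bar>q\<bar> * B * (wt x * wt y)" by (simp add: ac_simps)
    have "indicator {-1..1} (x - y) = (1::real)" using True by (auto simp: abs_le_iff)
    moreover have "\<bar>virial_kernel p N i q j x y\<bar> \<le> (\<bar>p\<bar> * A) * (wt x * wt y) + \<bar>q\<bar> * B * (wt x * wt y)"
      unfolding virial_kernel_def using 1 2 by linarith
    ultimately show ?thesis by (simp add: distrib_right)
  next
    case False
    then show ?thesis using moll_zero[OF N, of "x - y"] A B by (simp add: virial_kernel_def)
  qed
  moreover have "(\<lambda>(x, y). virial_kernel p N i q j x y) \<in> borel_measurable (borel \<Otimes>\<^sub>M borel)"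
    unfolding virial_kernel_def by measurable
  ultimately show ?thesis using A(1) B(1)
    by (intro exI[of _ "\<bar>p\<bar> * A + \<bar>q\<bar> * B"]) (simp add: local_kernel_def)
qed

lemma bump_fun_mult: "bump_fun (Q * P) k x = poly Q x * bump_fun P k x"
  by (simp add: bump_fun_def)

text \<open>In s = N (x - y) one has N (x + y)/2 = N y + s/2, so for fixed y the kernel is a
  polynomial times a bump. The linear weight is cut off by the bump itself, which keeps x within 1/N
  of y.\<close>

lemma virial_kernel_test_function:
  assumes N: "1 \<le> N"
  shows "test_function (\<lambda>x. virial_kernel 0 N 0 1 0 x y)"
proof -
  obtain P k where P: "mollifier_deriv 0 = bump_fun P k" using mollifier_deriv_bump_fun by blast
  have "(\<lambda>x. virial_kernel 0 N 0 1 0 x y) = (\<lambda>x. bump_fun ([:N * y, 1 / 2:] * P) k (N * x + - N * y))"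
    unfolding bump_fun_mult using N by (intro ext) (simp add: virial_kernel_def moll_def P field_simps)
  then show ?thesis using test_function_bump_fun_affine[of N "[:N * y, 1 / 2:] * P" k "- N * y"] N by simp
qed

text \<open>Each derivative falls once on (x + y)/2 and adds 1/2 to the coefficient of the
  unweighted term; after three of them it is 3/2.\<close>

lemma virial_kernel_deriv:
  "deriv (\<lambda>x. virial_kernel 0 N 0 1 0 x y) = (\<lambda>x. virial_kernel (1/2) N 0 1 1 x y)"
  "(deriv ^^ 3) (\<lambda>x. virial_kernel 0 N 0 1 0 x y) = (\<lambda>x. virial_kernel (3/2) N 2 1 3 x y)"
proof -
  have d: "deriv (\<lambda>x. virial_kernel p N j 1 (Suc j) x y) = (\<lambda>x. virial_kernel (p + 1/2) N (Suc j) 1 (Suc (Suc j)) x y)" for p j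
    unfolding virial_kernel_def
    by (intro ext DERIV_imp_deriv) (auto intro!: derivative_eq_intros simp: algebra_simps)
  show d1: "deriv (\<lambda>x. virial_kernel 0 N 0 1 0 x y) = (\<lambda>x. virial_kernel (1/2) N 0 1 1 x y)"
    unfolding virial_kernel_def
    by (intro ext DERIV_imp_deriv) (auto intro!: derivative_eq_intros simp: algebra_simps)
  show "(deriv ^^ 3) (\<lambda>x. virial_kernel 0 N 0 1 0 x y) = (\<lambda>x. virial_kernel (3/2) N 2 1 3 x y)"
    using d[of "1/2" 0] d[of 1 1] by (simp add: numeral_3_eq_3 d1 numeral_2_eq_2)
qed

section \<open>Time derivatives along the flow\<close>

lemma increment_estimate:
  fixes F F' :: "real \<Rightarrow> real"
  assumes F: "\<And>t. (F has_real_derivative F' t) (at t)"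
    and le: "\<And>\<xi>. min s t \<le> \<xi> \<Longrightarrow> \<xi> \<le> max s t \<Longrightarrow> \<bar>F' \<xi> - c\<bar> \<le> M"
  shows "\<bar>F s - F t - (s - t) * c\<bar> \<le> \<bar>s - t\<bar> * M"
proof -
  have *: "\<bar>F q - F p - (q - p) * c\<bar> \<le> (q - p) * M" if "p < q" "{p, q} = {s, t}" for p q
  proof -
    have "\<exists>\<xi>>p. \<xi> < q \<and> F q - F p = (q - p) * F' \<xi>"
      by (rule MVT2[OF that(1)]) (rule F)
    then obtain \<xi> where \<xi>: "p < \<xi>" "\<xi> < q" "F q - F p = (q - p) * F' \<xi>" by blast
    then have "\<bar>F' \<xi> - c\<bar> \<le> M" using that by (intro le) (auto simp: doubleton_eq_iff)
    then have "(q - p) * \<bar>F' \<xi> - c\<bar> \<le> (q - p) * M" using that by (intro mult_left_mono) auto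
    then show ?thesis using \<xi>(3) that(1) by (simp add: abs_mult right_diff_distrib[symmetric])
  qed
  consider "s = t" | "s < t" | "t < s" by linarith
  then show ?thesis
  proof cases
    case 2
    from *[OF 2] have "\<bar>F t - F s - (t - s) * c\<bar> \<le> (t - s) * M" by auto
    then show ?thesis using 2 by (simp add: abs_le_iff algebra_simps)
  next
    case 3
    from *[OF 3] show ?thesis using 3 by auto
  qed simp
qed

lemma has_real_derivative_from_increment:
  fixes F :: "real \<Rightarrow> real"
  assumes "\<And>e. 0 < e \<Longrightarrow> \<exists>d>0. \<forall>s. \<bar>s - t\<bar> < d \<longrightarrow> \<bar>F s - F t - (s - t) * c\<bar> \<le> e * \<bar>s - t\<bar>"
  shows "(F has_real_derivative c) (at t)"
  unfolding has_field_derivative_def has_derivative_at_alt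
  using assms by (simp add: bounded_linear_mult_right mult.commute)

text \<open>No space derivative of u appears: all derivatives sit on the kernel. The pointwise bound
  keeps u in the range where f is Lipschitz, so that f(u) inherits both the weighted integrability
  and the continuity in time.\<close>

locale gkdv_flow =
  fixes f :: "real \<Rightarrow> real" and L \<delta> :: real and u :: "real \<Rightarrow> real \<Rightarrow> real"
  assumes f_continuous: "continuous_on UNIV f" and f_zero: "f 0 = 0" and L: "0 \<le> L"
    and f_lipschitz: "\<And>a b. \<bar>a\<bar> \<le> \<delta> \<Longrightarrow> \<bar>b\<bar> \<le> \<delta> \<Longrightarrow> \<bar>f a - f b\<bar> \<le> L * \<bar>a - b\<bar>"
    and u_L2w: "\<And>t. u t \<in> L2w" and u_small: "\<And>t x. \<bar>u t x\<bar> \<le> \<delta>"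
    and u_continuous: "\<And>t. ((\<lambda>s. L2wnorm (\<lambda>x. u s x - u t x)) \<longlongrightarrow> 0) (at t)"
    and equation: "satisfies_gKdV f u"
begin

lemma f_measurable [measurable]: "f \<in> borel_measurable borel"
  by (rule borel_measurable_continuous_onI[OF f_continuous])

lemma u_measurable [measurable]: "u t \<in> borel_measurable borel"
  by (rule L2w_measurable[OF u_L2w])

lemma fu_L2w: "(\<lambda>x. f (u t x)) \<in> L2w"
proof (rule L2w_norm_mono(1)[OF u_L2w _ _ L])
  show "\<bar>f (u t x)\<bar> \<le> L * \<bar>u t x\<bar>" for x
    using f_lipschitz[OF u_small[of t x], of 0] u_small[of t x] f_zero by (simp add: order_trans[OF abs_ge_zero])
qed measurable

lemma fu_diff: "L2wnorm (\<lambda>x. f (u s x) - f (u t x)) \<le> L * L2wnorm (\<lambda>x. u s x - u t x)"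
  by (rule L2w_norm_mono(2)[OF L2w_diff[OF u_L2w u_L2w] _ f_lipschitz[OF u_small u_small] L]) measurable

text \<open>The right-hand side of the weak equation for the test function x to K(x, y), integrated
  against \<theta>(y); hence the candidate for the time derivative of the pairing of u with
  \<theta>.\<close>

definition flux :: "real \<Rightarrow> real \<Rightarrow> (real \<Rightarrow> real) \<Rightarrow> real" where
  "flux N t \<theta> = pairing (virial_kernel (3/2) N 2 1 3) (u t) \<theta> + pairing (virial_kernel (1/2) N 0 1 1) (\<lambda>x. f (u t x)) \<theta>"

lemma u_eventually_close:
  assumes "0 < e"
  shows "\<exists>d>0. \<forall>s. \<bar>s - t\<bar> < d \<longrightarrow> L2wnorm (\<lambda>x. u s x - u t x) \<le> e"
proof -
  obtain d where d: "0 < d" "\<And>s. s \<noteq> t \<Longrightarrow> \<bar>s - t\<bar> < d \<Longrightarrow> \<bar>L2wnorm (\<lambda>x. u s x - u t x)\<bar> < e"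
    using LIM_D[OF u_continuous[of t] assms] by (auto simp: dist_real_def)
  have "L2wnorm (\<lambda>x. u s x - u t x) \<le> e" if "\<bar>s - t\<bar> < d" for s
    using d(2)[of s] that assms by (cases "s = t") (auto simp: L2wnorm_def L2norm_def)
  then show ?thesis using d(1) by blast
qed

text \<open>Size, modulus in time, and modulus in time at a fixed y, with one constant. The second
  does not see the support of \<theta>; the third carries the growth \<open>wt y\<close>.\<close>

lemma flux_bounds:
  assumes N: "1 \<le> N"
  shows "\<exists>C\<ge>0. (\<forall>t \<theta>. \<theta> \<in> L2w \<longrightarrow> \<bar>flux N t \<theta>\<bar> \<le> C * (L2wnorm (u t) + L2wnorm (\<lambda>x. f (u t x))) * L2wnorm \<theta>) \<and>
    (\<forall>s t \<theta>. \<theta> \<in> L2w \<longrightarrow> \<bar>flux N s \<theta> - flux N t \<theta>\<bar> \<le> C * L2wnorm (\<lambda>x. u s x - u t x) * L2wnorm \<theta>) \<and>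
    (\<forall>s t y. \<bar>(LBINT x. u s x * virial_kernel (3/2) N 2 1 3 x y + f (u s x) * virial_kernel (1/2) N 0 1 1 x y)
       - (LBINT x. u t x * virial_kernel (3/2) N 2 1 3 x y + f (u t x) * virial_kernel (1/2) N 0 1 1 x y)\<bar>
       \<le> C * wt y * L2wnorm (\<lambda>x. u s x - u t x))"
proof -
  let ?K3 = "virial_kernel (3/2) N 2 1 3" and ?K1 = "virial_kernel (1/2) N 0 1 1"
  obtain C3 where C3: "local_kernel C3 ?K3" using local_kernel_virial[OF N] by blast
  obtain C1 where C1: "local_kernel C1 ?K1" using local_kernel_virial[OF N] by blast
  have nn: "0 \<le> C3" "0 \<le> C1" using C3 C1 by (auto simp: local_kernel_def)
  define C where "C = 2 * C3 + 2 * C1 + 2 * C1 * L"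
  have C: "2 * C3 \<le> C" "2 * C1 \<le> C" "2 * C3 + 2 * C1 * L \<le> C" "0 \<le> C" using nn L by (auto simp: C_def)
  note dl = L2w_diff[OF u_L2w u_L2w] L2w_diff[OF fu_L2w fu_L2w]
  show ?thesis
  proof (intro exI[of _ C] conjI allI impI)
    show "0 \<le> C" by (rule C(4))
  next
    fix t \<theta> assume \<theta>: "\<theta> \<in> L2w"
    have "\<bar>flux N t \<theta>\<bar> \<le> 2 * C3 * (L2wnorm (u t) * L2wnorm \<theta>) + 2 * C1 * (L2wnorm (\<lambda>x. f (u t x)) * L2wnorm \<theta>)"
      unfolding flux_def using pairing_bound[OF C3 u_L2w \<theta>] pairing_bound[OF C1 fu_L2w \<theta>]
      by (rule order_trans[OF abs_triangle_ineq add_mono])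
    also have "\<dots> \<le> C * (L2wnorm (u t) * L2wnorm \<theta>) + C * (L2wnorm (\<lambda>x. f (u t x)) * L2wnorm \<theta>)"
      by (intro add_mono mult_right_mono C) auto
    finally show "\<bar>flux N t \<theta>\<bar> \<le> C * (L2wnorm (u t) + L2wnorm (\<lambda>x. f (u t x))) * L2wnorm \<theta>" by (simp add: algebra_simps)
  next
    fix s t \<theta> assume \<theta>: "\<theta> \<in> L2w"
    have eq: "flux N s \<theta> - flux N t \<theta> = pairing ?K3 (\<lambda>x. u s x - u t x) \<theta> + pairing ?K1 (\<lambda>x. f (u s x) - f (u t x)) \<theta>"
      unfolding flux_def pairing_diff_left[OF C3 u_L2w u_L2w \<theta>] pairing_diff_left[OF C1 fu_L2w fu_L2w \<theta>] by simp
    have "\<bar>flux N s \<theta> - flux N t \<theta>\<bar> \<le> 2 * C3 * (L2wnorm (\<lambda>x. u s x - u t x) * L2wnorm \<theta>) + 2 * C1 * (L2wnorm (\<lambda>x. f (u s x) - f (u t x)) * L2wnorm \<theta>)"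
      unfolding eq using pairing_bound[OF C3 dl(1) \<theta>] pairing_bound[OF C1 dl(2) \<theta>]
      by (rule order_trans[OF abs_triangle_ineq add_mono])
    also have "\<dots> \<le> 2 * C3 * (L2wnorm (\<lambda>x. u s x - u t x) * L2wnorm \<theta>) + 2 * C1 * ((L * L2wnorm (\<lambda>x. u s x - u t x)) * L2wnorm \<theta>)"
      using nn by (intro add_left_mono mult_left_mono mult_right_mono fu_diff) auto
    also have "\<dots> = (2 * C3 + 2 * C1 * L) * (L2wnorm (\<lambda>x. u s x - u t x) * L2wnorm \<theta>)" by (simp add: algebra_simps)
    also have "\<dots> \<le> C * (L2wnorm (\<lambda>x. u s x - u t x) * L2wnorm \<theta>)" by (intro mult_right_mono C) auto
    finally show "\<bar>flux N s \<theta> - flux N t \<theta>\<bar> \<le> C * L2wnorm (\<lambda>x. u s x - u t x) * L2wnorm \<theta>" by (simp add: ac_simps)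
  next
    fix s t y
    have i: "integrable lborel (\<lambda>x. u r x * ?K3 x y)" "integrable lborel (\<lambda>x. f (u r x) * ?K1 x y)" for r
      using local_kernel_section(1)[OF C3 u_L2w, of y r] local_kernel_section(1)[OF C1 fu_L2w, of y r] by (simp_all add: mult.commute)
    have eq: "(LBINT x. u s x * ?K3 x y + f (u s x) * ?K1 x y) - (LBINT x. u t x * ?K3 x y + f (u t x) * ?K1 x y)
      = (LBINT x. ?K3 x y * (u s x - u t x)) + (LBINT x. ?K1 x y * (f (u s x) - f (u t x)))"
      using i by (simp add: left_diff_distrib mult.commute[of "virial_kernel _ _ _ _ _ _ _"])
    have "\<bar>(LBINT x. u s x * ?K3 x y + f (u s x) * ?K1 x y) - (LBINT x. u t x * ?K3 x y + f (u t x) * ?K1 x y)\<bar> \<le> 2 * C3 * wt y * L2wnorm (\<lambda>x. u s x - u t x) + 2 * C1 * wt y * L2wnorm (\<lambda>x. f (u s x) - f (u t x))"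
      unfolding eq using local_kernel_section(2)[OF C3 dl(1)] local_kernel_section(2)[OF C1 dl(2)]
      by (rule order_trans[OF abs_triangle_ineq add_mono])
    also have "\<dots> \<le> 2 * C3 * wt y * L2wnorm (\<lambda>x. u s x - u t x) + 2 * C1 * wt y * (L * L2wnorm (\<lambda>x. u s x - u t x))"
      using nn by (intro add_left_mono mult_left_mono fu_diff) auto
    also have "\<dots> = (2 * C3 + 2 * C1 * L) * (wt y * L2wnorm (\<lambda>x. u s x - u t x))" by (simp add: algebra_simps)
    also have "\<dots> \<le> C * (wt y * L2wnorm (\<lambda>x. u s x - u t x))" by (intro mult_right_mono C) auto
    finally show "\<bar>(LBINT x. u s x * ?K3 x y + f (u s x) * ?K1 x y) - (LBINT x. u t x * ?K3 x y + f (u t x) * ?K1 x y)\<bar>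
       \<le> C * wt y * L2wnorm (\<lambda>x. u s x - u t x)" by (simp add: ac_simps)
  qed
qed

text \<open>For each y the equation differentiates the section. The error is uniform in y up to a
  factor \<open>wt y\<close>, and \<open>wt\<close> times \<theta> is integrable on bounded sets but
  in general only square integrable on the line; this is where the compact support enters.\<close>

lemma pairing_derivative_compact:
  assumes N: "1 \<le> N" and \<theta>: "\<theta> \<in> L2w" and supp: "\<And>y. R < \<bar>y\<bar> \<Longrightarrow> \<theta> y = 0"
  shows "((\<lambda>s. pairing (virial_kernel 0 N 0 1 0) (u s) \<theta>) has_real_derivative flux N t \<theta>) (at t)"
proof -
  let ?K = "virial_kernel 0 N 0 1 0" and ?K3 = "virial_kernel (3/2) N 2 1 3" and ?K1 = "virial_kernel (1/2) N 0 1 1"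
  obtain C0 where C0: "local_kernel C0 ?K" using local_kernel_virial[OF N] by blast
  obtain C3 where C3: "local_kernel C3 ?K3" using local_kernel_virial[OF N] by blast
  obtain C1 where C1: "local_kernel C1 ?K1" using local_kernel_virial[OF N] by blast
  obtain C where C: "0 \<le> C" "\<forall>s t y. \<bar>(LBINT x. u s x * ?K3 x y + f (u s x) * ?K1 x y)
       - (LBINT x. u t x * ?K3 x y + f (u t x) * ?K1 x y)\<bar> \<le> C * wt y * L2wnorm (\<lambda>x. u s x - u t x)"
    using flux_bounds[OF N] by (elim exE conjE) (rule that)
  have [measurable]: "\<theta> \<in> borel_measurable borel" by (rule L2w_measurable[OF \<theta>])
  have [measurable]: "(\<lambda>(x, y). virial_kernel p N i q j x y) \<in> borel_measurable (borel \<Otimes>\<^sub>M borel)" for p i q j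
    unfolding virial_kernel_def by measurable
  define g where "g s y = (LBINT x. ?K x y * u s x)" for s y
  define p where "p s y = (LBINT x. u s x * ?K3 x y + f (u s x) * ?K1 x y)" for s y
  have g: "((\<lambda>s. g s y) has_real_derivative p s y) (at s)" for s y
    using equation virial_kernel_test_function[OF N, of y] unfolding satisfies_gKdV_def
    by (force simp: virial_kernel_deriv g_def p_def mult.commute)
  have p: "p s y = (LBINT x. ?K3 x y * u s x) + (LBINT x. ?K1 x y * f (u s x))" for s y
    using local_kernel_section(1)[OF C3 u_L2w, of y s] local_kernel_section(1)[OF C1 fu_L2w, of y s]
    by (simp add: p_def mult.commute)
  define R' where "R' = max R 0"
  define W where "W = (LBINT y. \<bar>indicator {-R'..R'} y * (wt y * \<theta> y)\<bar>)"
  have Wi: "integrable lborel (\<lambda>y. indicator {-R'..R'} y * (wt y * \<theta> y))"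
    by (rule L2_mult_integrable[OF indicator_Icc_L2 L2w_weighted[OF \<theta>]])
  have \<theta>_eq: "\<theta> y = indicator {-R'..R'} y * \<theta> y" for y
    by (cases "R < \<bar>y\<bar>") (auto simp: supp indicator_def R'_def abs_le_iff)
  have W0: "0 \<le> W" by (simp add: W_def)
  have \<theta>i: "integrable lborel (\<lambda>y. \<theta> y * (LBINT x. k x y * v x))"
    if k: "local_kernel c k" and v: "v \<in> L2w" for c k v
    using lborel_pair.integrable_snd[OF pairing_integrable[OF k v \<theta>]] by (simp add: mult.commute)
  have flux_eq: "flux N t \<theta> = (LBINT y. \<theta> y * p t y)" for t
    unfolding flux_def pairing_swap[OF C3 u_L2w \<theta>] pairing_swap[OF C1 fu_L2w \<theta>] p
    using \<theta>i[OF C3 u_L2w] \<theta>i[OF C1 fu_L2w] by (simp add: distrib_left)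
  have pi: "integrable lborel (\<lambda>y. \<theta> y * p t y)" for t
    unfolding p using \<theta>i[OF C3 u_L2w] \<theta>i[OF C1 fu_L2w] by (simp add: distrib_left)
  have gi: "integrable lborel (\<lambda>y. \<theta> y * g t y)" for t
    unfolding g_def using \<theta>i[OF C0 u_L2w] by simp
  have h: "pairing ?K (u s) \<theta> = (LBINT y. \<theta> y * g s y)" for s
    unfolding pairing_swap[OF C0 u_L2w \<theta>] g_def ..
  show ?thesis
  proof (rule has_real_derivative_from_increment)
    fix e :: real assume e: "0 < e"
    \<comment> \<open>Makes the accumulated error M C W at most e; the added 1 covers the case C W =
      0.\<close>
    define M where "M = e / (C * W + 1)"
    have CW: "0 \<le> C * W" using C(1) W0 by simp
    have M: "0 < M" "M * (C * W) \<le> e" using e CW by (auto simp: M_def field_simps)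
    obtain d where d: "0 < d" "\<And>s. \<bar>s - t\<bar> < d \<Longrightarrow> L2wnorm (\<lambda>x. u s x - u t x) \<le> M"
      using u_eventually_close[OF M(1)] by blast
    have "\<bar>pairing ?K (u s) \<theta> - pairing ?K (u t) \<theta> - (s - t) * flux N t \<theta>\<bar> \<le> e * \<bar>s - t\<bar>" if s: "\<bar>s - t\<bar> < d" for s
    proof -
      have pt: "\<bar>g s y - g t y - (s - t) * p t y\<bar> \<le> \<bar>s - t\<bar> * (C * wt y * M)" for y
      proof (rule increment_estimate[OF g])
        fix \<xi> assume "min s t \<le> \<xi>" "\<xi> \<le> max s t"
        then have "L2wnorm (\<lambda>x. u \<xi> x - u t x) \<le> M" using s by (intro d(2)) linarith
        then have "C * wt y * L2wnorm (\<lambda>x. u \<xi> x - u t x) \<le> C * wt y * M" using C(1) by (intro mult_left_mono) auto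
        then show "\<bar>p \<xi> y - p t y\<bar> \<le> C * wt y * M" using C(2)[rule_format, of \<xi> y t] unfolding p_def by linarith
      qed
      have i: "integrable lborel (\<lambda>y. \<theta> y * (g s y - g t y - (s - t) * p t y))"
      proof -
        have "integrable lborel (\<lambda>y. \<theta> y * g s y - \<theta> y * g t y - (s - t) * (\<theta> y * p t y))"
          by (intro Bochner_Integration.integrable_diff integrable_mult_right gi pi)
        then show ?thesis by (simp add: algebra_simps)
      qed
      have eq: "pairing ?K (u s) \<theta> - pairing ?K (u t) \<theta> - (s - t) * flux N t \<theta> = (LBINT y. \<theta> y * (g s y - g t y - (s - t) * p t y))"
      proof -
        have "(LBINT y. \<theta> y * (g s y - g t y - (s - t) * p t y)) = (LBINT y. \<theta> y * g s y - \<theta> y * g t y - (s - t) * (\<theta> y * p t y))"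
          by (simp add: algebra_simps)
        also have "\<dots> = (LBINT y. \<theta> y * g s y) - (LBINT y. \<theta> y * g t y) - (s - t) * (LBINT y. \<theta> y * p t y)"
          using gi pi by simp
        finally show ?thesis unfolding h flux_eq by simp
      qed
      have "\<bar>pairing ?K (u s) \<theta> - pairing ?K (u t) \<theta> - (s - t) * flux N t \<theta>\<bar> \<le> (LBINT y. \<bar>s - t\<bar> * (C * M) * \<bar>indicator {-R'..R'} y * (wt y * \<theta> y)\<bar>)"
        unfolding eq
      proof (rule order_trans[OF integral_abs_bound integral_mono])
        show "integrable lborel (\<lambda>y. \<bar>\<theta> y * (g s y - g t y - (s - t) * p t y)\<bar>)" by (rule integrable_abs[OF i])
        show "integrable lborel (\<lambda>y. \<bar>s - t\<bar> * (C * M) * \<bar>indicator {-R'..R'} y * (wt y * \<theta> y)\<bar>)"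
          by (intro integrable_mult_right integrable_abs Wi)
        fix y
        have "\<bar>\<theta> y * (g s y - g t y - (s - t) * p t y)\<bar> \<le> \<bar>\<theta> y\<bar> * (\<bar>s - t\<bar> * (C * wt y * M))"
          unfolding abs_mult[of "\<theta> y"] by (rule mult_left_mono[OF pt]) simp
        also have "\<dots> = \<bar>s - t\<bar> * (C * M) * \<bar>indicator {-R'..R'} y * (wt y * \<theta> y)\<bar>"
          by (subst \<theta>_eq) (simp add: abs_mult indicator_def)
        finally show "\<bar>\<theta> y * (g s y - g t y - (s - t) * p t y)\<bar> \<le> \<bar>s - t\<bar> * (C * M) * \<bar>indicator {-R'..R'} y * (wt y * \<theta> y)\<bar>" .
      qed
      also have "\<dots> = \<bar>s - t\<bar> * (M * (C * W))" by (simp add: W_def)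
      also have "\<dots> \<le> \<bar>s - t\<bar> * e" by (rule mult_left_mono[OF M(2)]) simp
      finally show ?thesis by (simp add: mult.commute)
    qed
    then show "\<exists>d>0. \<forall>s. \<bar>s - t\<bar> < d \<longrightarrow> \<bar>pairing ?K (u s) \<theta> - pairing ?K (u t) \<theta> - (s - t) * flux N t \<theta>\<bar> \<le> e * \<bar>s - t\<bar>"
      using d(1) by blast
  qed
qed

text \<open>For truncated \<theta> the mean value estimate is controlled by the weighted norm of
  \<theta>, independently of the truncation, so it survives the limit. Stating it as an increment
  bound avoids exchanging a limit with a derivative.\<close>

lemma pairing_increment:
  assumes N: "1 \<le> N"
  shows "\<exists>C\<ge>0. \<forall>s t M \<theta>. \<theta> \<in> L2w \<longrightarrow> (\<forall>\<xi>. min s t \<le> \<xi> \<longrightarrow> \<xi> \<le> max s t \<longrightarrow> L2wnorm (\<lambda>x. u \<xi> x - u t x) \<le> M) \<longrightarrow>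
     \<bar>pairing (virial_kernel 0 N 0 1 0) (u s) \<theta> - pairing (virial_kernel 0 N 0 1 0) (u t) \<theta> - (s - t) * flux N t \<theta>\<bar>
       \<le> \<bar>s - t\<bar> * (C * M * L2wnorm \<theta>)"
proof -
  let ?K = "virial_kernel 0 N 0 1 0" and ?K3 = "virial_kernel (3/2) N 2 1 3" and ?K1 = "virial_kernel (1/2) N 0 1 1"
  obtain C0 where C0: "local_kernel C0 ?K" using local_kernel_virial[OF N] by blast
  obtain C3 where C3: "local_kernel C3 ?K3" using local_kernel_virial[OF N] by blast
  obtain C1 where C1: "local_kernel C1 ?K1" using local_kernel_virial[OF N] by blast
  obtain C where C: "0 \<le> C" "\<forall>s t \<theta>. \<theta> \<in> L2w \<longrightarrow> \<bar>flux N s \<theta> - flux N t \<theta>\<bar> \<le> C * L2wnorm (\<lambda>x. u s x - u t x) * L2wnorm \<theta>"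
    using flux_bounds[OF N] by (elim exE conjE) (rule that)
  show ?thesis
  proof (intro exI[of _ C] conjI allI impI)
    show "0 \<le> C" by (rule C(1))
  next
    fix s t M \<theta>
    assume \<theta>: "\<theta> \<in> L2w" and "\<forall>\<xi>. min s t \<le> \<xi> \<longrightarrow> \<xi> \<le> max s t \<longrightarrow> L2wnorm (\<lambda>x. u \<xi> x - u t x) \<le> M"
    then have M: "\<And>\<xi>. min s t \<le> \<xi> \<Longrightarrow> \<xi> \<le> max s t \<Longrightarrow> L2wnorm (\<lambda>x. u \<xi> x - u t x) \<le> M" by blast
    have [measurable]: "\<theta> \<in> borel_measurable borel" by (rule L2w_measurable[OF \<theta>])
    define T where "T n y = indicator {- real n..real n} y * \<theta> y" for n y
    have T: "T n \<in> L2w" "L2wnorm (T n) \<le> L2wnorm \<theta>" for n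
    proof -
      have le: "\<bar>T n y\<bar> \<le> 1 * \<bar>\<theta> y\<bar>" for y by (auto simp: T_def indicator_def)
      have m: "T n \<in> borel_measurable borel" unfolding T_def by measurable
      show "T n \<in> L2w" "L2wnorm (T n) \<le> L2wnorm \<theta>" using L2w_norm_mono[OF \<theta> m le] by auto
    qed
    have M0: "0 \<le> M" by (rule order_trans[OF L2wnorm_nonneg M[of t]]) auto
    have *: "\<bar>pairing ?K (u s) (T n) - pairing ?K (u t) (T n) - (s - t) * flux N t (T n)\<bar> \<le> \<bar>s - t\<bar> * (C * M * L2wnorm \<theta>)" for n
    proof (rule increment_estimate[OF pairing_derivative_compact[OF N T(1), where R = "real n"]])
      show "real n < \<bar>y\<bar> \<Longrightarrow> T n y = 0" for y by (auto simp: T_def indicator_def)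
      fix \<xi> assume \<xi>: "min s t \<le> \<xi>" "\<xi> \<le> max s t"
      have "\<bar>flux N \<xi> (T n) - flux N t (T n)\<bar> \<le> C * L2wnorm (\<lambda>x. u \<xi> x - u t x) * L2wnorm (T n)"
        by (rule C(2)[rule_format, OF T(1)])
      also have "\<dots> \<le> C * M * L2wnorm \<theta>"
        using M[OF \<xi>] T(2) C(1) M0 by (intro mult_mono mult_left_mono) auto
      finally show "\<bar>flux N \<xi> (T n) - flux N t (T n)\<bar> \<le> C * M * L2wnorm \<theta>" .
    qed
    have lim: "(\<lambda>n. pairing ?K (u s) (T n) - pairing ?K (u t) (T n) - (s - t) * flux N t (T n))
       \<longlonglongrightarrow> pairing ?K (u s) \<theta> - pairing ?K (u t) \<theta> - (s - t) * flux N t \<theta>"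
      unfolding flux_def T_def
      by (intro tendsto_diff tendsto_mult tendsto_const tendsto_add
          pairing_truncate_tendsto[OF C0 u_L2w \<theta>] pairing_truncate_tendsto[OF C3 u_L2w \<theta>] pairing_truncate_tendsto[OF C1 fu_L2w \<theta>])
    show "\<bar>pairing ?K (u s) \<theta> - pairing ?K (u t) \<theta> - (s - t) * flux N t \<theta>\<bar> \<le> \<bar>s - t\<bar> * (C * M * L2wnorm \<theta>)"
      by (rule LIMSEQ_le_const2[OF tendsto_rabs[OF lim]]) (use * in blast)
  qed
qed

text \<open>Since the kernel is symmetric, the increment of the quadratic form is the increment of the
  linear form paired with the sum of the two states.\<close>

proposition virial_derivative:
  assumes N: "1 \<le> N"
  shows "((\<lambda>s. pairing (virial_kernel 0 N 0 1 0) (u s) (u s)) has_real_derivative 2 * flux N t (u t)) (at t)"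
proof -
  let ?K = "virial_kernel 0 N 0 1 0" and ?K3 = "virial_kernel (3/2) N 2 1 3" and ?K1 = "virial_kernel (1/2) N 0 1 1"
  obtain C0 where C0: "local_kernel C0 ?K" using local_kernel_virial[OF N] by blast
  obtain C3 where C3: "local_kernel C3 ?K3" using local_kernel_virial[OF N] by blast
  obtain C1 where C1: "local_kernel C1 ?K1" using local_kernel_virial[OF N] by blast
  obtain A where A: "0 \<le> A" "\<forall>t \<theta>. \<theta> \<in> L2w \<longrightarrow> \<bar>flux N t \<theta>\<bar> \<le> A * (L2wnorm (u t) + L2wnorm (\<lambda>x. f (u t x))) * L2wnorm \<theta>"
    using flux_bounds[OF N] by (elim exE conjE) (rule that)
  obtain C where C: "0 \<le> C" "\<forall>s t M \<theta>. \<theta> \<in> L2w \<longrightarrow> (\<forall>\<xi>. min s t \<le> \<xi> \<longrightarrow> \<xi> \<le> max s t \<longrightarrow> L2wnorm (\<lambda>x. u \<xi> x - u t x) \<le> M) \<longrightarrow>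
     \<bar>pairing ?K (u s) \<theta> - pairing ?K (u t) \<theta> - (s - t) * flux N t \<theta>\<bar> \<le> \<bar>s - t\<bar> * (C * M * L2wnorm \<theta>)"
    using pairing_increment[OF N] by (elim exE conjE) (rule that)
  have sym: "?K x y = ?K y x" for x y
    using moll_parity[of N 0 "x - y"] by (simp add: virial_kernel_def add.commute)
  define A' where "A' = A * (L2wnorm (u t) + L2wnorm (\<lambda>x. f (u t x)))"
  have A': "0 \<le> A'" using A(1) by (simp add: A'_def)
  \<comment> \<open>Total coefficient of M in the error below: the remainder of the linear form at
    \<theta>, whose norm is at most twice that of u(t) plus 1, and the flux of the difference
    w.\<close>
  define D where "D = C * (2 * L2wnorm (u t) + 1) + A'"
  have D: "0 \<le> D" unfolding D_def using C(1) A' by (intro add_nonneg_nonneg mult_nonneg_nonneg) auto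
  show ?thesis
  proof (rule has_real_derivative_from_increment)
    fix e :: real assume e: "0 < e"
    define M where "M = min 1 (e / (D + 1))"
    have M: "0 < M" "M \<le> 1" using e D by (auto simp: M_def)
    have "M * D \<le> e / (D + 1) * D" using D by (intro mult_right_mono) (auto simp: M_def)
    also have "\<dots> \<le> e" using e D by (simp add: field_simps)
    finally have MD: "M * D \<le> e" .
    obtain d where d: "0 < d" "\<And>s. \<bar>s - t\<bar> < d \<Longrightarrow> L2wnorm (\<lambda>x. u s x - u t x) \<le> M"
      using u_eventually_close[OF M(1)] by blast
    have "\<bar>pairing ?K (u s) (u s) - pairing ?K (u t) (u t) - (s - t) * (2 * flux N t (u t))\<bar> \<le> e * \<bar>s - t\<bar>"
      if s: "\<bar>s - t\<bar> < d" for s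
    proof -
      define w where "w x = u s x - u t x" for x
      define \<theta> where "\<theta> x = u s x + u t x" for x
      have w: "w \<in> L2w" unfolding w_def by (rule L2w_diff[OF u_L2w u_L2w])
      have \<theta>: "\<theta> \<in> L2w" unfolding \<theta>_def by (rule L2w_add[OF u_L2w u_L2w])
      have wM: "L2wnorm w \<le> M" using d(2)[OF s] by (simp add: w_def[abs_def])
      \<comment> \<open>The sum of the two states is 2 u(t) plus the small difference w; the first
        part gives the factor 2 of the derivative, the second an error.\<close>
      have \<theta>_eq: "\<theta> = (\<lambda>x. (u t x + u t x) + w x)" by (auto simp: \<theta>_def w_def)
      have "L2wnorm \<theta> \<le> L2wnorm (\<lambda>x. u t x + u t x) + L2wnorm w"
        unfolding \<theta>_eq by (rule L2wnorm_add[OF L2w_add[OF u_L2w u_L2w] w])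
      also have "\<dots> \<le> 2 * L2wnorm (u t) + 1"
        using L2wnorm_add[OF u_L2w u_L2w, of t t] wM M(2) by linarith
      finally have \<theta>_norm: "L2wnorm \<theta> \<le> 2 * L2wnorm (u t) + 1" .
      have "pairing ?K (u s) \<theta> - pairing ?K (u t) \<theta> = pairing ?K (u s) (u s) - pairing ?K (u t) (u t)"
        unfolding \<theta>_def pairing_add_right[OF C0 u_L2w u_L2w u_L2w]
        using pairing_commute[OF C0 u_L2w u_L2w sym, of s t] by simp
      moreover have "flux N t \<theta> = 2 * flux N t (u t) + flux N t w"
        unfolding flux_def \<theta>_eq
        unfolding pairing_add_right[OF C3 L2w_add[OF u_L2w u_L2w] w u_L2w] pairing_add_right[OF C3 u_L2w u_L2w u_L2w]
          pairing_add_right[OF C1 L2w_add[OF u_L2w u_L2w] w fu_L2w] pairing_add_right[OF C1 u_L2w u_L2w fu_L2w]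
        by simp
      ultimately have eq: "pairing ?K (u s) (u s) - pairing ?K (u t) (u t) - (s - t) * (2 * flux N t (u t)) =
         (pairing ?K (u s) \<theta> - pairing ?K (u t) \<theta> - (s - t) * flux N t \<theta>) + (s - t) * flux N t w"
        by (simp add: algebra_simps)
      have "\<bar>pairing ?K (u s) (u s) - pairing ?K (u t) (u t) - (s - t) * (2 * flux N t (u t))\<bar> \<le>
          \<bar>s - t\<bar> * (C * M * L2wnorm \<theta>) + \<bar>s - t\<bar> * (A' * L2wnorm w)"
        unfolding eq
      proof (rule order_trans[OF abs_triangle_ineq add_mono])
        show "\<bar>pairing ?K (u s) \<theta> - pairing ?K (u t) \<theta> - (s - t) * flux N t \<theta>\<bar> \<le> \<bar>s - t\<bar> * (C * M * L2wnorm \<theta>)"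
        proof (rule C(2)[rule_format, OF \<theta>])
          fix \<xi> assume "min s t \<le> \<xi>" "\<xi> \<le> max s t"
          then show "L2wnorm (\<lambda>x. u \<xi> x - u t x) \<le> M" using s by (intro d(2)) linarith
        qed
        show "\<bar>(s - t) * flux N t w\<bar> \<le> \<bar>s - t\<bar> * (A' * L2wnorm w)"
          unfolding abs_mult A'_def by (rule mult_left_mono[OF A(2)[rule_format, OF w]]) simp
      qed
      also have "\<dots> \<le> \<bar>s - t\<bar> * (C * M * (2 * L2wnorm (u t) + 1)) + \<bar>s - t\<bar> * (A' * M)"
        using \<theta>_norm wM C(1) M(1) A' by (intro add_mono mult_left_mono) auto
      also have "\<dots> = \<bar>s - t\<bar> * (M * D)" by (simp add: D_def algebra_simps)
      also have "\<dots> \<le> \<bar>s - t\<bar> * e" by (rule mult_left_mono[OF MD]) simp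
      finally show ?thesis by (simp add: mult.commute)
    qed
    then show "\<exists>d>0. \<forall>s. \<bar>s - t\<bar> < d \<longrightarrow> \<bar>pairing ?K (u s) (u s) - pairing ?K (u t) (u t) - (s - t) * (2 * flux N t (u t))\<bar> \<le> e * \<bar>s - t\<bar>"
      using d(1) by blast
  qed
qed

end

section \<open>Removing the regularisation\<close>

text \<open>Counterpart of \<open>pairing\<close> without a growing weight: the bounds involve plain
  L2 norms and the L1 norm of \<kappa>, which for the rescaled kernels used below does not depend on
  N.\<close>

definition conv_form :: "(real \<Rightarrow> real) \<Rightarrow> (real \<Rightarrow> real) \<Rightarrow> (real \<Rightarrow> real) \<Rightarrow> real" where
  "conv_form \<kappa> a b = (LBINT x. (LBINT y. \<kappa> (x - y) * a x * b y))"

lemma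
  assumes \<kappa>: "integrable lborel \<kappa>" and a: "a \<in> L2" and b: "b \<in> L2"
  shows conv_form_integrable: "integrable (lborel \<Otimes>\<^sub>M lborel) (\<lambda>(x, y). \<kappa> (x - y) * a x * b y)"
    and conv_form_bound: "\<bar>conv_form \<kappa> a b\<bar> \<le> (LBINT x. \<bar>\<kappa> x\<bar>) * (L2norm a * L2norm b)"
    and conv_form_left: "conv_form \<kappa> a b = (LBINT x. a x * (LBINT y. \<kappa> (x - y) * b y))"
    and conv_form_right: "conv_form \<kappa> a b = (LBINT y. b y * (LBINT x. \<kappa> (x - y) * a x))"
    and conv_form_prod: "conv_form \<kappa> a b = (\<integral>z. (case z of (x, y) \<Rightarrow> \<kappa> (x - y) * a x * b y) \<partial>(lborel \<Otimes>\<^sub>M lborel))"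
proof -
  have [measurable]: "\<kappa> \<in> borel_measurable borel" using \<kappa> by (auto dest: borel_measurable_integrable)
  note i = integrable_abs[OF \<kappa>]
  show I: "integrable (lborel \<Otimes>\<^sub>M lborel) (\<lambda>(x, y). \<kappa> (x - y) * a x * b y)"
    by (rule dominated_kernel_integrable[OF i _ _ a b]) auto
  show "\<bar>conv_form \<kappa> a b\<bar> \<le> (LBINT x. \<bar>\<kappa> x\<bar>) * (L2norm a * L2norm b)"
    unfolding conv_form_def by (rule dominated_kernel_bound[OF i _ _ a b]) auto
  show "conv_form \<kappa> a b = (LBINT x. a x * (LBINT y. \<kappa> (x - y) * b y))"
    unfolding conv_form_def by (subst integral_mult_right_zero[symmetric]) (simp add: ac_simps)
  have "conv_form \<kappa> a b = (LBINT y. (LBINT x. \<kappa> (x - y) * a x * b y))"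
    unfolding conv_form_def by (rule dominated_kernel_swap[OF i _ _ a b]) auto
  then show "conv_form \<kappa> a b = (LBINT y. b y * (LBINT x. \<kappa> (x - y) * a x))"
    by (simp add: mult.commute)
  show "conv_form \<kappa> a b = (\<integral>z. (case z of (x, y) \<Rightarrow> \<kappa> (x - y) * a x * b y) \<partial>(lborel \<Otimes>\<^sub>M lborel))"
    unfolding conv_form_def using lborel_pair.integral_fst'[OF I] by simp
qed

text \<open>Disposes of the term (x + y)/2 \<rho>'''(x - y), the only dispersive one that carries
  the weight.\<close>

lemma pairing_antisymmetric:
  assumes k: "local_kernel C k" and v: "v \<in> L2w" and anti: "\<And>x y. k x y = - k y x"
  shows "pairing k v v = 0"
proof -
  have "v y * (LBINT x. k x y * v x) = - (LBINT x. k y x * v y * v x)" for y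
    by (subst integral_mult_right_zero[symmetric], subst integral_minus[symmetric]) (simp add: ac_simps anti[of _ y])
  then have "pairing k v v = - (LBINT y. (LBINT x. k y x * v y * v x))"
    unfolding pairing_swap[OF k v v] by simp
  then show ?thesis unfolding pairing_def by linarith
qed

text \<open>The kernel (x - y) \<rho>'(x - y), left over when (x + y)/2 is written as x - (x -
  y)/2.\<close>

definition mollifier_moment :: "real \<Rightarrow> real" where
  "mollifier_moment z = z * mollifier_deriv 1 z"

lemma integrable_mollifier_moment: "integrable lborel mollifier_moment"
proof -
  obtain P k where P: "mollifier_deriv 1 = bump_fun P k" using mollifier_deriv_bump_fun by blast
  have "mollifier_moment = bump_fun ([:0, 1:] * P) k"
    unfolding bump_fun_mult[abs_def] mollifier_moment_def[abs_def] P by simp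
  then show ?thesis by (rule ssubst) (rule integrable_bump_fun)
qed

text \<open>The function z \<rho>(z) has derivative \<rho> + z \<rho>' and vanishes at -1 and 1, so
  the moment kernel has the opposite mass of \<rho>.\<close>

lemma integral_mollifier_moment: "(LBINT z. mollifier_moment z) = - 1"
proof -
  obtain P k where P: "mollifier_deriv 0 = bump_fun P k" using mollifier_deriv_bump_fun by blast
  obtain Q j where Q: "mollifier_deriv 1 = bump_fun Q j" using mollifier_deriv_bump_fun by blast
  have "(LBINT z. (mollifier_deriv 0 z + mollifier_moment z) * indicator {-1..1} z)
      = 1 * mollifier_deriv 0 1 - (-1) * mollifier_deriv 0 (-1)"
    unfolding mollifier_moment_def
  proof (rule integral_FTC_Icc_real)
    show "((\<lambda>z. z * mollifier_deriv 0 z) has_real_derivative mollifier_deriv 0 x + x * mollifier_deriv 1 x) (at x)" for x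
      by (auto intro!: derivative_eq_intros DERIV_cong[OF has_real_derivative_mollifier_deriv])
    show "isCont (\<lambda>z. mollifier_deriv 0 z + z * mollifier_deriv 1 z) x" for x
      by (intro continuous_intros DERIV_isCont[OF has_real_derivative_mollifier_deriv])
  qed simp
  moreover have "mollifier_deriv 0 1 = 0" "mollifier_deriv 0 (-1) = 0" by (auto simp: P bump_fun_zero)
  moreover have "(mollifier_deriv 0 z + mollifier_moment z) * indicator {-1..1} z = mollifier_deriv 0 z + mollifier_moment z" for z
  proof (cases "z \<in> {-1..1}")
    case False
    then have "1 \<le> \<bar>z\<bar>" by auto
    then show ?thesis unfolding mollifier_moment_def P Q by (simp add: bump_fun_zero)
  qed simp
  ultimately have "(LBINT z. mollifier_deriv 0 z + mollifier_moment z) = 0" by simp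
  then show ?thesis
    using integrable_mollifier_moment integrable_mollifier_deriv[of 0] integral_mollifier by simp
qed

text \<open>One time slice, with v the continuous representative and g its derivative. The bound
  \<delta> <= 1 lets higher powers of v be estimated by lower ones.\<close>

locale gkdv_profile =
  fixes f F :: "real \<Rightarrow> real" and c \<delta> :: real and v g :: "real \<Rightarrow> real"
  assumes f_continuous: "continuous_on UNIV f"
    and F_deriv: "\<And>s. (F has_real_derivative f s) (at s)" and F_zero: "F 0 = 0"
    and c: "0 \<le> c" and f_cubic: "\<And>s. \<bar>s\<bar> \<le> \<delta> \<Longrightarrow> \<bar>f s\<bar> \<le> c * \<bar>s\<bar> ^ 3" and \<delta>: "\<delta> \<le> 1"
    and v: "v \<in> L2w" and g: "g \<in> L2" and wd: "has_weak_deriv v g" and prim: "primitive_of v g"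
    and small: "\<And>x. \<bar>v x\<bar> \<le> \<delta>"
begin

lemma f_measurable [measurable]: "f \<in> borel_measurable borel"
  by (rule borel_measurable_continuous_onI[OF f_continuous])

lemma F_continuous: "continuous_on UNIV F"
  by (meson DERIV_isCont F_deriv continuous_at_imp_continuous_on)

lemma F_measurable [measurable]: "F \<in> borel_measurable borel"
  by (rule borel_measurable_continuous_onI[OF F_continuous])

lemma v_measurable [measurable]: "v \<in> borel_measurable borel" by (rule L2w_measurable[OF v])
lemma g_measurable [measurable]: "g \<in> borel_measurable borel" by (rule L2_measurable[OF g])

lemma v_L2: "v \<in> L2" by (rule L2w_L2[OF v])

lemma f_le_linear: "\<bar>f (v x)\<bar> \<le> c * \<bar>v x\<bar>"
proof -
  have "\<bar>v x\<bar> ^ 3 \<le> \<bar>v x\<bar> ^ 1" using small[of x] \<delta> by (intro power_decreasing) auto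
  then show ?thesis using f_cubic[OF small[of x]] c by (smt (verit) mult_left_mono power_one_right)
qed

lemma fv: "(\<lambda>x. f (v x)) \<in> L2w" "(\<lambda>x. f (v x)) \<in> L2" "L2norm (\<lambda>x. f (v x)) \<le> c * L2norm v"
  using L2w_norm_mono(1)[OF v _ f_le_linear c] L2_norm_mono(2)[OF v_L2 _ f_le_linear c] L2w_L2 by auto

definition sup_const :: real where
  "sup_const = 2 * (L2wnorm v)\<^sup>2 + (L2norm g)\<^sup>2"

lemma wt_sup_bound: "wt x * (v x)\<^sup>2 \<le> sup_const"
proof -
  have "wt x * (v x)\<^sup>2 \<le> (LBINT z. 2 * (wt z * v z)\<^sup>2 + (g z)\<^sup>2)"
    by (rule weighted_sup_bound[OF prim v_L2 g wt_ge_1 wt_mono L2w_weighted[OF v]])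
  also have "\<dots> = sup_const"
    using L2_integrable_square[OF L2w_weighted[OF v]] L2_integrable_square[OF g]
    by (simp add: sup_const_def L2wnorm_def L2norm_def)
  finally show ?thesis .
qed

text \<open>|x f(v)| is at most c times the product of \<open>wt\<close> v^2, which is bounded by
  the weighted Sobolev estimate, and \<open>wt\<close> |v|, which is in L2. This is where the cubic
  order of f at 0 is used.\<close>

lemma weighted_f: "(\<lambda>x. x * f (v x)) \<in> L2" "L2norm (\<lambda>x. x * f (v x)) \<le> c * sup_const * L2wnorm v"
proof -
  have S: "0 \<le> sup_const" by (simp add: sup_const_def)
  have le: "\<bar>x * f (v x)\<bar> \<le> c * sup_const * \<bar>wt x * v x\<bar>" for x
  proof -
    have "\<bar>x * f (v x)\<bar> \<le> (wt x)\<^sup>2 * (c * \<bar>v x\<bar> ^ 3)"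
      unfolding abs_mult using f_cubic[OF small[of x]] by (intro mult_mono) (auto simp: wt_square)
    also have "\<dots> = c * (wt x * \<bar>v x\<bar>\<^sup>2) * (wt x * \<bar>v x\<bar>)"
      by (simp only: power2_eq_square power3_eq_cube ac_simps)
    also have "\<dots> = c * (wt x * (v x)\<^sup>2) * \<bar>wt x * v x\<bar>"
      by (simp add: abs_mult)
    also have "\<dots> \<le> c * sup_const * \<bar>wt x * v x\<bar>"
      using wt_sup_bound c by (intro mult_right_mono mult_left_mono) auto
    finally show ?thesis .
  qed
  show "(\<lambda>x. x * f (v x)) \<in> L2" "L2norm (\<lambda>x. x * f (v x)) \<le> c * sup_const * L2wnorm v"
    using L2_norm_mono[OF L2w_weighted[OF v] _ le] c S by (auto simp: L2wnorm_def)
qed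

text \<open>A quadratic bound is enough, both for integrability of F(v) and, with the weight, for
  that of x F(v).\<close>

lemma F_bound: "\<bar>F (v x)\<bar> \<le> c * (v x)\<^sup>2"
proof -
  have "\<bar>F (v x) - F 0 - (v x - 0) * 0\<bar> \<le> \<bar>v x - 0\<bar> * (c * \<bar>v x\<bar>)"
  proof (rule increment_estimate[OF F_deriv])
    fix s assume s: "min (v x) 0 \<le> s" "s \<le> max (v x) 0"
    then have sv: "\<bar>s\<bar> \<le> \<bar>v x\<bar>" by linarith
    then have "\<bar>s\<bar> \<le> \<delta>" using small[of x] by linarith
    then have "\<bar>f s\<bar> \<le> c * \<bar>s\<bar> ^ 3" "\<bar>s\<bar> \<le> 1" using f_cubic \<delta> by auto
    moreover have "\<bar>s\<bar> ^ 3 \<le> \<bar>s\<bar> ^ 1" using \<open>\<bar>s\<bar> \<le> 1\<close> by (intro power_decreasing) auto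
    then have "c * \<bar>s\<bar> ^ 3 \<le> c * \<bar>v x\<bar>" using sv c by (intro mult_left_mono) auto
    ultimately show "\<bar>f s - 0\<bar> \<le> c * \<bar>v x\<bar>" by simp
  qed
  moreover have "\<bar>v x\<bar> * (c * \<bar>v x\<bar>) = c * (v x)\<^sup>2"
    by (simp only: mult.left_commute[of "\<bar>v x\<bar>" c] abs_mult_self_eq power2_eq_square)
  ultimately show ?thesis by (simp add: F_zero)
qed

lemma F_integrable: "integrable lborel (\<lambda>x. F (v x))"
  by (rule Bochner_Integration.integrable_bound[OF integrable_mult_right[OF L2_integrable_square[OF v_L2], of c]])
     (use F_bound c in \<open>auto intro!: AE_I2 simp: abs_mult\<close>)

lemma fv_v_integrable: "integrable lborel (\<lambda>x. f (v x) * v x)"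
  by (rule L2_mult_integrable[OF fv(2) v_L2])

text \<open>Integration by parts for x F(v). This product is integrable since |F(v)| <= c v^2 and v
  is in \<open>L2w\<close>, so there are no boundary terms.\<close>

lemma integral_weighted_f: "(LBINT x. x * f (v x) * g x) = - (LBINT x. F (v x))"
proof -
  have cv: "continuous_on UNIV v" by (rule primitive_of_continuous[OF prim g])
  have p: "primitive_of (\<lambda>x. x * F (v x)) (\<lambda>x. F (v x) + x * (f (v x) * g x))"
    by (intro primitive_of_times_id primitive_of_compose[OF prim cv F_deriv f_continuous]
        continuous_on_compose2[OF F_continuous cv]) auto
  have xi: "integrable lborel (\<lambda>x. x * f (v x) * g x)" by (rule L2_mult_integrable[OF weighted_f(1) g])
  have "(LBINT x. F (v x) + x * (f (v x) * g x)) = 0"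
  proof (rule integral_of_derivative_zero[OF p])
    show "integrable lborel (\<lambda>x. F (v x) + x * (f (v x) * g x))"
      using F_integrable xi by (simp add: mult.assoc)
    show "integrable lborel (\<lambda>x. x * F (v x))"
    proof (rule Bochner_Integration.integrable_bound[OF integrable_mult_right[OF L2_integrable_square[OF L2w_weighted[OF v]], of c]])
      show "AE x in lborel. norm (x * F (v x)) \<le> norm (c * (wt x * v x)\<^sup>2)"
      proof (rule AE_I2)
        fix x
        have "\<bar>x * F (v x)\<bar> \<le> (wt x)\<^sup>2 * (c * (v x)\<^sup>2)"
          unfolding abs_mult using F_bound[of x] by (intro mult_mono) (auto simp: wt_square)
        then show "norm (x * F (v x)) \<le> norm (c * (wt x * v x)\<^sup>2)" using c by (simp add: power_mult_distrib ac_simps)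
      qed
    qed measurable
  qed
  then show ?thesis using F_integrable xi by (simp add: mult.assoc)
qed

definition virial_flux :: "real \<Rightarrow> real" where
  "virial_flux N = 2 * (pairing (virial_kernel (3/2) N 2 1 3) v v + pairing (virial_kernel (1/2) N 0 1 1) (\<lambda>x. f (v x)) v)"

text \<open>Twice the coefficient 3/2 gives 3 \<rho>'', and both derivatives move to v, one in each
  variable. In the nonlinear part (x + y)/2 = x - (x - y)/2: the factor x goes to f(v), and (x - y)
  \<rho>' is the moment kernel.\<close>

lemma virial_flux_eq:
  assumes N: "1 \<le> N"
  shows "virial_flux N = - 3 * conv_form (moll N 0) g g + conv_form (moll N 0) (\<lambda>x. f (v x)) v
     + 2 * conv_form (moll N 0) (\<lambda>x. x * f (v x)) g - conv_form (\<lambda>z. N * mollifier_moment (N * z)) (\<lambda>x. f (v x)) v"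
proof -
  have N0: "0 < N" using N by simp
  note im = integrable_moll[OF N0]
  have iz: "integrable lborel (\<lambda>z. N * mollifier_moment (N * z))"
    using lborel_integrable_real_affine[OF integrable_mollifier_moment, of N 0] N by simp
  have zm: "N * mollifier_moment (N * z) = z * moll N 1 z" for z
    by (simp add: mollifier_moment_def moll_def)
  obtain Ca where Ca: "local_kernel Ca (virial_kernel 0 N 0 1 3)" using local_kernel_virial[OF N] by blast
  obtain C3 where C3: "local_kernel C3 (virial_kernel (3/2) N 2 1 3)" using local_kernel_virial[OF N] by blast
  obtain C1 where C1: "local_kernel C1 (virial_kernel (1/2) N 0 1 1)" using local_kernel_virial[OF N] by blast
  have anti: "pairing (virial_kernel 0 N 0 1 3) v v = 0"
  proof (rule pairing_antisymmetric[OF Ca v])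
    show "virial_kernel 0 N 0 1 3 x y = - virial_kernel 0 N 0 1 3 y x" for x y
      using moll_parity[of N 3 "x - y"] by (simp add: virial_kernel_def add.commute)
  qed
  have "pairing (virial_kernel (3/2) N 2 1 3) v v = 3/2 * conv_form (moll N 2) v v + pairing (virial_kernel 0 N 0 1 3) v v"
  proof -
    have "(\<lambda>(x, y). virial_kernel (3/2) N 2 1 3 x y * v x * v y) =
       (\<lambda>z. 3/2 * (case z of (x, y) \<Rightarrow> moll N 2 (x - y) * v x * v y) + (case z of (x, y) \<Rightarrow> virial_kernel 0 N 0 1 3 x y * v x * v y))"
      by (auto simp: virial_kernel_def fun_eq_iff algebra_simps)
    then show ?thesis
      unfolding pairing_prod[OF C3 v v] pairing_prod[OF Ca v v] conv_form_prod[OF im v_L2 v_L2]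
      using conv_form_integrable[OF im v_L2 v_L2, of 2] pairing_integrable[OF Ca v v] by simp
  qed
  moreover have "conv_form (moll N 2) v v = - conv_form (moll N 0) g g"
  proof -
    have "conv_form (moll N 2) v v = conv_form (moll N 1) v g"
      unfolding conv_form_left[OF im v_L2 v_L2] conv_form_left[OF im v_L2 g]
      using weak_deriv_moll(1)[OF wd N0, of 1] by (simp add: numeral_2_eq_2)
    also have "\<dots> = - conv_form (moll N 0) g g"
      unfolding conv_form_right[OF im v_L2 g] conv_form_right[OF im g g]
      using weak_deriv_moll(2)[OF wd N0, of 0] by simp
    finally show ?thesis .
  qed
  moreover have "2 * pairing (virial_kernel (1/2) N 0 1 1) (\<lambda>x. f (v x)) v =
     conv_form (moll N 0) (\<lambda>x. f (v x)) v + 2 * conv_form (moll N 1) (\<lambda>x. x * f (v x)) v - conv_form (\<lambda>z. N * mollifier_moment (N * z)) (\<lambda>x. f (v x)) v"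
  proof -
    have "(\<lambda>(x, y). virial_kernel (1/2) N 0 1 1 x y * f (v x) * v y) =
       (\<lambda>z. 1/2 * (case z of (x, y) \<Rightarrow> moll N 0 (x - y) * f (v x) * v y) + (case z of (x, y) \<Rightarrow> moll N 1 (x - y) * (x * f (v x)) * v y)
          - 1/2 * (case z of (x, y) \<Rightarrow> N * mollifier_moment (N * (x - y)) * f (v x) * v y))"
      unfolding zm by (auto simp: virial_kernel_def fun_eq_iff field_simps)
    then show ?thesis
      unfolding pairing_prod[OF C1 fv(1) v] conv_form_prod[OF im fv(2) v_L2] conv_form_prod[OF im weighted_f(1) v_L2] conv_form_prod[OF iz fv(2) v_L2]
      using conv_form_integrable[OF im[of 0] fv(2) v_L2] conv_form_integrable[OF im[of 1] weighted_f(1) v_L2] conv_form_integrable[OF iz fv(2) v_L2] by simp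
  qed
  moreover have "conv_form (moll N 1) (\<lambda>x. x * f (v x)) v = conv_form (moll N 0) (\<lambda>x. x * f (v x)) g"
    unfolding conv_form_left[OF im weighted_f(1) v_L2] conv_form_left[OF im weighted_f(1) g]
    using weak_deriv_moll(1)[OF wd N0, of 0] by simp
  ultimately show ?thesis using anti by (simp add: virial_flux_def)
qed

text \<open>The product f(v) v enters twice, through \<rho> of mass 1 and through minus the moment
  kernel of mass -1; integrating by parts turns x f(v) g into -F(v).\<close>

lemma virial_flux_tendsto:
  "(\<lambda>n. virial_flux (real (Suc n))) \<longlonglongrightarrow>
     - 3 * (LBINT x. (g x)\<^sup>2) + 2 * (LBINT x. f (v x) * v x) - 2 * (LBINT x. F (v x))"
proof -
  have lim: "(\<lambda>n. conv_form (moll (real (Suc n)) 0) a b) \<longlonglongrightarrow> (LBINT x. a x * b x)" if "a \<in> L2" "b \<in> L2" for a b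
    using approximate_identity_tendsto[OF integrable_mollifier_deriv[of 0] that]
    by (simp add: conv_form_def moll_def integral_mollifier del: of_nat_Suc)
  have lim': "(\<lambda>n. conv_form (\<lambda>z. real (Suc n) * mollifier_moment (real (Suc n) * z)) a b) \<longlonglongrightarrow> - (LBINT x. a x * b x)"
    if "a \<in> L2" "b \<in> L2" for a b
    using approximate_identity_tendsto[OF integrable_mollifier_moment that]
    by (simp add: conv_form_def integral_mollifier_moment del: of_nat_Suc)
  have "(\<lambda>n. virial_flux (real (Suc n))) \<longlonglongrightarrow>
    - 3 * (LBINT x. g x * g x) + (LBINT x. f (v x) * v x) + 2 * (LBINT x. x * f (v x) * g x) - - (LBINT x. f (v x) * v x)"
    by (subst virial_flux_eq, simp)
       (intro tendsto_intros lim lim' g fv(2) v_L2 weighted_f(1))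
  then show ?thesis unfolding integral_weighted_f power2_eq_square by (simp add: algebra_simps)
qed

text \<open>The kernels of the four forms have L1 norms independent of N. The coefficient 6 is the 2
  in front of the third form times the 3 in \<open>sup_const\<close> <= 3 A^2. The bound is the
  majorant for the limit in N.\<close>

lemma virial_flux_bound:
  assumes N: "1 \<le> N" and A: "L2wnorm v \<le> A" "L2norm g \<le> A"
  shows "\<bar>virial_flux N\<bar> \<le> 3 * A\<^sup>2 + c * A\<^sup>2 + 6 * c * A ^ 4 + (LBINT z. \<bar>mollifier_moment z\<bar>) * (c * A\<^sup>2)"
proof -
  have N0: "0 < N" using N by simp
  note im = integrable_moll[OF N0]
  have iz: "integrable lborel (\<lambda>z. N * mollifier_moment (N * z))"
    using lborel_integrable_real_affine[OF integrable_mollifier_moment, of N 0] N by simp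
  have A0: "0 \<le> A" using A(2) L2norm_nonneg[of g] by linarith
  have m1: "(LBINT x. \<bar>moll N 0 x\<bar>) = 1"
    using moll_nonneg[of N] N integral_moll[OF N0] by simp
  have m2: "(LBINT z. \<bar>N * mollifier_moment (N * z)\<bar>) = (LBINT z. \<bar>mollifier_moment z\<bar>)"
    using lborel_integral_real_affine[of N "\<lambda>z. \<bar>mollifier_moment z\<bar>" 0] N by (simp add: abs_mult)
  have vA: "L2norm v \<le> A" using L2norm_le_L2wnorm[OF v] A by linarith
  have fA: "L2norm (\<lambda>x. f (v x)) \<le> c * A" using fv(3) vA c by (meson mult_left_mono order_trans)
  have SA: "sup_const \<le> 3 * A\<^sup>2"
    using power_mono[OF A(1), of 2] power_mono[OF A(2), of 2] by (simp add: sup_const_def)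
  have HA: "L2norm (\<lambda>x. x * f (v x)) \<le> c * (3 * A\<^sup>2) * A"
    by (rule order_trans[OF weighted_f(2)], intro mult_mono mult_left_mono SA c A(1)) (use c in auto)
  have b1: "\<bar>conv_form (moll N 0) g g\<bar> \<le> A * A"
    using conv_form_bound[OF im[of 0] g g] mult_mono[OF A(2) A(2) A0] unfolding m1 by simp
  have fvA: "L2norm (\<lambda>x. f (v x)) * L2norm v \<le> (c * A) * A"
    using fA vA A0 c by (intro mult_mono) auto
  have b2: "\<bar>conv_form (moll N 0) (\<lambda>x. f (v x)) v\<bar> \<le> (c * A) * A"
    using conv_form_bound[OF im[of 0] fv(2) v_L2] fvA unfolding m1 by simp
  have b3: "\<bar>conv_form (moll N 0) (\<lambda>x. x * f (v x)) g\<bar> \<le> (c * (3 * A\<^sup>2) * A) * A"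
  proof -
    have "L2norm (\<lambda>x. x * f (v x)) * L2norm g \<le> (c * (3 * A\<^sup>2) * A) * A"
      using HA A A0 c by (intro mult_mono) auto
    then show ?thesis using conv_form_bound[OF im[of 0] weighted_f(1) g] unfolding m1 by simp
  qed
  have b4: "\<bar>conv_form (\<lambda>z. N * mollifier_moment (N * z)) (\<lambda>x. f (v x)) v\<bar> \<le> (LBINT z. \<bar>mollifier_moment z\<bar>) * ((c * A) * A)"
    by (rule order_trans[OF conv_form_bound[OF iz fv(2) v_L2]]) (unfold m2, intro mult_left_mono fvA, simp)
  show ?thesis
    unfolding virial_flux_eq[OF N] using b1 b2 b3 b4 by (simp add: power2_eq_square power4_eq_xxxx ac_simps)
qed

end

section \<open>Periodic flows\<close>

text \<open>V will be a pointwise limit, known only to be gauge integrable. Nonnegativity makes it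
  Lebesgue integrable, so a zero integral forces it to vanish almost everywhere, against its
  positivity on an interval of positive length.\<close>

lemma positive_integral_contradiction:
  fixes V :: "real \<Rightarrow> real"
  assumes V: "V integrable_on {a..b}" "integral {a..b} V = 0" and nn: "\<And>t. 0 \<le> V t"
    and d: "a < d" "d \<le> b" and pos: "\<And>t. t \<in> {a..d} \<Longrightarrow> 0 < V t"
  shows False
proof -
  have abs: "V absolutely_integrable_on {a..b}"
    by (rule nonnegative_absolutely_integrable_1[OF V(1)]) (use nn in auto)
  have i: "integrable lebesgue (\<lambda>x. indicator {a..b} x *\<^sub>R V x)"
    using abs by (simp add: set_integrable_def)
  have "(\<integral>x. indicator {a..b} x *\<^sub>R V x \<partial>lebesgue) = 0"
    using set_lebesgue_integral_eq_integral(2)[OF abs] V(2) by (simp add: set_lebesgue_integral_def)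
  then have "AE x in lebesgue. indicator {a..b} x *\<^sub>R V x = 0"
    using integral_nonneg_eq_0_iff_AE[OF i] nn by (auto simp: indicator_def)
  then have "AE x in lebesgue. x \<notin> {a..d}"
  proof eventually_elim
    fix x assume 0: "indicator {a..b} x *\<^sub>R V x = 0"
    show "x \<notin> {a..d}"
    proof
      assume x: "x \<in> {a..d}"
      then have "V x = 0" using 0 d by (auto simp: indicator_def split: if_splits)
      then show False using pos[OF x] by simp
    qed
  qed
  then have "emeasure lebesgue {a..d} = 0"
    by (subst (asm) AE_iff_measurable[of "{a..d}"]) auto
  then show False using d by simp
qed

text \<open>\<sigma> stands for the sign of \<beta>, and \<sigma> E <= 0 covers both cases of the
  theorem at once. Strict positivity of the limiting derivative is used on a short interval starting
  at a time a at which the solution is nonzero.\<close>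

lemma no_periodic_flow:
  assumes flow: "gkdv_flow f L \<delta> w" and prof: "\<And>t. gkdv_profile f F c \<delta> (w t) (g t)"
    and gA: "\<And>t. L2norm (g t) \<le> A" and \<omega>: "0 < \<omega>"
    and periodic: "\<And>t. L2wnorm (\<lambda>x. w (t + \<omega>) x - w t x) = 0"
    and energy: "\<And>t. (LBINT x. (g t x)\<^sup>2) / 2 - (LBINT x. F (w t x)) = E"
    and \<sigma>: "\<sigma> * E \<le> 0" and \<kappa>: "0 < \<kappa>"
    and sign: "\<And>y. \<bar>y\<bar> \<le> \<delta> \<Longrightarrow> \<kappa> * y ^ 6 \<le> \<sigma> * (2 * y * f y - 8 * F y)"
    and nontrivial: "L2wnorm (w a) \<noteq> 0"
  shows False
proof -
  interpret gkdv_flow f L \<delta> w by (rule flow)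
  define D where "D n t = 2 * flux (real (Suc n)) t (w t)" for n t
  define V where "V t = - 3 * (LBINT x. (g t x)\<^sup>2) + 2 * (LBINT x. f (w t x) * w t x) - 2 * (LBINT x. F (w t x))" for t
  have D_eq: "D n t = gkdv_profile.virial_flux f (w t) (real (Suc n))" for n t
    unfolding D_def flux_def gkdv_profile.virial_flux_def[OF prof] ..
  have D_lim: "(\<lambda>n. D n t) \<longlonglongrightarrow> V t" for t
    unfolding D_eq V_def by (rule gkdv_profile.virial_flux_tendsto[OF prof])
  have norm_cont: "isCont (\<lambda>s. L2wnorm (w s)) t" for t
    unfolding isCont_def
  proof (rule LIM_zero_cancel, rule Lim_null_comparison[OF _ u_continuous[of t]])
    have "\<bar>L2wnorm (w s) - L2wnorm (w t)\<bar> \<le> L2wnorm (\<lambda>x. w s x - w t x)" for s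
    proof -
      have "L2wnorm (\<lambda>x. w t x - w s x) = L2wnorm (\<lambda>x. w s x - w t x)"
        unfolding L2wnorm_def L2norm_def by (simp add: power_mult_distrib power2_commute)
      then show ?thesis
        using L2wnorm_add[OF u_L2w[of t] L2w_diff[OF u_L2w[of s] u_L2w[of t]]]
          L2wnorm_add[OF u_L2w[of s] L2w_diff[OF u_L2w[of t] u_L2w[of s]]] by simp
    qed
    then show "\<forall>\<^sub>F s in at t. norm (L2wnorm (w s) - L2wnorm (w t)) \<le> L2wnorm (\<lambda>x. w s x - w t x)"
      by simp
  qed
  let ?S = "{a..a + \<omega>}"
  \<comment> \<open>The assumed bound on the H^1 norm says nothing about the weighted norm;
    continuity in time bounds the latter on one period.\<close>
  have "bounded ((\<lambda>s. L2wnorm (w s)) ` ?S)"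
    by (intro compact_imp_bounded compact_continuous_image continuous_at_imp_continuous_on ballI norm_cont) auto
  then obtain M where M: "\<And>s. s \<in> ?S \<Longrightarrow> L2wnorm (w s) \<le> M"
    unfolding bounded_iff by fastforce
  define A' where "A' = max M A"
  define C where "C = 3 * A'\<^sup>2 + c * A'\<^sup>2 + 6 * c * A' ^ 4 + (LBINT z. \<bar>mollifier_moment z\<bar>) * (c * A'\<^sup>2)"
  have D_bound: "norm (D n t) \<le> C" if "t \<in> ?S" for n t
    unfolding D_eq C_def real_norm_def
    by (rule gkdv_profile.virial_flux_bound[OF prof]) (use M[OF that] gA[of t] in \<open>auto simp: A'_def\<close>)
  \<comment> \<open>For the gauge integral it is enough that the derivative exists at every t, so
    \<open>D n\<close> need not be shown continuous in time.\<close>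
  have D_int: "(D n has_integral 0) ?S" for n
  proof -
    let ?K = "virial_kernel 0 (real (Suc n)) 0 1 0"
    have N: "1 \<le> real (Suc n)" by simp
    obtain C0 where C0: "local_kernel C0 ?K" using local_kernel_virial[OF N] by blast
    let ?d = "\<lambda>x. w (a + \<omega>) x - w a x"
    have d: "?d \<in> L2w" by (rule L2w_diff[OF u_L2w u_L2w])
    \<comment> \<open>Periodicity is an equality almost everywhere, available here as a vanishing
      norm of the difference; boundedness of the pairing turns it into equality of the two
      values.\<close>
    have z: "pairing ?K ?d (w (a + \<omega>)) = 0" "pairing ?K (w a) ?d = 0"
      using pairing_bound[OF C0 d u_L2w[of "a + \<omega>"]] pairing_bound[OF C0 u_L2w[of a] d] periodic[of a] by auto
    have per: "pairing ?K (w (a + \<omega>)) (w (a + \<omega>)) = pairing ?K (w a) (w a)"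
      using z unfolding pairing_diff_left[OF C0 u_L2w u_L2w u_L2w] pairing_diff_right[OF C0 u_L2w u_L2w u_L2w] by simp
    have "(D n has_integral pairing ?K (w (a + \<omega>)) (w (a + \<omega>)) - pairing ?K (w a) (w a)) ?S"
    proof (rule fundamental_theorem_of_calculus)
      fix t assume "t \<in> ?S"
      show "((\<lambda>s. pairing ?K (w s) (w s)) has_vector_derivative D n t) (at t within ?S)"
        unfolding D_def
        by (rule has_vector_derivative_at_within)
           (use virial_derivative[OF N, of t] in \<open>simp add: has_real_derivative_iff_has_vector_derivative\<close>)
    qed (use \<omega> in simp)
    then show ?thesis unfolding per by simp
  qed
  \<comment> \<open>Dominated convergence for the gauge integral also yields the integrability of
    the limit V.\<close>
  have V_int: "V integrable_on ?S" and V_lim: "(\<lambda>n. integral ?S (D n)) \<longlonglongrightarrow> integral ?S V"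
    using dominated_convergence[of D ?S "\<lambda>_. C" V] D_int D_bound D_lim
    by (auto simp: has_integral_iff integrable_const_ivl)
  have "integral ?S (D n) = 0" for n using D_int by (simp add: has_integral_iff)
  then have V_zero: "integral ?S V = 0" using V_lim by (simp add: LIMSEQ_const_iff)
  have six: "integrable lborel (\<lambda>x. (w t x) ^ 6)" and lower: "\<kappa> * (LBINT x. (w t x) ^ 6) \<le> \<sigma> * V t" for t
  proof -
    interpret p: gkdv_profile f F c \<delta> "w t" "g t" by (rule prof)
    have "\<bar>w t x\<bar> ^ 6 \<le> \<bar>w t x\<bar> ^ 2" for x
      using p.small[of x] p.\<delta> by (intro power_decreasing) auto
    then show six: "integrable lborel (\<lambda>x. (w t x) ^ 6)"
      by (intro Bochner_Integration.integrable_bound[OF L2_integrable_square[OF p.v_L2]]) (auto simp: power_abs)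
    \<comment> \<open>By the energy identity, -3 times the integral of g^2 is -6 E minus 6 times
      that of F(w); together with the -2 already present this gives the coefficient 8.\<close>
    have "V t = - 6 * E + (LBINT x. 2 * w t x * f (w t x) - 8 * F (w t x))"
      using energy[of t] p.fv_v_integrable p.F_integrable
      by (simp add: V_def mult.assoc mult.commute[of "f _"])
    then have "\<sigma> * V t = - 6 * (\<sigma> * E) + (LBINT x. \<sigma> * (2 * w t x * f (w t x) - 8 * F (w t x)))"
      unfolding integral_mult_right_zero by (simp only: distrib_left mult.left_commute[of \<sigma>])
    moreover have "(LBINT x. \<kappa> * (w t x) ^ 6) \<le> (LBINT x. \<sigma> * (2 * w t x * f (w t x) - 8 * F (w t x)))"
      using six p.fv_v_integrable p.F_integrable sign p.small
      by (intro integral_mono) (auto simp: mult.assoc mult.commute[of "f _"])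
    ultimately show "\<kappa> * (LBINT x. (w t x) ^ 6) \<le> \<sigma> * V t" using \<sigma> by simp
  qed
  have nn: "0 \<le> \<sigma> * V t" for t
    by (rule order_trans[OF _ lower]) (use \<kappa> in simp)
  have pos: "0 < \<sigma> * V t" if nz: "L2wnorm (w t) \<noteq> 0" for t
  proof (rule ccontr)
    assume "\<not> 0 < \<sigma> * V t"
    then have "\<kappa> * (LBINT x. (w t x) ^ 6) \<le> 0" using lower[of t] by linarith
    then have "(LBINT x. (w t x) ^ 6) \<le> 0" using \<kappa> by (simp add: mult_le_0_iff)
    moreover have "0 \<le> (LBINT x. (w t x) ^ 6)" by simp
    ultimately have "(LBINT x. (w t x) ^ 6) = 0" by linarith
    then have "AE x in lborel. (w t x) ^ 6 = 0" using integral_nonneg_eq_0_iff_AE[OF six] by simp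
    then have "AE x in lborel. (wt x * w t x)\<^sup>2 = 0" by eventually_elim simp
    then have "(LBINT x. (wt x * w t x)\<^sup>2) = 0" by (simp add: integral_eq_zero_AE)
    then show False using nz by (simp add: L2wnorm_def L2norm_def)
  qed
  have "0 < L2wnorm (w a)" using nontrivial L2wnorm_nonneg[of "w a"] by linarith
  with norm_cont[of a] have "\<forall>\<^sub>F s in at a. 0 < L2wnorm (w s)"
    unfolding isCont_def by (rule order_tendstoD)
  then obtain d where d: "0 < d" "\<And>s. s \<noteq> a \<Longrightarrow> dist s a < d \<Longrightarrow> 0 < L2wnorm (w s)"
    unfolding eventually_at by blast
  \<comment> \<open>Half of d keeps the points at distance strictly less than d from a, and \<omega>
    keeps them inside one period.\<close>
  define b where "b = a + min (d / 2) \<omega>"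
  show False
  proof (rule positive_integral_contradiction[of "\<lambda>t. \<sigma> * V t" a "a + \<omega>" b])
    show "(\<lambda>t. \<sigma> * V t) integrable_on ?S" using integrable_cmul[OF V_int, of \<sigma>] by simp
    show "integral ?S (\<lambda>t. \<sigma> * V t) = 0" using V_zero by simp
    fix t assume t: "t \<in> {a..b}"
    have "L2wnorm (w t) \<noteq> 0"
    proof (cases "t = a")
      case False
      then have "dist t a < d" using t d(1) by (auto simp: b_def dist_real_def)
      then show ?thesis using d(2)[OF False] by simp
    qed (simp add: nontrivial)
    then show "0 < \<sigma> * V t" by (rule pos)
  qed (use nn d(1) \<omega> in \<open>auto simp: b_def\<close>)
qed

section \<open>Estimates for the nonlinearity\<close>

lemma has_real_derivative_primitive0:
  assumes f: "continuous_on UNIV f"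
  shows "(primitive0 f has_real_derivative f y) (at y)"
proof -
  \<comment> \<open>The interval from \<open>-?R\<close> to \<open>?R\<close> contains the base
    point 0 and has y in its interior, so the derivative within it is the full one.\<close>
  let ?R = "\<bar>y\<bar> + 1"
  have "((\<lambda>u. LBINT s=ereal 0..ereal u. f s) has_vector_derivative f y) (at y within {-?R..?R})"
    by (rule interval_integral_FTC2) (use f continuous_on_subset in auto)
  moreover have "at y within {-?R..?R} = at y"
    by (rule at_within_interior) (auto simp: interior_atLeastAtMost_real abs_if)
  ultimately show ?thesis
    unfolding has_real_derivative_iff_has_vector_derivative by (simp add: primitive0_def[abs_def])
qed

lemma primitive0_zero: "primitive0 f 0 = 0"
  by (simp add: primitive0_def)

text \<open>The constants depend on f5 and \<beta>, not on the energy; \<delta> is the source of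
  \<epsilon>.\<close>

lemma nonlinearity_estimates:
  fixes f5 f :: "real \<Rightarrow> real" and \<beta> :: real
  assumes C: "C_k 5 f5" and small: "((\<lambda>s. f5 s / \<bar>s\<bar> ^ 5) \<longlongrightarrow> 0) (at 0)"
    and f: "f = (\<lambda>s. s ^ 3 + \<beta> * s ^ 5 + f5 s)" and \<beta>: "\<beta> \<noteq> 0"
  obtains \<delta> c L where "continuous_on UNIV f" "0 < \<delta>" "\<delta> \<le> 1" "0 \<le> c" "0 \<le> L"
    "\<And>s. \<bar>s\<bar> \<le> \<delta> \<Longrightarrow> \<bar>f s\<bar> \<le> c * \<bar>s\<bar> ^ 3"
    "\<And>a b. \<bar>a\<bar> \<le> \<delta> \<Longrightarrow> \<bar>b\<bar> \<le> \<delta> \<Longrightarrow> \<bar>f a - f b\<bar> \<le> L * \<bar>a - b\<bar>"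
    "\<And>y. \<bar>y\<bar> \<le> \<delta> \<Longrightarrow> \<bar>\<beta>\<bar> / 6 * y ^ 6 \<le> sgn \<beta> * (2 * y * f y - 8 * primitive0 f y)"
proof -
  have df: "f5 differentiable at x" "deriv f5 differentiable at x" for x
    using C[unfolded C_k_def, THEN conjunct1, rule_format, of 0 x] C[unfolded C_k_def, THEN conjunct1, rule_format, of 1 x] by simp_all
  have f5d: "(f5 has_real_derivative deriv f5 x) (at x)" for x
    using df(1) DERIV_deriv_iff_real_differentiable by blast
  have cf5: "continuous_on UNIV f5"
    by (intro continuous_at_imp_continuous_on ballI DERIV_isCont[OF f5d])
  have cdf5: "continuous_on UNIV (deriv f5)"
    by (intro continuous_at_imp_continuous_on ballI differentiable_imp_continuous_within df(2))
  define f' where "f' s = 3 * s ^ 2 + 5 * \<beta> * s ^ 4 + deriv f5 s" for s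
  have fd: "(f has_real_derivative f' s) (at s)" for s
    unfolding f f'_def by (auto intro!: derivative_eq_intros f5d)
  have cf': "continuous_on UNIV f'" unfolding f'_def by (intro continuous_intros cdf5)
  have cf: "continuous_on UNIV f"
    by (intro continuous_at_imp_continuous_on ballI DERIV_isCont[OF fd])
  \<comment> \<open>The errors 2 y f5(y) and 8 \<open>F5 y\<close> total at most 10 \<eta> y^6 =
    |\<beta>|/2 y^6, against the leading 2/3 |\<beta>| y^6; the difference is |\<beta>|/6
    y^6.\<close>
  define \<eta> where "\<eta> = \<bar>\<beta>\<bar> / 20"
  have \<eta>: "0 < \<eta>" using \<beta> by (simp add: \<eta>_def)
  obtain d where d: "0 < d" "\<And>s. s \<noteq> 0 \<Longrightarrow> \<bar>s\<bar> < d \<Longrightarrow> \<bar>f5 s / \<bar>s\<bar> ^ 5\<bar> < \<eta>"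
    using LIM_D[OF small \<eta>] by (auto simp: dist_real_def)
  \<comment> \<open>The limit is over nonzero s and says nothing about f5(0) by itself; multiplying
    back by |s|^5 and continuity of f5 give the value.\<close>
  have f50: "f5 0 = 0"
  proof -
    have "((\<lambda>s. (f5 s / \<bar>s\<bar> ^ 5) * \<bar>s\<bar> ^ 5) \<longlongrightarrow> 0 * \<bar>0\<bar> ^ 5) (at 0)"
      by (intro tendsto_intros small)
    moreover have "\<forall>\<^sub>F s in at 0. (f5 s / \<bar>s\<bar> ^ 5) * \<bar>s\<bar> ^ 5 = f5 s"
      by (simp add: eventually_at_filter)
    ultimately have "(f5 \<longlongrightarrow> 0) (at 0)"
      by (simp add: tendsto_cong)
    moreover have "(f5 \<longlongrightarrow> f5 0) (at 0)" using DERIV_isCont[OF f5d] by (simp add: isCont_def)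
    ultimately show ?thesis using LIM_unique by blast
  qed
  define \<delta> where "\<delta> = min 1 (d / 2)"
  have \<delta>: "0 < \<delta>" "\<delta> \<le> 1" "\<delta> < d" using d(1) by (auto simp: \<delta>_def)
  have f5_le: "\<bar>f5 s\<bar> \<le> \<eta> * \<bar>s\<bar> ^ 5" if "\<bar>s\<bar> \<le> \<delta>" for s
  proof (cases "s = 0")
    case False
    then have "\<bar>f5 s / \<bar>s\<bar> ^ 5\<bar> < \<eta>" using that \<delta>(3) by (intro d(2)) auto
    then show ?thesis using False by (simp add: abs_divide divide_less_eq power_abs)
  qed (simp add: f50)
  define c where "c = 1 + \<bar>\<beta>\<bar> + \<eta>"
  have f_le: "\<bar>f s\<bar> \<le> c * \<bar>s\<bar> ^ 3" if s: "\<bar>s\<bar> \<le> \<delta>" for s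
  proof -
    have p: "\<bar>s\<bar> ^ 5 \<le> \<bar>s\<bar> ^ 3" using s \<delta> by (intro power_decreasing) auto
    have "\<bar>f s\<bar> \<le> \<bar>s ^ 3\<bar> + \<bar>\<beta> * s ^ 5\<bar> + \<bar>f5 s\<bar>" unfolding f by linarith
    also have "\<dots> \<le> \<bar>s\<bar> ^ 3 + \<bar>\<beta>\<bar> * \<bar>s\<bar> ^ 3 + \<eta> * \<bar>s\<bar> ^ 3"
    proof (intro add_mono)
      show "\<bar>\<beta> * s ^ 5\<bar> \<le> \<bar>\<beta>\<bar> * \<bar>s\<bar> ^ 3"
        using mult_left_mono[OF p, of "\<bar>\<beta>\<bar>"] by (simp add: abs_mult power_abs)
      show "\<bar>f5 s\<bar> \<le> \<eta> * \<bar>s\<bar> ^ 3"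
        by (rule order_trans[OF f5_le[OF s] mult_left_mono[OF p]]) (use \<eta> in simp)
    qed (simp add: power_abs)
    finally show ?thesis by (simp add: c_def algebra_simps)
  qed
  have "bounded (f' ` {-\<delta>..\<delta>})"
    by (intro compact_imp_bounded compact_continuous_image continuous_on_subset[OF cf']) auto
  then obtain L where L: "\<And>s. s \<in> {-\<delta>..\<delta>} \<Longrightarrow> \<bar>f' s\<bar> \<le> L"
    unfolding bounded_iff by (metis imageI real_norm_def)
  have L0: "0 \<le> L" using L[of 0] \<delta> by auto
  have lip: "\<bar>f a - f b\<bar> \<le> L * \<bar>a - b\<bar>" if "\<bar>a\<bar> \<le> \<delta>" "\<bar>b\<bar> \<le> \<delta>" for a b
  proof -
    have "\<bar>f a - f b - (a - b) * 0\<bar> \<le> \<bar>a - b\<bar> * L"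
    proof (rule increment_estimate[OF fd])
      fix s assume "min a b \<le> s" "s \<le> max a b"
      then have "s \<in> {-\<delta>..\<delta>}" using that by auto
      then show "\<bar>f' s - 0\<bar> \<le> L" using L by simp
    qed
    then show ?thesis by (simp add: mult.commute)
  qed
  have sign: "\<bar>\<beta>\<bar> / 6 * y ^ 6 \<le> sgn \<beta> * (2 * y * f y - 8 * primitive0 f y)" if y: "\<bar>y\<bar> \<le> \<delta>" for y
  proof -
    \<comment> \<open>The primitive of f5 that vanishes at 0, obtained by removing the polynomial
      part from the primitive of f.\<close>
    define F5 where "F5 s = primitive0 f s - s ^ 4 / 4 - \<beta> * s ^ 6 / 6" for s
    have F5d: "(F5 has_real_derivative f5 s) (at s)" for s
    proof -
      have "(F5 has_real_derivative f s - s ^ 3 - \<beta> * s ^ 5) (at s)"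
        unfolding F5_def by (rule derivative_eq_intros has_real_derivative_primitive0[OF cf] refl | simp)+
      then show ?thesis by (simp add: f)
    qed
    have y6: "\<bar>y\<bar> * \<bar>y\<bar> ^ 5 = y ^ 6" by (simp add: power_abs flip: power_Suc)
    have "\<bar>F5 y - F5 0 - (y - 0) * 0\<bar> \<le> \<bar>y - 0\<bar> * (\<eta> * \<bar>y\<bar> ^ 5)"
    proof (rule increment_estimate[OF F5d])
      fix s assume "min y 0 \<le> s" "s \<le> max y 0"
      then have s: "\<bar>s\<bar> \<le> \<bar>y\<bar>" by linarith
      then have "\<bar>f5 s\<bar> \<le> \<eta> * \<bar>s\<bar> ^ 5" using y by (intro f5_le) linarith
      also have "\<dots> \<le> \<eta> * \<bar>y\<bar> ^ 5" using s \<eta> by (intro mult_left_mono power_mono) auto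
      finally show "\<bar>f5 s - 0\<bar> \<le> \<eta> * \<bar>y\<bar> ^ 5" by simp
    qed
    then have F5_le: "\<bar>F5 y\<bar> \<le> \<eta> * y ^ 6"
      by (simp add: F5_def primitive0_zero y6[symmetric] mult.left_commute)
    have "\<bar>y * f5 y\<bar> \<le> \<bar>y\<bar> * (\<eta> * \<bar>y\<bar> ^ 5)"
      unfolding abs_mult by (rule mult_left_mono[OF f5_le[OF y]]) simp
    then have yf5: "\<bar>y * f5 y\<bar> \<le> \<eta> * y ^ 6" by (simp add: y6[symmetric] mult.left_commute)
    have eq: "2 * y * f y - 8 * primitive0 f y = 2/3 * (\<beta> * y ^ 6) + (2 * (y * f5 y) - 8 * F5 y)"
      unfolding F5_def f by (simp add: algebra_simps power_Suc[symmetric] eval_nat_numeral)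
    have rest: "\<bar>2 * (y * f5 y) - 8 * F5 y\<bar> \<le> \<bar>\<beta>\<bar> / 2 * y ^ 6"
      using yf5 F5_le abs_triangle_ineq4[of "2 * (y * f5 y)" "8 * F5 y"] by (simp add: \<eta>_def abs_mult)
    have sb: "\<bar>\<beta>\<bar> = sgn \<beta> * \<beta>" by (simp add: abs_sgn mult.commute)
    have "- \<bar>2 * (y * f5 y) - 8 * F5 y\<bar> \<le> sgn \<beta> * (2 * (y * f5 y) - 8 * F5 y)"
      using \<beta> by (auto simp: sgn_if)
    moreover have "sgn \<beta> * (2/3 * (\<beta> * y ^ 6)) = 2/3 * (\<bar>\<beta>\<bar> * y ^ 6)" unfolding sb by simp
    ultimately show ?thesis using rest unfolding eq distrib_left by linarith
  qed
  show ?thesis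
    by (rule that[OF cf \<delta>(1,2) _ L0 f_le lip sign]) (use \<eta> in \<open>auto simp: c_def\<close>)
qed

section \<open>Continuous representatives and conclusion\<close>

lemma has_weak_deriv_cong:
  assumes v: "has_weak_deriv v g" and [measurable]: "w \<in> borel_measurable borel" and ae: "AE x in lborel. v x = w x"
  shows "has_weak_deriv w g"
proof -
  have li: "locally_integrable v" "locally_integrable g" using v by (auto simp: has_weak_deriv_def)
  have [measurable]: "v \<in> borel_measurable borel" using li(1) by measurable
  have "locally_integrable w"
  proof (rule locally_integrableI)
    fix a b
    show "integrable lborel (\<lambda>x. indicator {a..b} x * w x)"
      by (rule Bochner_Integration.integrable_cong_AE_imp[OF locally_integrable_indicator[OF li(1), of a b]]) (use ae in auto)
  qed measurable
  moreover have "(LBINT x. w x * deriv \<phi> x) = - (LBINT x. g x * \<phi> x)" if \<phi>: "test_function \<phi>" for \<phi>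
  proof -
    have "continuous_on UNIV (deriv \<phi>)" using \<phi> unfolding test_function_def C_k_def by (metis funpow_0 funpow.simps(2) comp_apply One_nat_def)
    then have [measurable]: "deriv \<phi> \<in> borel_measurable borel" by (rule borel_measurable_continuous_onI)
    have "(LBINT x. w x * deriv \<phi> x) = (LBINT x. v x * deriv \<phi> x)"
      by (rule integral_cong_AE) (use ae in auto)
    then show ?thesis using v \<phi> by (simp add: has_weak_deriv_def)
  qed
  ultimately show ?thesis using li by (simp add: has_weak_deriv_def)
qed

lemma test_function_measurable:
  assumes "test_function \<phi>"
  shows "(deriv ^^ n) \<phi> \<in> borel_measurable borel"
  using assms by (intro borel_measurable_continuous_onI) (auto simp: test_function_def C_k_def)

text \<open>The definitions speak of classes modulo null sets and of a chosen weak derivative.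
  Pointwise bounds and integration by parts need one continuous w with a square integrable
  derivative g; the H^1 norm is expressed through this pair.\<close>

lemma H1_weighted_representative:
  assumes v: "v \<in> H1_weighted (1/2)"
  obtains w g where "w \<in> L2w" "g \<in> L2" "has_weak_deriv w g" "primitive_of w g"
    "AE x in lborel. v x = w x" "AE x in lborel. weak_deriv v x = g x" "v \<in> borel_measurable borel"
    "(H1_norm v)\<^sup>2 = (LBINT x. (w x)\<^sup>2) + (LBINT x. (g x)\<^sup>2)"
proof -
  have H1: "v \<in> H1" and xv: "integrable lborel (\<lambda>x. \<bar>x\<bar> * (v x)\<^sup>2)"
    using v by (auto simp: H1_weighted_def)
  have v2: "v \<in> L2" using H1 by (simp add: H1_def)
  have [measurable]: "v \<in> borel_measurable borel" by (rule L2_measurable[OF v2])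
  obtain g where g: "g \<in> L2" "has_weak_deriv v g" "AE x in lborel. weak_deriv v x = g x"
    using H1_weak_deriv[OF H1] by blast
  have [measurable]: "g \<in> borel_measurable borel" by (rule L2_measurable[OF g(1)])
  obtain w where w: "AE x in lborel. v x = w x" "primitive_of w g"
    using H1_representative[OF v2 g(1,2)] by blast
  have [measurable]: "w \<in> borel_measurable borel"
    by (rule borel_measurable_continuous_onI[OF primitive_of_continuous[OF w(2) g(1)]])
  have "integrable lborel (\<lambda>x. (v x)\<^sup>2 + \<bar>x\<bar> * (v x)\<^sup>2)"
    using L2_integrable_square[OF v2] xv by simp
  then have "integrable lborel (\<lambda>x. (wt x * w x)\<^sup>2)"
    by (rule Bochner_Integration.integrable_cong_AE_imp)
       (use w(1) in \<open>auto simp: power_mult_distrib wt_square distrib_right elim!: eventually_mono\<close>)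
  then have "(\<lambda>x. wt x * w x) \<in> L2" by (intro L2I) measurable
  then have wL: "w \<in> L2w" by (simp add: L2w_def)
  have [measurable]: "weak_deriv v \<in> borel_measurable borel"
  proof -
    have "has_weak_deriv v (weak_deriv v)" unfolding weak_deriv_def by (rule someI[of _ g]) (rule g)
    then show ?thesis by (simp add: has_weak_deriv_def locally_integrable_def)
  qed
  have "(LBINT x. (v x)\<^sup>2) = (LBINT x. (w x)\<^sup>2)"
    by (rule integral_cong_AE) (use w(1) in \<open>auto elim!: eventually_mono\<close>)
  moreover have "(LBINT x. (weak_deriv v x)\<^sup>2) = (LBINT x. (g x)\<^sup>2)"
    by (rule integral_cong_AE) (use g(3) in \<open>auto elim!: eventually_mono\<close>)
  ultimately have "(H1_norm v)\<^sup>2 = (LBINT x. (w x)\<^sup>2) + (LBINT x. (g x)\<^sup>2)"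
    by (simp add: H1_norm_def)
  then show ?thesis
    using that[OF wL g(1) has_weak_deriv_cong[OF g(2) _ w(1)] w(2) w(1) g(3)] by simp
qed

theorem theorem1p4:
  fixes f5 f :: "real \<Rightarrow> real" and \<beta> E :: real
  assumes "C_k 5 f5"
    and "((\<lambda>s. f5 s / \<bar>s\<bar> ^ 5) \<longlongrightarrow> 0) (at 0)"
    and "f = (\<lambda>s. s ^ 3 + \<beta> * s ^ 5 + f5 s)"
    and "(\<beta> < 0 \<and> E \<ge> 0) \<or> (\<beta> > 0 \<and> E \<le> 0)"
  shows "\<exists>\<epsilon>>0. \<forall>u0 u.
           strong_solution (1/2) f u0 u \<and> bounded_in_H1 u \<and>
           \<not> (\<forall>t. AE x in lborel. u t x = 0) \<and>
           I3 f u0 = E \<and> (\<forall>t. I3 f (u t) = I3 f u0) \<and>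
           (SUP t. H1_norm (u t)) < \<epsilon>
           \<longrightarrow> \<not> time_periodic u"
proof -
  have \<beta>: "\<beta> \<noteq> 0" using assms(4) by auto
  obtain \<delta> c L where cf: "continuous_on UNIV f" and \<delta>: "0 < \<delta>" "\<delta> \<le> 1" and c: "0 \<le> c" and L: "0 \<le> L"
    and cubic: "\<And>s. \<bar>s\<bar> \<le> \<delta> \<Longrightarrow> \<bar>f s\<bar> \<le> c * \<bar>s\<bar> ^ 3"
    and lip: "\<And>a b. \<bar>a\<bar> \<le> \<delta> \<Longrightarrow> \<bar>b\<bar> \<le> \<delta> \<Longrightarrow> \<bar>f a - f b\<bar> \<le> L * \<bar>a - b\<bar>"
    and sign: "\<And>y. \<bar>y\<bar> \<le> \<delta> \<Longrightarrow> \<bar>\<beta>\<bar> / 6 * y ^ 6 \<le> sgn \<beta> * (2 * y * f y - 8 * primitive0 f y)"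
    by (rule nonlinearity_estimates[OF assms(1-3) \<beta>]) (rule that)
  let ?F = "primitive0 f"
  have F': "(?F has_real_derivative f s) (at s)" for s by (rule has_real_derivative_primitive0[OF cf])
  have cF: "continuous_on UNIV ?F" by (intro continuous_at_imp_continuous_on ballI DERIV_isCont[OF F'])
  have [measurable]: "f \<in> borel_measurable borel" "?F \<in> borel_measurable borel"
    by (rule borel_measurable_continuous_onI[OF cf], rule borel_measurable_continuous_onI[OF cF])
  have f0: "f 0 = 0" using cubic[of 0] \<delta> by simp
  \<comment> \<open>\<delta>/2 serves as \<epsilon>: the Sobolev bound of w^2 by twice the squared
    H^1 norm turns it into |w| <= \<delta>, the range of all estimates for f.\<close>
  have "False" if sol: "strong_solution (1/2) f u0 u" and bdd: "bounded_in_H1 u"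
    and nontriv: "\<not> (\<forall>t. AE x in lborel. u t x = 0)" and en0: "I3 f u0 = E" and en: "\<forall>t. I3 f (u t) = I3 f u0"
    and sup: "(SUP t. H1_norm (u t)) < \<delta> / 2" and per: "time_periodic u" for u0 u
  proof -
    have uW: "u t \<in> H1_weighted (1/2)" and eq: "satisfies_gKdV f u"
      and ucont: "((\<lambda>s. H1_weighted_norm (1/2) (\<lambda>x. u s x - u t x)) \<longlongrightarrow> 0) (at t)" for t
      using sol by (auto simp: strong_solution_def continuous_in_H1_weighted_def)
    \<comment> \<open>One predicate for the pair, so that w(t) and g(t) are chosen together for all
      t.\<close>
    define good where "good t w g \<longleftrightarrow> w \<in> L2w \<and> g \<in> L2 \<and> has_weak_deriv w g \<and> primitive_of w g \<and>
      (AE x in lborel. u t x = w x) \<and> (AE x in lborel. weak_deriv (u t) x = g x) \<and>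
      (H1_norm (u t))\<^sup>2 = (LBINT x. (w x)\<^sup>2) + (LBINT x. (g x)\<^sup>2)" for t w g
    have "\<exists>w g. good t w g" for t
      by (rule H1_weighted_representative[OF uW[of t]]) (auto simp: good_def)
    then obtain w g where "good t (w t) (g t)" for t by metis
    then have wL: "w t \<in> L2w" and gL: "g t \<in> L2" and wd: "has_weak_deriv (w t) (g t)" and prim: "primitive_of (w t) (g t)"
      and uw: "AE x in lborel. u t x = w t x" and ug: "AE x in lborel. weak_deriv (u t) x = g t x"
      and nrm: "(H1_norm (u t))\<^sup>2 = (LBINT x. (w t x)\<^sup>2) + (LBINT x. (g t x)\<^sup>2)" for t
      by (auto simp: good_def)
    have [measurable]: "u t \<in> borel_measurable borel" "w t \<in> borel_measurable borel" "g t \<in> borel_measurable borel" for t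
      using uW[of t] wL[of t] gL[of t] by (auto simp: H1_weighted_def H1_def L2_measurable L2w_measurable)
    have [measurable]: "weak_deriv (u t) \<in> borel_measurable borel" for t
    proof -
      obtain h where h: "has_weak_deriv (u t) h" using uW[of t] by (auto simp: H1_weighted_def H1_def)
      have "has_weak_deriv (u t) (weak_deriv (u t))" unfolding weak_deriv_def by (rule someI[of _ h]) (rule h)
      then show ?thesis by (simp add: has_weak_deriv_def locally_integrable_def)
    qed
    have H1n: "H1_norm (u t) \<le> \<delta> / 2" for t
    proof -
      \<comment> \<open>Boundedness in H^1 is what makes this supremum an upper bound.\<close>
      have "H1_norm (u t) \<le> (SUP t. H1_norm (u t))"
        using bdd by (intro cSUP_upper) (auto simp: bounded_in_H1_def)
      then show ?thesis using sup by simp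
    qed
    have H1n0: "0 \<le> H1_norm (u t)" for t by (simp add: H1_norm_def)
    have gA: "L2norm (g t) \<le> \<delta> / 2" for t
    proof -
      have "(L2norm (g t))\<^sup>2 \<le> (H1_norm (u t))\<^sup>2" unfolding nrm by (simp add: L2norm_def)
      then show ?thesis using H1n[of t] H1n0[of t] power2_le_imp_le order_trans by blast
    qed
    have small: "\<bar>w t x\<bar> \<le> \<delta>" for t x
    proof -
      have wi: "integrable lborel (\<lambda>x. (w t x)\<^sup>2)" and gi: "integrable lborel (\<lambda>x. (g t x)\<^sup>2)"
        by (rule L2_integrable_square[OF L2w_L2[OF wL]], rule L2_integrable_square[OF gL])
      have "1 * (w t x)\<^sup>2 \<le> (LBINT z. 2 * (1 * w t z)\<^sup>2 + (g t z)\<^sup>2)"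
        by (rule weighted_sup_bound[OF prim L2w_L2[OF wL] gL]) (use L2w_L2[OF wL] in auto)
      also have "\<dots> \<le> 2 * (H1_norm (u t))\<^sup>2" unfolding nrm using wi gi by simp
      also have "\<dots> \<le> 2 * (\<delta> / 2)\<^sup>2" using H1n[of t] H1n0[of t] by (intro mult_left_mono power_mono) auto
      also have "\<dots> \<le> \<delta>\<^sup>2" by (simp add: power_divide)
      finally show ?thesis using \<delta> by (simp add: abs_le_square_iff[symmetric])
    qed
    \<comment> \<open>The density 1 + |x| collects the plain and the weighted L2 parts of the norm,
      as |x| \<open>powr\<close> 1 = |x|; the part with the weak derivative is discarded.\<close>
    have diff_le: "L2wnorm (\<lambda>x. w s x - w t x) \<le> H1_weighted_norm (1/2) (\<lambda>x. u s x - u t x)" for s t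
    proof -
      let ?d = "\<lambda>x. u s x - u t x"
      have ae: "AE x in lborel. (wt x * (w s x - w t x))\<^sup>2 = (?d x)\<^sup>2 + \<bar>x\<bar> * (?d x)\<^sup>2"
        using uw[of s] uw[of t] by eventually_elim (simp add: power_mult_distrib wt_square distrib_right)
      have di: "integrable lborel (\<lambda>x. (wt x * (w s x - w t x))\<^sup>2)"
        by (rule L2_integrable_square[OF L2w_weighted[OF L2w_diff[OF wL wL]]])
      have d1: "integrable lborel (\<lambda>x. (?d x)\<^sup>2)"
        by (rule Bochner_Integration.integrable_bound[OF di]) (use ae in \<open>auto elim!: eventually_mono\<close>)
      have d2: "integrable lborel (\<lambda>x. \<bar>x\<bar> * (?d x)\<^sup>2)"
        by (rule Bochner_Integration.integrable_bound[OF di]) (use ae in \<open>auto elim!: eventually_mono\<close>)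
      have "(LBINT x. (wt x * (w s x - w t x))\<^sup>2) = (LBINT x. (?d x)\<^sup>2 + \<bar>x\<bar> * (?d x)\<^sup>2)"
        by (rule integral_cong_AE) (use ae in auto)
      also have "\<dots> = (LBINT x. (?d x)\<^sup>2) + (LBINT x. \<bar>x\<bar> * (?d x)\<^sup>2)" using d1 d2 by simp
      also have "\<dots> \<le> (H1_norm ?d)\<^sup>2 + (LBINT x. \<bar>x\<bar> powr (2 * (1/2)) * (?d x)\<^sup>2)"
        by (simp add: H1_norm_def)
      finally show ?thesis unfolding L2wnorm_def L2norm_def H1_weighted_norm_def by (rule real_sqrt_le_mono)
    qed
    have flow: "gkdv_flow f L \<delta> w"
    proof
      fix t
      show "((\<lambda>s. L2wnorm (\<lambda>x. w s x - w t x)) \<longlongrightarrow> 0) (at t)"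
        by (rule Lim_null_comparison[OF _ ucont[of t]]) (use diff_le in auto)
    next
      \<comment> \<open>The weak equation only sees integrals, which do not change when u is
        replaced by its representative.\<close>
      show "satisfies_gKdV f w"
        unfolding satisfies_gKdV_def
      proof (intro allI impI)
        fix \<phi> t assume \<phi>: "test_function \<phi>"
        have [measurable]: "\<phi> \<in> borel_measurable borel" "deriv \<phi> \<in> borel_measurable borel" "(deriv ^^ 3) \<phi> \<in> borel_measurable borel"
          using test_function_measurable[OF \<phi>, of 0] test_function_measurable[OF \<phi>, of 1] test_function_measurable[OF \<phi>, of 3] by simp_all
        have "(LBINT x. u s x * \<phi> x) = (LBINT x. w s x * \<phi> x)" for s
          by (rule integral_cong_AE) (use uw[of s] in \<open>auto elim!: eventually_mono\<close>)
        moreover have "(LBINT x. u t x * (deriv ^^ 3) \<phi> x + f (u t x) * deriv \<phi> x) =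
            (LBINT x. w t x * (deriv ^^ 3) \<phi> x + f (w t x) * deriv \<phi> x)"
          by (rule integral_cong_AE) (use uw[of t] in \<open>auto elim!: eventually_mono\<close>)
        moreover have "((\<lambda>s. LBINT x. u s x * \<phi> x) has_real_derivative
           (LBINT x. u t x * (deriv ^^ 3) \<phi> x + f (u t x) * deriv \<phi> x)) (at t)"
          using eq \<phi> unfolding satisfies_gKdV_def by blast
        ultimately show "((\<lambda>s. LBINT x. w s x * \<phi> x) has_real_derivative
           (LBINT x. w t x * (deriv ^^ 3) \<phi> x + f (w t x) * deriv \<phi> x)) (at t)" by simp
      qed
    qed (use cf f0 L lip wL small in auto)
    have prof: "gkdv_profile f ?F c \<delta> (w t) (g t)" for t
      by unfold_locales (use cf F' primitive0_zero c cubic \<delta> wL gL wd prim small in auto)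
    have energy: "(LBINT x. (g t x)\<^sup>2) / 2 - (LBINT x. ?F (w t x)) = E" for t
    proof -
      have "I3 f (u t) = (LBINT x. (g t x)\<^sup>2 / 2 - ?F (w t x))"
        unfolding I3_def by (rule integral_cong_AE; (measurable)?) (use uw[of t] ug[of t] in eventually_elim, simp)
      also have "\<dots> = (LBINT x. (g t x)\<^sup>2) / 2 - (LBINT x. ?F (w t x))"
        using gkdv_profile.F_integrable[OF prof] L2_integrable_square[OF gL] by simp
      finally show ?thesis using en en0 by simp
    qed
    obtain \<omega> where \<omega>: "0 < \<omega>" "\<And>t. AE x in lborel. u (t + \<omega>) x = u t x" using per by (auto simp: time_periodic_def)
    have periodic: "L2wnorm (\<lambda>x. w (t + \<omega>) x - w t x) = 0" for t
    proof -
      have "AE x in lborel. (wt x * (w (t + \<omega>) x - w t x))\<^sup>2 = 0"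
        using uw[of t] uw[of "t + \<omega>"] \<omega>(2)[of t] by eventually_elim simp
      then show ?thesis by (simp add: L2wnorm_def L2norm_def integral_eq_zero_AE)
    qed
    obtain a where a: "\<not> (AE x in lborel. u a x = 0)" using nontriv by blast
    have "L2wnorm (w a) \<noteq> 0"
    proof
      assume "L2wnorm (w a) = 0"
      then have "(LBINT x. (wt x * w a x)\<^sup>2) = 0" by (simp add: L2wnorm_def L2norm_def)
      then have "AE x in lborel. (wt x * w a x)\<^sup>2 = 0"
        using integral_nonneg_eq_0_iff_AE[OF L2_integrable_square[OF L2w_weighted[OF wL[of a]]]] by simp
      then have "AE x in lborel. u a x = 0"
        using uw[of a] by eventually_elim (use wt_pos in \<open>auto simp: less_imp_neq[symmetric]\<close>)
      then show False using a by blast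
    qed
    moreover have "sgn \<beta> * E \<le> 0" using assms(4) by auto
    moreover have "0 < \<bar>\<beta>\<bar> / 6" using \<beta> by simp
    ultimately show False
      using no_periodic_flow[OF flow prof gA \<omega>(1) periodic energy _ _ sign] by blast
  qed
  then show ?thesis using \<delta>(1) by (intro exI[of _ "\<delta> / 2"]) auto
qed

end
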